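(* Let $d\ge 1$. There exists a constant $M>0$ depending only on $d$ such that for all bistochastic measures $\mu$ and $\nu$ on $\mathbb{T}^d$, \[ \mathcal{A}(\nu) \le \mathcal{A}(\mu) + M\, d_{MK}(\mu,\nu)^{1/(d+3)} . \] Consequently (the roles of $\mu$ and $\nu$ being symmetric), $\mathcal{A}$ is $1/(d+3)$-H\"older continuous with respect to $d_{MK}$ on the set of bistochastic measures on $\mathbb{T}^d$; for example, if $d=3$, it is $1/6$-H\"older continuous.
   Context: $\mathbb{T}^d=\mathbb{R}^d/\mathbb{Z}^d$ and $\lambda$ is the Lebesgue measure on $\mathbb{T}^d$. A bistochastic measure on $\mathbb{T}^d$ is a positive Radon measure on $\mathbb{T}^d\times\mathbb{T}^d$ both of whose marginals equal $\lambda$. $d_{MK}$ is the Monge-Kantorovich (Wasserstein) distance of exponent $2$ on Borel probability measures on $(\mathbb{T}^d)^2$, associated with the Euclidean (flat) distance on $(\mathbb{T}^d)^2$. Let $\mathcal{C}=C^0([0,1];\mathbb{T}^d)$ (with the supremum distance). A generalized flow is a (positive) Borel measure $\eta$ on $\mathcal{C}$. For a curve $\omega\in\mathcal{C}$, its action is $A(\omega)=\frac12\int_0^1|\dot\omega(t)|^2\,dt$ if $\omega$ is absolutely continuous and $A(\omega)=+\infty$ otherwise; the action of a generalized flow is $\mathcal{A}(\eta)=\int A(\omega)\,d\eta(\omega)$. Given a bistochastic measure $\gamma$, a generalized flow $\eta$ is admissible for the problem $\mathsf{Pb}(\gamma)$ if: (i) for every nonnegative measurable $\varphi$ on $\mathbb{T}^d\times\mathbb{T}^d$,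 $\int\varphi(\omega(0),\omega(1))\,d\eta(\omega)=\int\varphi\,d\gamma$; (ii) for every $t\in[0,1]$ the law of $\omega(t)$ under $\eta$ is $\lambda$; (iii) $\mathcal{A}(\eta)<+\infty$. $\mathcal{A}(\gamma)$ denotes the minimum of $\mathcal{A}(\eta)$ over all flows $\eta$ admissible for $\mathsf{Pb}(\gamma)$ (it is known that admissible flows and minimizers exist for every bistochastic $\gamma$, and that $\mathcal{A}(\gamma)$ is bounded uniformly in $\gamma$). *)

theory Defs
  imports "HOL-Analysis.Analysis"
begin

quotient_type 'd torus = "real ^ 'd :: finite" / "\<lambda>x y. \<forall>i. x $ i - y $ i \<in> \<int>"
  morphisms rep_torus to_torus
proof (rule equivpI)
  show "reflp (\<lambda>x y :: real ^ 'd. \<forall>i. x $ i - y $ i \<in> \<int>)"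
    by (simp add: reflp_def)
  show "symp (\<lambda>x y :: real ^ 'd. \<forall>i. x $ i - y $ i \<in> \<int>)"
  proof (rule sympI)
    fix x y :: "real ^ 'd"
    assume xy: "\<forall>i. x $ i - y $ i \<in> \<int>"
    show "\<forall>i. y $ i - x $ i \<in> \<int>"
    proof
      fix i
      have "- (x $ i - y $ i) \<in> \<int>" using xy by (intro Ints_minus) auto
      then show "y $ i - x $ i \<in> \<int>" by simp
    qed
  qed
  show "transp (\<lambda>x y :: real ^ 'd. \<forall>i. x $ i - y $ i \<in> \<int>)"
  proof (rule transpI)
    fix x y z :: "real ^ 'd"
    assume 1: "\<forall>i. x $ i - y $ i \<in> \<int>" and 2: "\<forall>i. y $ i - z $ i \<in> \<int>"
    show "\<forall>i. x $ i - z $ i \<in> \<int>"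
    proof
      fix i
      have "(x $ i - y $ i) + (y $ i - z $ i) \<in> \<int>"
        using 1 2 by (intro Ints_add) auto
      then show "x $ i - z $ i \<in> \<int>" by simp
    qed
  qed
qed

lemma to_torus_eq_iff: "to_torus x = to_torus y \<longleftrightarrow> (\<forall>i. x $ i - y $ i \<in> \<int>)"
  by (rule torus.abs_eq_iff)

lemma ex_to_torus: "\<exists>x. to_torus x = a"
  by (rule exI[of _ "rep_torus a"], rule Quotient_abs_rep[OF Quotient_torus])

definition torus_fibre :: "'d::finite torus \<Rightarrow> (real ^ 'd) set" where
  "torus_fibre a = {x. to_torus x = a}"

lemma torus_fibre_nonempty: "torus_fibre a \<noteq> {}"
  using ex_to_torus by (auto simp: torus_fibre_def)

lemma closed_torus_fibre: "closed (torus_fibre (a :: 'd::finite torus))"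
proof -
  obtain y where y: "to_torus y = a" using ex_to_torus by blast
  have "torus_fibre a = (\<Inter>i. (\<lambda>x. x $ i - y $ i) -` \<int>)"
    using y to_torus_eq_iff[of _ y] by (auto simp: torus_fibre_def)
  moreover have "closed ((\<lambda>x :: real ^ 'd. x $ i - y $ i) -` \<int>)" for i
    by (intro closed_vimage continuous_intros closed_Ints)
  ultimately show ?thesis by auto
qed

lemma setdist_torus_fibre:
  assumes "to_torus x = a"
  shows "setdist (torus_fibre a) (torus_fibre b) = infdist x (torus_fibre b)"
proof (rule antisym)
  have "x \<in> torus_fibre a" using assms by (simp add: torus_fibre_def)
  then show "setdist (torus_fibre a) (torus_fibre b) \<le> infdist x (torus_fibre b)"
    by (metis infdist_eq_setdist setdist_le_sing setdist_sym)
  show "infdist x (torus_fibre b) \<le> setdist (torus_fibre a) (torus_fibre b)"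
  proof (rule le_setdistI)
    fix y z assume "y \<in> torus_fibre a" "z \<in> torus_fibre b"
    then have y: "to_torus x = to_torus y" and z: "to_torus z = b"
      using assms by (auto simp: torus_fibre_def)
    have "to_torus (x - y + z) = to_torus z"
      using y by (simp add: to_torus_eq_iff)
    then have "x - y + z \<in> torus_fibre b" using z by (simp add: torus_fibre_def)
    then have "infdist x (torus_fibre b) \<le> dist x (x - y + z)" by (rule infdist_le)
    also have "\<dots> = dist y z" by (simp add: dist_norm)
    finally show "infdist x (torus_fibre b) \<le> dist y z" .
  qed (auto simp: torus_fibre_nonempty)
qed

text \<open>The type-class product metric on pairs is the Euclidean combination of the two distances, so
  this also fixes the flat distance on pairs of torus points.\<close>

instantiation torus :: (finite) metric_space
begin

definition dist_torus :: "'a torus \<Rightarrow> 'a torus \<Rightarrow> real" where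
  "dist_torus a b = setdist (torus_fibre a) (torus_fibre b)"

definition uniformity_torus :: "('a torus \<times> 'a torus) filter" where
  "uniformity_torus = (INF e\<in>{0<..}. principal {(x, y). dist x y < e})"

definition open_torus :: "'a torus set \<Rightarrow> bool" where
  "open_torus U \<longleftrightarrow> (\<forall>x\<in>U. \<forall>\<^sub>F (x', y) in uniformity. x' = x \<longrightarrow> y \<in> U)"

instance
proof
  fix a b c :: "'a torus"
  obtain x y where x: "to_torus x = a" and y: "to_torus y = b" using ex_to_torus by metis
  show "dist a b = 0 \<longleftrightarrow> a = b"
  proof -
    have "dist a b = 0 \<longleftrightarrow> x \<in> torus_fibre b"
      using in_closed_iff_infdist_zero[OF closed_torus_fibre torus_fibre_nonempty, of x b]
      by (simp add: dist_torus_def setdist_torus_fibre[OF x])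
    then show ?thesis using x by (simp add: torus_fibre_def)
  qed
  show "dist a b \<le> dist a c + dist b c"
  proof -
    obtain z where z: "to_torus z = c" using ex_to_torus by metis
    have 1: "infdist z (torus_fibre a) = dist a c" "infdist z (torus_fibre b) = dist b c"
      by (simp_all add: dist_torus_def setdist_torus_fibre[OF z, symmetric] setdist_sym)
    obtain u where u: "u \<in> torus_fibre a" "infdist z (torus_fibre a) = dist z u"
      using infdist_attains_inf[OF closed_torus_fibre torus_fibre_nonempty] by blast
    obtain v where v: "v \<in> torus_fibre b" "infdist z (torus_fibre b) = dist z v"
      using infdist_attains_inf[OF closed_torus_fibre torus_fibre_nonempty] by blast
    have "dist a b \<le> dist u v"
      unfolding dist_torus_def by (rule setdist_le_dist[OF u(1) v(1)])
    also have "\<dots> \<le> dist z u + dist z v" by (rule dist_triangle3)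
    finally show ?thesis using u(2) v(2) 1 by simp
  qed
qed (rule uniformity_torus_def open_torus_def)+

end

lemma dist_to_torus_le: "dist (to_torus x) (to_torus y) \<le> dist x y"
  unfolding dist_torus_def by (rule setdist_le_dist) (auto simp: torus_fibre_def)

lemma continuous_on_to_torus: "continuous_on S to_torus"
  unfolding continuous_on_iff using dist_to_torus_le le_less_trans by blast

lemma measurable_to_torus [measurable]: "to_torus \<in> borel \<rightarrow>\<^sub>M borel"
  by (rule borel_measurable_continuous_onI[OF continuous_on_to_torus])

definition torus_measure :: "'d::finite torus measure" where
  "torus_measure = distr (restrict_space lborel {x. \<forall>i. 0 \<le> x $ i \<and> x $ i < 1}) borel to_torus"

text \<open>Every finite Borel measure on the compact metric space of pairs is a Radon measure.\<close>

definition bistochastic :: "('d::finite torus \<times> 'd torus) measure \<Rightarrow> bool" where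
  "bistochastic \<gamma> \<longleftrightarrow> sets \<gamma> = sets borel \<and>
     distr \<gamma> borel fst = torus_measure \<and> distr \<gamma> borel snd = torus_measure"

definition couplings :: "'a::topological_space measure \<Rightarrow> 'a measure \<Rightarrow> ('a \<times> 'a) measure set" where
  "couplings \<mu> \<nu> =
     {\<pi>. sets \<pi> = sets borel \<and> distr \<pi> borel fst = \<mu> \<and> distr \<pi> borel snd = \<nu>}"

text \<open>For Borel probability measures on a bounded metric space the infimum is finite, so the
  conversion to a real number loses nothing.\<close>

definition monge_kantorovich :: "'a::metric_space measure \<Rightarrow> 'a measure \<Rightarrow> real" where
  "monge_kantorovich \<mu> \<nu> =
     sqrt (enn2real (INF \<pi>\<in>couplings \<mu> \<nu>. \<integral>\<^sup>+ z. ennreal ((dist (fst z) (snd z))\<^sup>2) \<partial>\<pi>))"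

text \<open>The continuous curves with the supremum distance; a curve takes the value \<open>undefined\<close> outside
  the unit interval.\<close>

definition path_metric :: "(real \<Rightarrow> 'd::finite torus) metric" where
  "path_metric = cfunspace (top_of_set {0..1}) euclidean_metric"

definition path_borel :: "(real \<Rightarrow> 'd::finite torus) measure" where
  "path_borel = sigma (mspace path_metric) {U. openin (mtopology_of path_metric) U}"

definition abs_continuous_on :: "real set \<Rightarrow> (real \<Rightarrow> 'a::metric_space) \<Rightarrow> bool" where
  "abs_continuous_on S f \<longleftrightarrow>
     (\<forall>\<epsilon>>0. \<exists>\<delta>>0. \<forall>I. finite I \<longrightarrow>
        (\<forall>(a, b)\<in>I. a \<le> b \<and> {a..b} \<subseteq> S) \<longrightarrow>
        disjoint_family_on (\<lambda>(a, b). {a<..<b}) I \<longrightarrow>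
        (\<Sum>(a, b)\<in>I. b - a) < \<delta> \<longrightarrow> (\<Sum>(a, b)\<in>I. dist (f a) (f b)) < \<epsilon>)"

text \<open>The derivative at \<open>t\<close> is computed in the covering space. The lift \<open>w\<close> is not required to be
  continuous away from \<open>t\<close>, which makes the notion local.\<close>

definition has_velocity :: "(real \<Rightarrow> 'd::finite torus) \<Rightarrow> real ^ 'd \<Rightarrow> real \<Rightarrow> bool" where
  "has_velocity \<omega> v t \<longleftrightarrow>
     (\<exists>w. (\<forall>s\<in>{0..1}. to_torus (w s) = \<omega> s) \<and> (w has_vector_derivative v) (at t within {0..1}))"

lemma has_velocity_unique:
  fixes \<omega> :: "real \<Rightarrow> 'd::finite torus"
  assumes "has_velocity \<omega> v t" "has_velocity \<omega> v' t" "t \<in> {0..1}"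
  shows "v = v'"
proof -
  obtain w where w: "\<And>s. s \<in> {0..1} \<Longrightarrow> to_torus (w s) = \<omega> s"
      "(w has_vector_derivative v) (at t within {0..1})"
    using assms(1) unfolding has_velocity_def by blast
  obtain w' where w': "\<And>s. s \<in> {0..1} \<Longrightarrow> to_torus (w' s) = \<omega> s"
      "(w' has_vector_derivative v') (at t within {0..1})"
    using assms(2) unfolding has_velocity_def by blast
  define u where "u = (\<lambda>s. w s - w' s)"
  have du: "(u has_vector_derivative (v - v')) (at t within {0..1})"
    unfolding u_def by (intro derivative_intros w w')
  have int: "u s $ i \<in> \<int>" if "s \<in> {0..1}" for s i
    using w(1)[OF that] w'(1)[OF that] to_torus_eq_iff[of "w s" "w' s"] by (simp add: u_def)
  have "continuous (at t within {0..1}) u"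
    using du by (rule has_vector_derivative_continuous)
  then obtain d where d: "d > 0" "\<And>s. s \<in> {0..1} \<Longrightarrow> dist s t < d \<Longrightarrow> dist (u s) (u t) < 1"
    unfolding continuous_within_eps_delta by (meson zero_less_one)
  have const: "u s = u t" if s: "s \<in> {0..1}" "dist s t < d" for s
  proof (rule vec_eq_iff[THEN iffD2], rule allI)
    fix i
    have "\<bar>(u s - u t) $ i\<bar> < 1"
      using component_le_norm_cart[of "u s - u t" i] d(2)[OF s] by (simp add: dist_norm)
    moreover have "u s $ i - u t $ i \<in> \<int>"
      using int s(1) assms(3) by (intro Ints_diff) auto
    ultimately show "u s $ i = u t $ i"
      using Ints_nonzero_abs_less1[of "u s $ i - u t $ i"] by auto
  qed
  have "((\<lambda>s. u t) has_vector_derivative (v - v')) (at t within {0..1})"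
    using const by (intro has_vector_derivative_transform_within[OF du d(1) assms(3)]) auto
  moreover have "((\<lambda>s. u t) has_vector_derivative 0) (at t within {0..1})"
    by (rule has_vector_derivative_const)
  moreover have "at t within {0..1} \<noteq> bot"
    unfolding trivial_limit_within using islimpt_Icc[of 0 1 t] assms(3) by auto
  ultimately have "v - v' = 0"
    by (intro vector_derivative_unique_within)
  then show ?thesis by simp
qed

definition velocity :: "(real \<Rightarrow> 'd::finite torus) \<Rightarrow> real \<Rightarrow> real ^ 'd" where
  "velocity \<omega> t = (if \<exists>v. has_velocity \<omega> v t then THE v. has_velocity \<omega> v t else 0)"

definition curve_action :: "(real \<Rightarrow> 'd::finite torus) \<Rightarrow> ennreal" where
  "curve_action \<omega> =
     (if abs_continuous_on {0..1} \<omega>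
      then (\<integral>\<^sup>+ t\<in>{0..1}. ennreal ((norm (velocity \<omega> t))\<^sup>2) \<partial>lborel) / 2 else \<infinity>)"

definition generalized_flow :: "(real \<Rightarrow> 'd::finite torus) measure \<Rightarrow> bool" where
  "generalized_flow \<eta> \<longleftrightarrow> sets \<eta> = sets path_borel"

definition flow_action :: "(real \<Rightarrow> 'd::finite torus) measure \<Rightarrow> ennreal" where
  "flow_action \<eta> = (\<integral>\<^sup>+ \<omega>. curve_action \<omega> \<partial>\<eta>)"

definition admissible ::
    "('d::finite torus \<times> 'd torus) measure \<Rightarrow> (real \<Rightarrow> 'd torus) measure \<Rightarrow> bool" where
  "admissible \<gamma> \<eta> \<longleftrightarrow> generalized_flow \<eta> \<and>
     (\<forall>\<phi> \<in> borel_measurable borel. (\<integral>\<^sup>+ \<omega>. \<phi> (\<omega> 0, \<omega> 1) \<partial>\<eta>) = (\<integral>\<^sup>+ z. \<phi> z \<partial>\<gamma>)) \<and>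
     (\<forall>t\<in>{0..1}. distr \<eta> borel (\<lambda>\<omega>. \<omega> t) = torus_measure) \<and>
     flow_action \<eta> < \<infinity>"

text \<open>The infimum is attained for every bistochastic measure, so it is the minimal action; it is
  \<open>\<infinity>\<close> only if no flow is admissible.\<close>

definition minimal_action :: "('d::finite torus \<times> 'd torus) measure \<Rightarrow> ennreal" where
  "minimal_action \<gamma> = (INF \<eta>\<in>{\<eta>. admissible \<gamma> \<eta>}. flow_action \<eta>)"

lemma measurable_path_eval [measurable]:
  assumes "t \<in> {0..1}"
  shows "(\<lambda>\<omega> :: real \<Rightarrow> 'd::finite torus. \<omega> t) \<in> path_borel \<rightarrow>\<^sub>M borel"
proof -
  let ?m = "path_metric :: (real \<Rightarrow> 'd torus) metric"
  have "continuous_map (mtopology_of ?m) (mtopology_of euclidean_metric) (\<lambda>\<omega>. \<omega> t)"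
  proof (rule Lipschitz_continuous_imp_continuous_map)
    show "Lipschitz_continuous_map ?m euclidean_metric (\<lambda>\<omega>. \<omega> t)"
      unfolding Lipschitz_continuous_map_def
    proof (intro conjI exI[of _ 1] ballI)
      fix f g assume "f \<in> mspace ?m" "g \<in> mspace ?m"
      then show "mdist euclidean_metric (f t) (g t) \<le> 1 * mdist ?m f g"
        using assms mdist_cfunspace_imp_mdist_le[of f "top_of_set {0..1}" euclidean_metric g _ t]
        by (simp add: path_metric_def del: mspace_cfunspace)
    qed auto
  qed
  then have c: "continuous_map (mtopology_of ?m) euclidean (\<lambda>\<omega>. \<omega> t)"
    by (simp add: mtopology_of_euclidean)
  show ?thesis
  proof (rule borel_measurableI)
    fix S :: "'d torus set" assume "open S"
    then have "openin (mtopology_of ?m) {\<omega> \<in> mspace ?m. \<omega> t \<in> S}"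
      using openin_continuous_map_preimage[OF c, of S] by simp
    moreover have "Collect (openin (mtopology_of ?m)) \<subseteq> Pow (mspace ?m)"
      using openin_subset by fastforce
    moreover from this have "space (path_borel :: (real \<Rightarrow> 'd torus) measure) = mspace ?m"
      by (simp add: path_borel_def space_measure_of)
    moreover have "(\<lambda>\<omega>. \<omega> t) -` S \<inter> mspace ?m = {\<omega> \<in> mspace ?m. \<omega> t \<in> S}" by auto
    ultimately show "(\<lambda>\<omega>. \<omega> t) -` S \<inter> space path_borel \<in> sets path_borel"
      by (auto simp: path_borel_def intro: sigma_sets.Basic)
  qed
qed

definition holder_continuous_wrt ::
    "('a \<Rightarrow> 'a \<Rightarrow> real) \<Rightarrow> real \<Rightarrow> 'a set \<Rightarrow> ('a \<Rightarrow> real) \<Rightarrow> bool" where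
  "holder_continuous_wrt d \<alpha> S f \<longleftrightarrow>
     (\<exists>C\<ge>0. \<forall>x\<in>S. \<forall>y\<in>S. \<bar>f x - f y\<bar> \<le> C * d x y powr \<alpha>)"

end

theory Submission
  imports Defs
begin

text \<open>
  Let \<open>\<eta>\<close> be a flow for \<open>\<mu>\<close> and let \<open>\<delta>\<close> exceed the distance of \<open>\<mu>\<close> and \<open>\<nu>\<close>. Run \<open>\<eta>\<close> during \<open>[h, 1 - h]\<close> (up to a
  reparametrisation) and couple its end points with those prescribed by \<open>\<nu>\<close>, at mean distance of
  order \<open>\<delta>\<close>. It remains to join, in time \<open>h\<close> and incompressibly, a uniform point \<open>a\<close> to a uniform
  point \<open>x\<close> that is mostly close to it. Moving along a displacement independent of the position
  preserves the Lebesgue measure, so both \<open>a\<close> and \<open>x\<close> can be spread by a Lipschitz kernel of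
  width \<open>h\<close>, at cost of order \<open>h\<^sup>2\<close>. The two spread points can be taken equal except for a mass
  \<open>\<alpha>\<close> of order \<open>\<delta> / h^(d+1)\<close>, the Lipschitz constant of the kernel times \<open>\<delta>\<close>; rescaling the common part
  makes the remaining mass uniform, and it travels through an independent uniform point. The total
  cost is of order \<open>(h\<^sup>2 + \<delta> / h^(d+1)) / h\<close>, which is of order \<open>h\<close> for \<open>h^(d+3) = \<delta>\<close>.
\<close>

text \<open>The rescaling is forced by exact incompressibility: the overlap of the two kernels,
  averaged over all trajectories, has a density between 1 - \<alpha> and 1 that is not constant.
  Divided by this density and multiplied by 1 - \<alpha>, the overlap stays below both kernels, and
  the two leftover parts have density exactly \<alpha>. The joint law of an unmatched pair z, z' is
  uncontrolled, so a geodesic between them could compress mass; an independent uniform point in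
  between makes the displacement independent of the position on both legs. Squeezing the given flow
  into a shorter interval multiplies its action by 1 + O(h). This is an additive error of order h
  because the minimal action is bounded uniformly, which the same construction with \<alpha> = 1
  yields; the bound also settles distances that are not small. All pieces are random variables on
  one space that is enlarged by auxiliary points at each step, so laws are checked piece by piece
  and end points agree exactly.\<close>

section \<open>The flat torus\<close>

text \<open>As a measurability rule, \<open>measurable_path_eval\<close> matches every function application.\<close>

declare measurable_path_eval [measurable del]

text \<open>\<open>rep_torus\<close> chooses a representative arbitrarily; fractional parts turn it
  into the one in \<open>unit_cube\<close>, which depends measurably on the point.\<close>

definition torus_section :: "'d::finite torus \<Rightarrow> real ^ 'd" where
  "torus_section p = (\<chi> i. frac (rep_torus p $ i))"

definition unit_cube :: "(real ^ 'd::finite) set" where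
  "unit_cube = {x. \<forall>i. 0 \<le> x $ i \<and> x $ i < 1}"

definition centred_cube :: "(real ^ 'd::finite) set" where
  "centred_cube = {x. \<forall>i. - 1 / 2 \<le> x $ i \<and> x $ i < 1 / 2}"

text \<open>The representative of q - p in the half-open \<open>centred_cube\<close>: a shortest
  displacement, with ties on the cut locus broken measurably.\<close>

definition torus_disp :: "'d::finite torus \<Rightarrow> 'd torus \<Rightarrow> real ^ 'd" where
  "torus_disp p q = (\<chi> i. frac (torus_section q $ i - torus_section p $ i + 1 / 2) - 1 / 2)"

definition torus_geod :: "real \<Rightarrow> 'd::finite torus \<Rightarrow> 'd torus \<Rightarrow> 'd torus" where
  "torus_geod t p q = to_torus (torus_section p + t *\<^sub>R torus_disp p q)"

lemma frac_diff_Ints: "frac x - x \<in> \<int>" for x :: real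
  by (simp add: frac_def)

lemma Ints_less_1_eq:
  assumes "x - y \<in> \<int>" "c \<le> x" "x < c + 1" "c \<le> y" "y < c + (1::real)"
  shows "x = y"
proof -
  have "\<bar>x - y\<bar> < 1" using assms by linarith
  then show ?thesis using Ints_nonzero_abs_less1[of "x - y"] assms(1) by auto
qed

lemma to_torus_section [simp]: "to_torus (torus_section p) = p"
proof -
  have "to_torus (torus_section p) = to_torus (rep_torus p)"
    unfolding to_torus_eq_iff torus_section_def by (simp add: frac_diff_Ints)
  then show ?thesis by (simp add: Quotient_abs_rep[OF Quotient_torus])
qed

lemma torus_section_in: "torus_section p \<in> unit_cube"
  by (simp add: torus_section_def unit_cube_def frac_lt_1)

lemma torus_section_to_torus:
  assumes "x \<in> unit_cube" shows "torus_section (to_torus x) = x"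
proof (rule vec_eq_iff[THEN iffD2], rule allI)
  fix i
  have "torus_section (to_torus x) $ i - x $ i \<in> \<int>"
    using to_torus_eq_iff[of "torus_section (to_torus x)" x] by simp
  then show "torus_section (to_torus x) $ i = x $ i"
    using torus_section_in[of "to_torus x"] assms
    by (intro Ints_less_1_eq[where c = 0]) (auto simp: unit_cube_def)
qed

lemma torus_disp_in: "torus_disp p q \<in> centred_cube"
  by (simp add: torus_disp_def centred_cube_def less_diff_eq frac_lt_1 diff_less_eq)

lemma to_torus_disp [simp]: "to_torus (torus_section p + torus_disp p q) = q"
proof -
  have "to_torus (torus_section p + torus_disp p q) = to_torus (torus_section q)"
    unfolding to_torus_eq_iff torus_disp_def
    by (auto simp: frac_def)
  then show ?thesis by simp
qed

lemma torus_disp_eqI: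
  assumes "to_torus x = p" "to_torus (x + u) = q" "u \<in> centred_cube"
  shows "torus_disp p q = u"
proof (rule vec_eq_iff[THEN iffD2], rule allI)
  fix i
  have 1: "torus_section p $ i - x $ i \<in> \<int>"
    using to_torus_eq_iff[of "torus_section p" x] assms(1) by simp
  have 2: "(torus_section p + torus_disp p q) $ i - (x + u) $ i \<in> \<int>"
    using to_torus_eq_iff[of "torus_section p + torus_disp p q" "x + u"] assms(2) by simp
  have "torus_disp p q $ i - u $ i \<in> \<int>"
    using Ints_diff[OF 2 1] by simp
  then show "torus_disp p q $ i = u $ i"
    using torus_disp_in[of p q] assms(3)
    by (intro Ints_less_1_eq[where c = "- 1 / 2"]) (auto simp: centred_cube_def)
qed

text \<open>Applied coordinatewise, this is why \<open>torus_disp\<close> is a shortest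
  displacement: distinct numbers that differ by an integer are at least 1 apart.\<close>

lemma abs_le_abs_Ints_diff:
  fixes x y :: real
  assumes "x - y \<in> \<int>" "- 1 / 2 \<le> x" "x \<le> 1 / 2"
  shows "\<bar>x\<bar> \<le> \<bar>y\<bar>"
proof (cases "x = y")
  case False
  then have "1 \<le> \<bar>x - y\<bar>" using Ints_nonzero_abs_ge1[OF assms(1)] by auto
  then show ?thesis using assms(2,3) by linarith
qed auto

lemma norm_torus_disp: "norm (torus_disp p q) = dist p q"
proof (rule antisym)
  show "dist p q \<le> norm (torus_disp p q)"
    using dist_to_torus_le[of "torus_section p" "torus_section p + torus_disp p q"]
    by (simp add: dist_norm)
  show "norm (torus_disp p q) \<le> dist p q"
    unfolding dist_torus_def
  proof (rule le_setdistI)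
    fix x y assume "x \<in> torus_fibre p" "y \<in> torus_fibre q"
    then have x: "to_torus x = to_torus (torus_section p)"
      and y: "to_torus y = to_torus (torus_section p + torus_disp p q)"
      unfolding torus_fibre_def to_torus_section to_torus_disp by auto
    have "norm (torus_disp p q) \<le> norm (y - x)"
    proof (rule norm_le_componentwise_cart)
      fix i
      have "(x $ i - torus_section p $ i) - (y $ i - (torus_section p $ i + torus_disp p q $ i)) \<in> \<int>"
        by (rule Ints_diff)
           (use x[unfolded to_torus_eq_iff] y[unfolded to_torus_eq_iff] in \<open>simp_all\<close>)
      then have "torus_disp p q $ i - (y - x) $ i \<in> \<int>" by (simp add: algebra_simps)
      then show "norm (torus_disp p q $ i) \<le> norm ((y - x) $ i)"
        using torus_disp_in[of p q] unfolding real_norm_def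
        by (intro abs_le_abs_Ints_diff) (auto simp: centred_cube_def intro: less_imp_le)
    qed
    then show "norm (torus_disp p q) \<le> dist x y" by (simp add: dist_norm norm_minus_commute)
  qed (auto simp: torus_fibre_nonempty)
qed

lemma torus_disp_self [simp]: "torus_disp p p = 0"
  using norm_torus_disp[of p p] by simp

lemma torus_geod_0 [simp]: "torus_geod 0 p q = p"
  and torus_geod_1 [simp]: "torus_geod 1 p q = q"
  and torus_geod_self [simp]: "torus_geod t p p = p"
  by (simp_all add: torus_geod_def)

lemma dist_torus_geod_le: "dist (torus_geod s p q) (torus_geod t p q) \<le> \<bar>s - t\<bar> * dist p q"
proof -
  have "dist (torus_geod s p q) (torus_geod t p q)
      \<le> dist (torus_section p + s *\<^sub>R torus_disp p q) (torus_section p + t *\<^sub>R torus_disp p q)"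
    unfolding torus_geod_def by (rule dist_to_torus_le)
  also have "\<dots> = norm ((s - t) *\<^sub>R torus_disp p q)"
    by (simp add: dist_norm algebra_simps)
  finally show ?thesis by (simp add: norm_torus_disp)
qed

text \<open>A crude diameter bound, each coordinate of a displacement being bounded by 1; it keeps
  later constants dependent on the dimension only.\<close>

lemma dist_torus_le: "dist p q \<le> real CARD('d)" for p q :: "'d::finite torus"
proof -
  have "norm (torus_disp p q) \<le> (\<Sum>i\<in>UNIV. \<bar>torus_disp p q $ i\<bar>)"
    by (rule norm_le_l1_cart)
  also have "\<dots> \<le> (\<Sum>i\<in>(UNIV :: 'd set). 1)"
  proof (rule sum_mono)
    fix i
    show "\<bar>torus_disp p q $ i\<bar> \<le> 1"
      using spec[OF torus_disp_in[of p q, unfolded centred_cube_def mem_Collect_eq], of i] by linarith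
  qed
  finally show ?thesis by (simp add: norm_torus_disp)
qed

section \<open>Topology and Borel structure of the torus\<close>

text \<open>For any lift x of p, a point q near p lifts to x plus the displacement from p to
  q.\<close>

lemma open_to_torus_image:
  assumes "open U" shows "open (to_torus ` U)"
  unfolding open_dist
proof
  fix p assume "p \<in> to_torus ` U"
  then obtain x where x: "x \<in> U" "to_torus x = p" by auto
  then obtain e where e: "e > 0" "ball x e \<subseteq> U" using assms openE by blast
  have "q \<in> to_torus ` U" if "dist q p < e" for q
  proof -
    have "to_torus (x + torus_disp p q) = to_torus (torus_section p + torus_disp p q)"
      unfolding to_torus_eq_iff using x(2) to_torus_eq_iff[of x "torus_section p"] by simp
    moreover have "x + torus_disp p q \<in> U"
      using that e(2) by (auto simp: dist_norm norm_torus_disp dist_commute subset_iff)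
    ultimately show ?thesis by (metis image_eqI to_torus_disp)
  qed
  then show "\<exists>e>0. \<forall>q. dist q p < e \<longrightarrow> q \<in> to_torus ` U" using e(1) by blast
qed

text \<open>The images of a countable basis under the open quotient map form a basis. Second
  countability identifies the Borel sets of a product with the product sigma-algebra.\<close>

instance torus :: (finite) second_countable_topology
proof
  obtain B :: "(real ^ 'a) set set" where B: "countable B" "topological_basis B"
    using ex_countable_basis by blast
  have "topological_basis ((`) to_torus ` B)"
  proof (rule topological_basisI)
    fix U :: "'a torus set" assume "U \<in> (`) to_torus ` B"
    then show "open U" using B(2) open_to_torus_image topological_basis_open by blast
  next
    fix U :: "'a torus set" and p assume U: "open U" "p \<in> U"
    have "open (to_torus -` U)"
      using U(1) continuous_on_to_torus by (rule open_vimage)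
    moreover have "torus_section p \<in> to_torus -` U" using U(2) by simp
    ultimately obtain V where "V \<in> B" "torus_section p \<in> V" "V \<subseteq> to_torus -` U"
      using B(2) topological_basisE by blast
    then show "\<exists>W\<in>(`) to_torus ` B. p \<in> W \<and> W \<subseteq> U"
      by (intro bexI[of _ "to_torus ` V"]) (auto, metis image_eqI to_torus_section)
  qed
  then show "\<exists>B :: 'a torus set set. countable B \<and> open = generate_topology B"
    using B(1) topological_basis_imp_subbasis by blast
qed

lemma compact_UNIV_torus: "compact (UNIV :: 'd::finite torus set)"
proof -
  have "p \<in> to_torus ` cbox 0 1" for p :: "'d torus"
  proof -
    have "torus_section p \<in> cbox 0 1"
      using torus_section_in[of p] by (auto simp: mem_box_cart unit_cube_def intro: less_imp_le)
    then show ?thesis by (metis image_eqI to_torus_section)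
  qed
  then have "UNIV = to_torus ` (cbox 0 1 :: (real ^ 'd) set)" by auto
  then show ?thesis
    by (metis compact_cbox compact_continuous_image continuous_on_to_torus)
qed

lemma sets_unit_cube [measurable]: "unit_cube \<in> sets borel"
  unfolding unit_cube_def by measurable

lemma sets_centred_cube [measurable]: "centred_cube \<in> sets borel"
  unfolding centred_cube_def by measurable

lemma borel_measurable_vecI:
  fixes f :: "'w \<Rightarrow> real ^ 'd::finite"
  assumes "\<And>i. (\<lambda>w. f w $ i) \<in> borel_measurable M"
  shows "f \<in> borel_measurable M"
proof (subst borel_measurable_euclidean_space, rule ballI)
  fix b :: "real ^ 'd" assume "b \<in> Basis"
  then obtain i where "b = axis i 1" by (auto simp: Basis_vec_def)
  then show "(\<lambda>w. f w \<bullet> b) \<in> borel_measurable M"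
    using assms[of i] by (simp add: inner_axis)
qed

text \<open>The section jumps at the faces of the cube, so measurability cannot come from
  continuity; instead each sublevel set of a coordinate is a countable union of compact
  sets.\<close>

lemma measurable_torus_section [measurable]: "torus_section \<in> borel \<rightarrow>\<^sub>M borel"
proof (rule borel_measurable_vecI, unfold borel_measurable_iff_le, rule allI)
  fix i :: 'a and c :: real
  \<comment> \<open>Compact boxes exhausting the part of the half-open cube where coordinate i is at
    most c; their images in the torus are compact.\<close>
  define K where "K n = cbox 0 (\<chi> j. if j = i then min c (1 - 1 / real (Suc n)) else 1 - 1 / real (Suc n))" for n
  have "torus_section p $ i \<le> c \<longleftrightarrow> (\<exists>n. p \<in> to_torus ` K n)" for p :: "'a torus"
  proof
    assume c: "torus_section p $ i \<le> c"
    define m where "m = Max (range (($) (torus_section p)))"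
    have m: "torus_section p $ j \<le> m" for j unfolding m_def by (intro Max_ge) auto
    have "m < 1" unfolding m_def using torus_section_in[of p] by (auto simp: unit_cube_def)
    then obtain n where "1 / real (Suc n) < 1 - m"
      using reals_Archimedean[of "1 - m"] by (auto simp: inverse_eq_divide)
    then have "torus_section p \<in> K n"
      using torus_section_in[of p] c m unfolding K_def mem_box_cart unit_cube_def
      by (auto intro: order_trans[OF m])
    then show "\<exists>n. p \<in> to_torus ` K n" by (metis image_eqI to_torus_section)
  next
    assume "\<exists>n. p \<in> to_torus ` K n"
    then obtain n x where x: "x \<in> K n" "p = to_torus x" by auto
    have b: "0 \<le> x $ j" "x $ j \<le> 1 - 1 / real (Suc n)" "x $ i \<le> c" for j
      using x(1) unfolding K_def mem_box_cart
      by (auto dest: spec[of _ j] spec[of _ i] split: if_splits)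
    have "1 - 1 / real (Suc n) < 1" by simp
    then have "x \<in> unit_cube"
      unfolding unit_cube_def using b(1) le_less_trans[OF b(2)] by blast
    then show "torus_section p $ i \<le> c" using b(3) x(2) by (simp add: torus_section_to_torus)
  qed
  then have "{p \<in> space borel. torus_section p $ i \<le> c} = (\<Union>n. to_torus ` K n)"
    by auto
  moreover have "to_torus ` K n \<in> sets borel" for n
    unfolding K_def
    by (intro borel_closed compact_imp_closed compact_continuous_image continuous_on_to_torus compact_cbox)
  ultimately show "{p \<in> space borel. torus_section p $ i \<le> c} \<in> sets borel" by simp
qed

lemma borel_measurable_vec_component [measurable (raw)]:
  assumes "f \<in> borel_measurable M"
  shows "(\<lambda>w. (f w :: real ^ 'd::finite) $ i) \<in> borel_measurable M"
  using assms by (rule measurable_compose) (intro borel_measurable_continuous_onI continuous_intros)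

lemma measurable_torus_disp [measurable (raw)]:
  assumes [measurable]: "p \<in> M \<rightarrow>\<^sub>M borel" "q \<in> M \<rightarrow>\<^sub>M borel"
  shows "(\<lambda>w. torus_disp (p w) (q w)) \<in> M \<rightarrow>\<^sub>M borel"
  by (rule borel_measurable_vecI) (simp add: torus_disp_def frac_def)

lemma measurable_torus_geod [measurable (raw)]:
  assumes [measurable]: "p \<in> M \<rightarrow>\<^sub>M borel" "q \<in> M \<rightarrow>\<^sub>M borel"
  shows "(\<lambda>w. torus_geod t (p w) (q w)) \<in> M \<rightarrow>\<^sub>M borel"
  unfolding torus_geod_def by measurable

section \<open>Lebesgue measure on the torus and its invariance\<close>

lemma sets_torus_measure [measurable_cong, simp]: "sets torus_measure = sets borel"
  and space_torus_measure [simp]: "space torus_measure = UNIV"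
  by (simp_all add: torus_measure_def)

lemma nn_integral_torus_measure:
  fixes F :: "'d::finite torus \<Rightarrow> ennreal"
  assumes [measurable]: "F \<in> borel_measurable borel"
  shows "(\<integral>\<^sup>+ p. F p \<partial>torus_measure) = (\<integral>\<^sup>+ x. F (to_torus x) * indicator unit_cube x \<partial>lborel)"
proof -
  have eq: "torus_measure = distr (restrict_space lborel (unit_cube :: (real ^ 'd) set)) borel to_torus"
    by (simp add: torus_measure_def unit_cube_def)
  have "(\<integral>\<^sup>+ p. F p \<partial>torus_measure) = (\<integral>\<^sup>+ x. F (to_torus x) \<partial>restrict_space lborel unit_cube)"
    unfolding eq by (rule nn_integral_distr) (auto intro: measurable_restrict_space1)
  then show ?thesis by (simp add: nn_integral_restrict_space)
qed

lemma emeasure_unit_cube: "emeasure lborel (unit_cube :: (real ^ 'd::finite) set) = 1"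
proof (rule antisym)
  have prod1: "(\<Prod>b\<in>Basis. (1 :: real ^ 'd) \<bullet> b) = 1"
    by (intro prod.neutral) (auto simp: Basis_vec_def inner_axis)
  have pos: "0 \<bullet> b \<le> 1 \<bullet> b" if "b \<in> Basis" for b :: "real ^ 'd"
    using that by (auto simp: Basis_vec_def inner_axis)
  have "emeasure lborel (unit_cube :: (real ^ 'd) set) \<le> emeasure lborel (cbox 0 (1 :: real ^ 'd))"
    by (intro emeasure_mono) (auto simp: unit_cube_def mem_box_cart less_imp_le)
  then show "emeasure lborel (unit_cube :: (real ^ 'd) set) \<le> 1"
    using prod1 pos by (simp add: emeasure_lborel_cbox)
  have "emeasure lborel (box 0 (1 :: real ^ 'd)) \<le> emeasure lborel (unit_cube :: (real ^ 'd) set)"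
    by (intro emeasure_mono) (auto simp: unit_cube_def mem_box_cart less_imp_le)
  then show "1 \<le> emeasure lborel (unit_cube :: (real ^ 'd) set)"
    using prod1 pos by (simp add: emeasure_lborel_box)
qed

lemma emeasure_torus_measure_UNIV [simp]:
  "emeasure torus_measure (UNIV :: 'd::finite torus set) = 1"
proof -
  have "emeasure torus_measure (UNIV :: 'd torus set) = (\<integral>\<^sup>+ p. 1 \<partial>(torus_measure :: 'd torus measure))" by simp
  also have "\<dots> = 1" by (subst nn_integral_torus_measure) (auto simp: emeasure_unit_cube)
  finally show ?thesis .
qed

lemma sigma_finite_torus_measure: "sigma_finite_measure torus_measure"
  by (intro finite_measure.axioms(1) finite_measureI) simp

lemma countable_integer_vectors: "countable {k :: real ^ 'd::finite. \<forall>i. k $ i \<in> \<int>}"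
proof -
  have "{k :: real ^ 'd. \<forall>i. k $ i \<in> \<int>} \<subseteq> range (\<lambda>f :: 'd \<Rightarrow> int. \<chi> i. real_of_int (f i))"
  proof
    fix k :: "real ^ 'd" assume "k \<in> {k. \<forall>i. k $ i \<in> \<int>}"
    then have Ints: "k $ i \<in> \<int>" for i by blast
    have "k $ i = real_of_int \<lfloor>k $ i\<rfloor>" for i
      using Ints[of i] by (rule Ints_cases) (simp only: floor_of_int)
    then have "k = (\<chi> i. real_of_int \<lfloor>k $ i\<rfloor>)" unfolding vec_eq_iff vec_lambda_beta by blast
    then show "k \<in> range (\<lambda>f :: 'd \<Rightarrow> int. \<chi> i. real_of_int (f i))" by (intro range_eqI)
  qed
  then show ?thesis by (rule countable_subset) (intro countable_image countableI_type)
qed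

text \<open>The integer translates of the half-open cube tile the space, so exactly one k
  contributes. The counting measure makes the sum an integral, ready for Tonelli's theorem.\<close>

lemma nn_integral_integer_shift_unit_cube:
  fixes x :: "real ^ 'd::finite"
  shows "(\<integral>\<^sup>+ k. indicator unit_cube (x + k) \<partial>count_space {k. \<forall>i. k $ i \<in> \<int>}) = 1" (is ?A)
    and "(\<integral>\<^sup>+ k. indicator unit_cube (x - k) \<partial>count_space {k. \<forall>i. k $ i \<in> \<int>}) = 1" (is ?B)
proof -
  have eq: "x + k \<in> unit_cube \<longleftrightarrow> k = (\<chi> i. - real_of_int \<lfloor>x $ i\<rfloor>)" if int: "\<forall>i. k $ i \<in> \<int>" for k
  proof
    assume "x + k \<in> unit_cube"
    then have b: "0 \<le> x $ i + k $ i" "x $ i + k $ i < 1" for i by (auto simp: unit_cube_def)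
    show "k = (\<chi> i. - real_of_int \<lfloor>x $ i\<rfloor>)"
    proof (rule vec_eq_iff[THEN iffD2], rule allI)
      fix i
      obtain n where n: "k $ i = real_of_int n"
        using int[rule_format, of i] by (rule Ints_cases)
      have "\<lfloor>x $ i\<rfloor> = - n" using b[of i] n by (intro floor_unique) auto
      then show "k $ i = (\<chi> i. - real_of_int \<lfloor>x $ i\<rfloor>) $ i" using n by simp
    qed
  next
    assume "k = (\<chi> i. - real_of_int \<lfloor>x $ i\<rfloor>)"
    then show "x + k \<in> unit_cube" by (simp add: unit_cube_def) linarith
  qed
  let ?Z = "{k :: real ^ 'd. \<forall>i. k $ i \<in> \<int>}"
  define k0 :: "real ^ 'd" where "k0 = (\<chi> i. - real_of_int \<lfloor>x $ i\<rfloor>)"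
  have k0: "k0 \<in> ?Z" "- k0 \<in> ?Z" by (auto simp: k0_def)
  have "(\<integral>\<^sup>+ k. indicator unit_cube (x + k) \<partial>count_space ?Z) = (\<integral>\<^sup>+ k. indicator {k0} k \<partial>count_space ?Z)"
    by (intro nn_integral_cong) (auto simp: indicator_def eq k0_def)
  then show ?A using k0 by (simp add: emeasure_count_space)
  have "(\<integral>\<^sup>+ k. indicator unit_cube (x - k) \<partial>count_space ?Z) = (\<integral>\<^sup>+ k. indicator {- k0} k \<partial>count_space ?Z)"
  proof (intro nn_integral_cong)
    fix k assume "k \<in> space (count_space ?Z)"
    then have "x - k \<in> unit_cube \<longleftrightarrow> - k = k0" using eq[of "- k"] by (auto simp: k0_def)
    then show "(indicator unit_cube (x - k) :: ennreal) = indicator {- k0} k"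
      by (auto simp: indicator_def minus_equation_iff)
  qed
  then show ?B using k0 by (simp add: emeasure_count_space)
qed

lemma nn_integral_lborel_translate:
  fixes G :: "'a::euclidean_space \<Rightarrow> ennreal"
  assumes [measurable]: "G \<in> borel_measurable borel"
  shows "(\<integral>\<^sup>+ x. G (c + x) \<partial>lborel) = (\<integral>\<^sup>+ x. G x \<partial>lborel)"
proof -
  have "(\<integral>\<^sup>+ x. G x \<partial>distr lborel borel ((+) c)) = (\<integral>\<^sup>+ x. G (c + x) \<partial>lborel)"
    by (intro nn_integral_distr) auto
  then show ?thesis by (simp add: lborel_distr_plus)
qed

text \<open>Unfolding and folding: insert the tiling, exchange sum and integral, shift each term by
  its integer vector, and sum over the tiles again.\<close>

lemma nn_integral_periodic_translate:
  fixes G :: "real ^ 'd::finite \<Rightarrow> ennreal"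
  assumes [measurable]: "G \<in> borel_measurable borel"
    and per: "\<And>x k. \<forall>i. k $ i \<in> \<int> \<Longrightarrow> G (x + k) = G x"
  shows "(\<integral>\<^sup>+ x. G (v + x) * indicator unit_cube x \<partial>lborel) = (\<integral>\<^sup>+ x. G x * indicator unit_cube x \<partial>lborel)"
proof -
  let ?Z = "{k :: real ^ 'd. \<forall>i. k $ i \<in> \<int>}"
  let ?I = "indicator unit_cube :: _ \<Rightarrow> ennreal"
  have "(\<integral>\<^sup>+ x. G (v + x) * ?I x \<partial>lborel) = (\<integral>\<^sup>+ x. G x * ?I (x - v) \<partial>lborel)"
    using nn_integral_lborel_translate[of "\<lambda>x. G x * ?I (x - v)" v] by simp
  also have "\<dots> = (\<integral>\<^sup>+ x. \<integral>\<^sup>+ k. G x * ?I (x - v) * ?I (x + k) \<partial>count_space ?Z \<partial>lborel)"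
    by (simp add: nn_integral_cmult nn_integral_integer_shift_unit_cube)
  also have "\<dots> = (\<integral>\<^sup>+ k. \<integral>\<^sup>+ x. G x * ?I (x - v) * ?I (x + k) \<partial>lborel \<partial>count_space ?Z)"
    by (rule nn_integral_count_space_nn_integral) (auto intro: countable_integer_vectors)
  also have "\<dots> = (\<integral>\<^sup>+ k. \<integral>\<^sup>+ x. G x * ?I ((x - v) - k) * ?I x \<partial>lborel \<partial>count_space ?Z)"
  proof (rule nn_integral_cong)
    fix k assume "k \<in> space (count_space ?Z)"
    then have "G (x + - k) = G x" for x by (intro per) auto
    then show "(\<integral>\<^sup>+ x. G x * ?I (x - v) * ?I (x + k) \<partial>lborel) = (\<integral>\<^sup>+ x. G x * ?I ((x - v) - k) * ?I x \<partial>lborel)"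
      using nn_integral_lborel_translate[of "\<lambda>x. G x * ?I (x - v) * ?I (x + k)" "- k"]
      by (simp add: algebra_simps)
  qed
  also have "\<dots> = (\<integral>\<^sup>+ x. \<integral>\<^sup>+ k. G x * ?I ((x - v) - k) * ?I x \<partial>count_space ?Z \<partial>lborel)"
    by (rule nn_integral_count_space_nn_integral[symmetric]) (auto intro: countable_integer_vectors)
  also have "\<dots> = (\<integral>\<^sup>+ x. G x * ?I x \<partial>lborel)"
    by (simp add: nn_integral_cmult nn_integral_multc nn_integral_integer_shift_unit_cube)
  finally show ?thesis .
qed

lemma nn_integral_torus_measure_translate:
  assumes [measurable]: "F \<in> borel_measurable borel"
  shows "(\<integral>\<^sup>+ x. F (to_torus (v + x)) * indicator unit_cube x \<partial>lborel) = (\<integral>\<^sup>+ p. F p \<partial>torus_measure)"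
proof -
  have "F (to_torus (x + k)) = F (to_torus x)" if "\<forall>i. k $ i \<in> \<int>" for x k
    using that by (metis add_diff_cancel_left' to_torus_eq_iff vector_minus_component)
  then show ?thesis
    using nn_integral_periodic_translate[of "\<lambda>x. F (to_torus x)" v]
    by (simp add: nn_integral_torus_measure)
qed

text \<open>The centred cube is another fundamental domain. When v lifts p, the variable u is the
  displacement from p.\<close>

lemma nn_integral_torus_measure_centred:
  assumes [measurable]: "F \<in> borel_measurable borel"
  shows "(\<integral>\<^sup>+ p. F p \<partial>torus_measure) = (\<integral>\<^sup>+ u. F (to_torus (v + u)) * indicator centred_cube u \<partial>lborel)"
proof -
  define c :: "real ^ 'a" where "c = (\<chi> i. - 1 / 2)"
  have [simp]: "c + x \<in> centred_cube \<longleftrightarrow> x \<in> unit_cube" for x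
    by (simp add: c_def centred_cube_def unit_cube_def less_diff_eq)
  have "(\<integral>\<^sup>+ u. F (to_torus (v + u)) * indicator centred_cube u \<partial>lborel)
      = (\<integral>\<^sup>+ x. F (to_torus (v + (c + x))) * indicator unit_cube x \<partial>lborel)"
    by (subst nn_integral_lborel_translate[of _ c, symmetric]) (auto simp: indicator_def)
  then show ?thesis
    using nn_integral_torus_measure_translate[of F "v + c"] by (simp add: add.assoc)
qed

text \<open>Given \<open>q - p\<close>, the point \<open>torus_geod t p q\<close> is a translate of \<open>p\<close>, hence equidistributed.\<close>

lemma nn_integral_torus_geod:
  fixes f :: "'d::finite torus \<Rightarrow> ennreal"
  assumes [measurable]: "f \<in> borel_measurable borel" "k \<in> borel_measurable borel"
  shows "(\<integral>\<^sup>+ p. \<integral>\<^sup>+ q. f (torus_geod t p q) * k (dist p q) \<partial>torus_measure \<partial>torus_measure)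
    = (\<integral>\<^sup>+ p. f p \<partial>torus_measure) * (\<integral>\<^sup>+ u. k (norm u) * indicator centred_cube (u :: real ^ 'd) \<partial>lborel)"
proof -
  interpret T: sigma_finite_measure "torus_measure :: 'd torus measure"
    by (rule sigma_finite_torus_measure)
  interpret TL: pair_sigma_finite "torus_measure :: 'd torus measure" "lborel :: (real ^ 'd) measure" ..
  have disp: "torus_disp p (to_torus (torus_section p + u)) = u" if "u \<in> centred_cube"
    for p :: "'d torus" and u
    using that by (intro torus_disp_eqI[of "torus_section p"]) auto
  \<comment> \<open>The inner variable q is replaced by its displacement u from p.\<close>
  have "(\<integral>\<^sup>+ p. \<integral>\<^sup>+ q. f (torus_geod t p q) * k (dist p q) \<partial>torus_measure \<partial>torus_measure)
      = (\<integral>\<^sup>+ p. \<integral>\<^sup>+ u. f (to_torus (t *\<^sub>R u + torus_section p)) * (k (norm u) * indicator centred_cube u) \<partial>lborel \<partial>torus_measure)"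
  proof (intro nn_integral_cong)
    fix p :: "'d torus"
    show "(\<integral>\<^sup>+ q. f (torus_geod t p q) * k (dist p q) \<partial>torus_measure)
      = (\<integral>\<^sup>+ u. f (to_torus (t *\<^sub>R u + torus_section p)) * (k (norm u) * indicator centred_cube u) \<partial>lborel)"
      unfolding norm_torus_disp[symmetric] torus_geod_def
      by (subst nn_integral_torus_measure_centred[where v = "torus_section p"])
         (auto intro!: nn_integral_cong simp: disp indicator_def add.commute[of "t *\<^sub>R _" "torus_section p"])
  qed
  also have "\<dots> = (\<integral>\<^sup>+ u. \<integral>\<^sup>+ p. f (to_torus (t *\<^sub>R u + torus_section p)) * (k (norm u) * indicator centred_cube u) \<partial>torus_measure \<partial>lborel)"
    by (rule TL.Fubini'[symmetric]) measurable
  also have "\<dots> = (\<integral>\<^sup>+ u. (\<integral>\<^sup>+ p. f p \<partial>torus_measure) * (k (norm u) * indicator centred_cube (u :: real ^ 'd)) \<partial>lborel)"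
  proof (intro nn_integral_cong)
    fix u :: "real ^ 'd"
    have "(\<integral>\<^sup>+ p. f (to_torus (t *\<^sub>R u + torus_section p)) \<partial>torus_measure) = (\<integral>\<^sup>+ p. f p \<partial>torus_measure)"
      unfolding nn_integral_torus_measure_translate[where F = f and v = "t *\<^sub>R u", OF assms(1), symmetric]
      by (subst nn_integral_torus_measure)
         (auto intro!: nn_integral_cong simp: indicator_def torus_section_to_torus)
    then show "(\<integral>\<^sup>+ p. f (to_torus (t *\<^sub>R u + torus_section p)) * (k (norm u) * indicator centred_cube u) \<partial>torus_measure)
        = (\<integral>\<^sup>+ p. f p \<partial>torus_measure) * (k (norm u) * indicator centred_cube u)"
      by (subst nn_integral_multc) auto
  qed
  also have "\<dots> = (\<integral>\<^sup>+ p. f p \<partial>torus_measure) * (\<integral>\<^sup>+ u. k (norm u) * indicator centred_cube (u :: real ^ 'd) \<partial>lborel)"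
    by (rule nn_integral_cmult) measurable
  finally show ?thesis .
qed

text \<open>By homogeneity a radial kernel has the same mass around every centre. A constant k gives
  the volume of \<open>centred_cube\<close>.\<close>

lemma nn_integral_torus_dist:
  fixes p :: "'d::finite torus"
  assumes [measurable]: "k \<in> borel_measurable borel"
  shows "(\<integral>\<^sup>+ q. k (dist p q) \<partial>torus_measure)
    = (\<integral>\<^sup>+ u. k (norm u) * indicator centred_cube (u :: real ^ 'd) \<partial>lborel)"
proof -
  have disp: "torus_disp p (to_torus (torus_section p + u)) = u" if "u \<in> centred_cube" for u
    using that by (intro torus_disp_eqI[of "torus_section p"]) auto
  show ?thesis
    unfolding norm_torus_disp[symmetric]
    by (subst nn_integral_torus_measure_centred[where v = "torus_section p"])
       (auto intro!: nn_integral_cong simp: disp indicator_def)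
qed

section \<open>Paths and their action\<close>

lemma mspace_path_metric:
  "mspace (path_metric :: (real \<Rightarrow> 'd::finite torus) metric)
    = {\<omega>. continuous_on {0..1} \<omega> \<and> \<omega> \<in> extensional {0..1}}"
proof -
  \<comment> \<open>\<open>cfunspace\<close> asks for bounded continuous functions; compactness of
    the torus provides the bound.\<close>
  have "bounded (\<omega> ` {0..1})" for \<omega> :: "real \<Rightarrow> 'd torus"
    using compact_imp_bounded[OF compact_UNIV_torus] bounded_subset by blast
  then show ?thesis by (auto simp: path_metric_def)
qed

lemma space_path_borel:
  "space (path_borel :: (real \<Rightarrow> 'd::finite torus) measure) = mspace path_metric"
proof -
  have "Collect (openin (mtopology_of path_metric)) \<subseteq> Pow (mspace (path_metric :: (real \<Rightarrow> 'd torus) metric))"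
    using openin_subset by fastforce
  then show ?thesis by (simp add: path_borel_def space_measure_of)
qed

lemma mdist_path_metric_le_iff:
  fixes \<omega> :: "real \<Rightarrow> 'd::finite torus"
  assumes "\<omega> \<in> mspace path_metric" "\<omega>' \<in> mspace path_metric"
  shows "mdist path_metric \<omega> \<omega>' \<le> e \<longleftrightarrow> (\<forall>t\<in>{0..1}. dist (\<omega> t) (\<omega>' t) \<le> e)"
  using assms cfunspace_mdist_le[of \<omega> "top_of_set {0..1}" euclidean_metric \<omega>' e]
  by (simp add: path_metric_def)

text \<open>A path is coded by a precision, a grid, and approximate values at the grid points from a
  countable dense set. Paths with the same code are uniformly close, so one path chosen from each
  realised code suffices, without building interpolating paths.\<close>

lemma separable_path_metric:
  obtains D where "countable D" "D \<subseteq> mspace (path_metric :: (real \<Rightarrow> 'd::finite torus) metric)"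
    "\<forall>\<omega>\<in>mspace path_metric. \<forall>e>0. \<exists>d\<in>D. mdist path_metric \<omega> d \<le> e"
proof -
  let ?M = "mspace (path_metric :: (real \<Rightarrow> 'd torus) metric)"
  obtain B :: "'d torus set" where B: "countable B" "UNIV \<subseteq> closure B"
    by (rule separable[of "UNIV :: 'd torus set"])
  \<comment> \<open>Entry i of the list controls the path on the whole interval of radius 1/n around
    i/n. These intervals cover [0,1], so a common code bounds the uniform distance by
    2/(k+1).\<close>
  define near where "near c \<omega> \<longleftrightarrow> (case c of (k, n, l) \<Rightarrow> \<forall>i\<le>n. \<forall>t\<in>{0..1}.
      \<bar>t - real i / real n\<bar> \<le> 1 / real n \<longrightarrow> dist (\<omega> t) (l ! i) \<le> 1 / real (Suc k))"
    for c :: "nat \<times> nat \<times> 'd torus list" and \<omega> :: "real \<Rightarrow> 'd torus"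
  define C where "C = {c \<in> UNIV \<times> {1..} \<times> lists B. \<exists>\<omega>\<in>?M. near c \<omega>}"
  define pick where "pick c = (SOME \<omega>. \<omega> \<in> ?M \<and> near c \<omega>)" for c
  have pick: "pick c \<in> ?M" "near c (pick c)" if "c \<in> C" for c
  proof -
    have "\<exists>\<omega>. \<omega> \<in> ?M \<and> near c \<omega>" using that by (auto simp: C_def)
    then have "pick c \<in> ?M \<and> near c (pick c)" unfolding pick_def by (rule someI_ex)
    then show "pick c \<in> ?M" "near c (pick c)" by auto
  qed
  have "countable (UNIV \<times> {1::nat..} \<times> lists B :: (nat \<times> nat \<times> 'd torus list) set)"
    using B(1) by (intro countable_SIGMA countableI_type countable_lists)
  then have "countable C" by (rule countable_subset[rotated]) (auto simp: C_def)
  moreover have "\<exists>d\<in>pick ` C. mdist path_metric \<omega> d \<le> e" if \<omega>: "\<omega> \<in> ?M" and e: "e > 0" for \<omega> e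
  proof -
    obtain k where k: "2 / real (Suc k) < e"
      using reals_Archimedean[of "e / 2"] e by (auto simp: field_simps)
    define r where "r = 1 / real (Suc k)"
    have r: "r > 0" by (simp add: r_def)
    have "uniformly_continuous_on {0..1} \<omega>"
      using \<omega> by (intro compact_uniformly_continuous) (auto simp: mspace_path_metric)
    then obtain \<delta> where \<delta>: "\<delta> > 0"
        "\<And>s t. s \<in> {0..1} \<Longrightarrow> t \<in> {0..1} \<Longrightarrow> dist t s < \<delta> \<Longrightarrow> dist (\<omega> t) (\<omega> s) < r / 2"
      unfolding uniformly_continuous_on_def using half_gt_zero[OF r] by meson
    obtain n' where n': "1 / real (Suc n') < \<delta>"
      using reals_Archimedean[OF \<delta>(1)] by (auto simp: inverse_eq_divide)
    define n where "n = Suc n'"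
    have "\<forall>i. \<exists>b\<in>B. dist b (\<omega> (real i / real n)) < r / 2"
      using B(2) half_gt_zero[OF r] closure_approachable[of _ B] by blast
    then obtain b where b: "\<And>i. b i \<in> B" "\<And>i. dist (b i) (\<omega> (real i / real n)) < r / 2" by metis
    define c where "c = (k, n, map b [0..<Suc n])"
    have near: "near c \<omega>"
      unfolding near_def c_def prod.case
    proof (intro allI impI ballI)
      fix i t assume i: "i \<le> n" and t: "t \<in> {0..1::real}" "\<bar>t - real i / real n\<bar> \<le> 1 / real n"
      have "dist (\<omega> t) (\<omega> (real i / real n)) < r / 2"
        using i t n' by (intro \<delta>(2)) (auto simp: dist_real_def n_def)
      then have "dist (\<omega> t) (b i) \<le> r"
        using b(2)[of i] dist_triangle3[of "\<omega> t" "b i" "\<omega> (real i / real n)"]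
        by (simp add: dist_commute)
      then show "dist (\<omega> t) (map b [0..<Suc n] ! i) \<le> 1 / real (Suc k)"
        using i by (simp add: r_def del: upt_Suc)
    qed
    have c: "c \<in> C"
      unfolding C_def using near \<omega> b(1) by (auto simp: c_def n_def)
    have "mdist path_metric \<omega> (pick c) \<le> e"
      unfolding mdist_path_metric_le_iff[OF \<omega> pick(1)[OF c]]
    proof
      fix t :: real assume t: "t \<in> {0..1}"
      define i where "i = nat \<lfloor>t * real n\<rfloor>"
      have n0: "real n > 0" by (simp add: n_def)
      have i: "real i \<le> t * real n" "t * real n \<le> real i + 1"
        using t n0 by (auto simp: i_def of_nat_nat)
      have "t * real n \<le> real n" using t n0 by simp
      then have "real i \<le> real n" using i(1) by linarith
      then have "i \<le> n" by simp
      moreover have "\<bar>t - real i / real n\<bar> \<le> 1 / real n"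
      proof -
        have "\<bar>t - real i / real n\<bar> = \<bar>t * real n - real i\<bar> / real n"
        proof -
          have "t - real i / real n = (t * real n - real i) / real n"
            using n0 by (simp add: diff_divide_distrib)
          then show ?thesis using n0 by (simp only: abs_divide abs_of_pos)
        qed
        also have "\<dots> \<le> 1 / real n" using i n0 by (intro divide_right_mono) auto
        finally show ?thesis .
      qed
      ultimately have "dist (\<omega> t) (map b [0..<Suc n] ! i) \<le> r"
        "dist (pick c t) (map b [0..<Suc n] ! i) \<le> r"
        using near pick(2)[OF c] t unfolding near_def c_def prod.case r_def by blast+
      then have "dist (\<omega> t) (pick c t) \<le> 2 * r"
        using dist_triangle2[of "\<omega> t" "pick c t" "map b [0..<Suc n] ! i"] by linarith
      then show "dist (\<omega> t) (pick c t) \<le> e" using k by (simp add: r_def)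
    qed
    then show ?thesis using c by blast
  qed
  moreover have "pick ` C \<subseteq> ?M" using pick(1) by blast
  ultimately show ?thesis
    by (intro that[of "pick ` C"] countable_image ballI allI impI)
qed

text \<open>By separability an open set of paths is a countable union of closed balls, and a closed ball is
  cut out by countably many evaluations.\<close>

lemma measurable_path_borelI:
  fixes X :: "'w \<Rightarrow> real \<Rightarrow> 'd::finite torus"
  assumes X: "\<And>w. w \<in> space M \<Longrightarrow> X w \<in> mspace path_metric"
    and [measurable]: "\<And>t. t \<in> {0..1} \<Longrightarrow> (\<lambda>w. X w t) \<in> M \<rightarrow>\<^sub>M borel"
  shows "X \<in> M \<rightarrow>\<^sub>M path_borel"
  unfolding path_borel_def
proof (rule measurable_measure_of)
  let ?m = "path_metric :: (real \<Rightarrow> 'd torus) metric"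
  interpret P: Metric_space "mspace ?m" "mdist ?m" by (rule Metric_space_mspace_mdist)
  show "{U. openin (mtopology_of ?m) U} \<subseteq> Pow (mspace ?m)"
    using openin_subset by fastforce
  show "X \<in> space M \<rightarrow> mspace ?m" using X by auto
  fix U assume "U \<in> {U. openin (mtopology_of ?m) U}"
  then have U: "U \<subseteq> mspace ?m" "\<And>\<omega>. \<omega> \<in> U \<Longrightarrow> \<exists>r>0. P.mball \<omega> r \<subseteq> U"
    by (auto simp: mtopology_of_def P.openin_mtopology)
  obtain D where D: "countable D" "D \<subseteq> mspace ?m"
    "\<forall>\<omega>\<in>mspace ?m. \<forall>e>0. \<exists>d\<in>D. mdist ?m \<omega> d \<le> e"
    by (rule separable_path_metric)
  obtain S :: "real set" where S: "countable S" "S \<subseteq> {0..1}" "{0..1} \<subseteq> closure S"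
    by (rule separable[of "{0..1::real}"])
  define I where "I = {(d, n). d \<in> D \<and> P.mcball d (1 / real (Suc n)) \<subseteq> U}"
  have "countable I"
    by (rule countable_subset[of _ "D \<times> UNIV"]) (use D(1) in \<open>auto simp: I_def\<close>)
  \<comment> \<open>By continuity, the countably many times in \<open>S\<close> decide membership in
    a closed ball.\<close>
  have dense: "\<omega> \<in> P.mcball d e" if "\<omega> \<in> mspace ?m" "d \<in> mspace ?m" "\<forall>t\<in>S. dist (d t) (\<omega> t) \<le> e" for \<omega> d e
  proof -
    have cont: "continuous_on {0..1} (\<lambda>t. dist (d t) (\<omega> t))"
      using that(1,2) by (intro continuous_on_dist) (auto simp: mspace_path_metric)
    have cl: "closure S = {0..1}"
      using S(2,3) closure_minimal[of S "{0..1}"] by auto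
    have "dist (d t) (\<omega> t) \<le> e" if "t \<in> {0..1}" for t
      using continuous_le_on_closure[of S "\<lambda>t. dist (d t) (\<omega> t)" t e] cont cl that
        \<open>\<forall>t\<in>S. dist (d t) (\<omega> t) \<le> e\<close> by auto
    then show ?thesis using that(1,2) mdist_path_metric_le_iff[of d \<omega> e] by simp
  qed
  have eq: "\<omega> \<in> U \<longleftrightarrow> (\<exists>(d, n)\<in>I. \<forall>t\<in>S. dist (d t) (\<omega> t) \<le> 1 / real (Suc n))" if \<omega>: "\<omega> \<in> mspace ?m" for \<omega>
  proof
    assume "\<omega> \<in> U"
    then obtain r where r: "r > 0" "P.mball \<omega> r \<subseteq> U" using U(2) by blast
    \<comment> \<open>Half of r is spent on the distance from the path to the centre d, half on the
      radius of the ball around d.\<close>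
    obtain n where n: "2 / real (Suc n) < r"
      using reals_Archimedean[of "r / 2"] r(1) by (auto simp: field_simps)
    obtain d where d: "d \<in> D" "mdist ?m \<omega> d \<le> 1 / real (Suc n)"
      using D(3)[rule_format, OF \<omega>, of "1 / real (Suc n)"] by auto
    have dM: "d \<in> mspace ?m" using d(1) D(2) by blast
    have "P.mcball d (1 / real (Suc n)) \<subseteq> P.mball \<omega> r"
    proof
      fix x assume "x \<in> P.mcball d (1 / real (Suc n))"
      then have x: "x \<in> mspace ?m" "mdist ?m d x \<le> 1 / real (Suc n)" by auto
      have "mdist ?m \<omega> x \<le> mdist ?m \<omega> d + mdist ?m d x"
        by (rule P.triangle[OF \<omega> dM x(1)])
      also have "\<dots> \<le> 2 / real (Suc n)" using d(2) x(2) by simp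
      finally show "x \<in> P.mball \<omega> r" using n \<omega> x(1) by simp
    qed
    then have "(d, n) \<in> I" using d(1) r(2) by (auto simp: I_def)
    moreover have "\<forall>t\<in>S. dist (d t) (\<omega> t) \<le> 1 / real (Suc n)"
      using d(2) mdist_path_metric_le_iff[OF \<omega> dM] S(2) by (auto simp: dist_commute)
    ultimately show "\<exists>(d, n)\<in>I. \<forall>t\<in>S. dist (d t) (\<omega> t) \<le> 1 / real (Suc n)" by blast
  next
    assume "\<exists>(d, n)\<in>I. \<forall>t\<in>S. dist (d t) (\<omega> t) \<le> 1 / real (Suc n)"
    then obtain d n where "(d, n) \<in> I" "\<forall>t\<in>S. dist (d t) (\<omega> t) \<le> 1 / real (Suc n)" by blast
    then show "\<omega> \<in> U" using dense[OF \<omega>, of d "1 / real (Suc n)"] D(2) by (auto simp: I_def simp del: P.in_mcball)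
  qed
  have "X -` U \<inter> space M = {w \<in> space M. \<exists>(d, n)\<in>I. \<forall>t\<in>S. dist (d t) (X w t) \<le> 1 / real (Suc n)}"
    using eq[OF X] by auto
  also have "\<dots> = (\<Union>(d, n)\<in>I. {w \<in> space M. \<forall>t\<in>S. dist (d t) (X w t) \<le> 1 / real (Suc n)})"
    by auto
  also have "\<dots> \<in> sets M"
  proof (rule sets.countable_UN'[OF \<open>countable I\<close>], rule image_subsetI)
    show "(case i of (d, n) \<Rightarrow> {w \<in> space M. \<forall>t\<in>S. dist (d t) (X w t) \<le> 1 / real (Suc n)}) \<in> sets M" if "i \<in> I" for i
    proof (cases i)
      case (Pair d n)
      have "{w \<in> space M. \<not> dist (d t) (X w t) \<le> 1 / real (Suc n)} \<in> sets M" if "t \<in> S" for t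
      proof -
        have [measurable]: "(\<lambda>w. X w t) \<in> M \<rightarrow>\<^sub>M borel" using that S(2) by (intro assms(2)) auto
        show ?thesis by measurable
      qed
      then have "space M - (\<Union>t\<in>S. {w \<in> space M. \<not> dist (d t) (X w t) \<le> 1 / real (Suc n)}) \<in> sets M"
        by (intro sets.Diff sets.top sets.countable_UN'[OF S(1)]) auto
      also have "space M - (\<Union>t\<in>S. {w \<in> space M. \<not> dist (d t) (X w t) \<le> 1 / real (Suc n)})
          = {w \<in> space M. \<forall>t\<in>S. dist (d t) (X w t) \<le> 1 / real (Suc n)}" by blast
      finally show ?thesis unfolding Pair prod.case .
    qed
  qed
  finally show "X -` U \<inter> space M \<in> sets M" .
qed

section \<open>Rules for lower integrals\<close>

text \<open>The measurability of \<^const>\<open>curve_action\<close> is never needed: for a function that need not be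
  measurable, \<^const>\<open>nn_integral\<close> is the lower integral, and the following rules suffice.\<close>

lemma nn_integral_le_of_measurable_le:
  assumes "\<And>g. g \<in> borel_measurable M \<Longrightarrow> (\<And>x. x \<in> space M \<Longrightarrow> g x \<le> f x) \<Longrightarrow> (\<integral>\<^sup>+ x. g x \<partial>M) \<le> c"
  shows "(\<integral>\<^sup>+ x. f x \<partial>M) \<le> c"
  unfolding nn_integral_def[of M f]
proof (rule SUP_least)
  fix g assume "g \<in> {g. simple_function M g \<and> g \<le> f}"
  then have g: "simple_function M g" "g \<le> f" by auto
  have "(\<integral>\<^sup>+ x. g x \<partial>M) \<le> c"
    using g by (intro assms borel_measurable_simple_function) (auto simp: le_fun_def)
  then show "integral\<^sup>S M g \<le> c" using nn_integral_eq_simple_integral[OF g(1)] by simp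
qed

text \<open>The lower integral is superadditive but in general not subadditive. For disjoint
  measurable sets it is, since a measurable minorant splits into its restrictions.\<close>

lemma nn_integral_indicator_add_le:
  assumes [measurable]: "A \<in> sets M" "B \<in> sets M" and "A \<inter> B = {}"
  shows "(\<integral>\<^sup>+ x. f x * indicator A x + f x * indicator B x \<partial>M)
    \<le> (\<integral>\<^sup>+ x. f x * indicator A x \<partial>M) + (\<integral>\<^sup>+ x. f x * indicator B x \<partial>M)"
proof (rule nn_integral_le_of_measurable_le)
  fix g assume [measurable]: "g \<in> borel_measurable M"
    and g: "\<And>x. x \<in> space M \<Longrightarrow> g x \<le> f x * indicator A x + f x * indicator B x"
  have "(\<integral>\<^sup>+ x. g x \<partial>M) = (\<integral>\<^sup>+ x. g x * indicator A x + g x * indicator B x \<partial>M)"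
  proof (rule nn_integral_cong)
    fix x assume "x \<in> space M"
    then show "g x = g x * indicator A x + g x * indicator B x"
      using g[of x] \<open>A \<inter> B = {}\<close> by (cases "x \<in> A"; cases "x \<in> B") auto
  qed
  also have "\<dots> = (\<integral>\<^sup>+ x. g x * indicator A x \<partial>M) + (\<integral>\<^sup>+ x. g x * indicator B x \<partial>M)"
    by (rule nn_integral_add) auto
  also have "\<dots> \<le> (\<integral>\<^sup>+ x. f x * indicator A x \<partial>M) + (\<integral>\<^sup>+ x. f x * indicator B x \<partial>M)"
  proof (intro add_mono nn_integral_mono)
    fix x assume "x \<in> space M"
    then show "g x * indicator A x \<le> f x * indicator A x" "g x * indicator B x \<le> f x * indicator B x"
      using g[of x] \<open>A \<inter> B = {}\<close> by (cases "x \<in> A"; cases "x \<in> B"; auto)+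
  qed
  finally show "(\<integral>\<^sup>+ x. g x \<partial>M)
      \<le> (\<integral>\<^sup>+ x. f x * indicator A x \<partial>M) + (\<integral>\<^sup>+ x. f x * indicator B x \<partial>M)" .
qed

text \<open>A measurable finite summand can be subtracted from a minorant of the sum, which leaves a
  minorant of the other summand.\<close>

lemma nn_integral_add_measurable_le:
  fixes f g :: "'w \<Rightarrow> ennreal"
  assumes [measurable]: "g \<in> borel_measurable M" and fin: "\<And>x. x \<in> space M \<Longrightarrow> g x < \<infinity>"
  shows "(\<integral>\<^sup>+ x. f x + g x \<partial>M) \<le> (\<integral>\<^sup>+ x. f x \<partial>M) + (\<integral>\<^sup>+ x. g x \<partial>M)"
proof (rule nn_integral_le_of_measurable_le)
  fix k assume [measurable]: "k \<in> borel_measurable M"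
    and k: "\<And>x. x \<in> space M \<Longrightarrow> k x \<le> f x + g x"
  have "(\<integral>\<^sup>+ x. k x \<partial>M) \<le> (\<integral>\<^sup>+ x. (k x - g x) + g x \<partial>M)"
  proof (rule nn_integral_mono)
    fix x assume "x \<in> space M"
    then show "k x \<le> (k x - g x) + g x"
      by (cases "g x \<le> k x") (auto simp: diff_add_cancel_ennreal intro: add_increasing less_imp_le)
  qed
  also have "\<dots> = (\<integral>\<^sup>+ x. k x - g x \<partial>M) + (\<integral>\<^sup>+ x. g x \<partial>M)"
    by (rule nn_integral_add) auto
  also have "\<dots> \<le> (\<integral>\<^sup>+ x. f x \<partial>M) + (\<integral>\<^sup>+ x. g x \<partial>M)"
  proof (intro add_mono nn_integral_mono order_refl)
    fix x assume "x \<in> space M"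
    then show "k x - g x \<le> f x"
      using k[of x] fin[of x] by (auto simp: ennreal_minus_le_iff add.commute)
  qed
  finally show "(\<integral>\<^sup>+ x. k x \<partial>M) \<le> (\<integral>\<^sup>+ x. f x \<partial>M) + (\<integral>\<^sup>+ x. g x \<partial>M)" .
qed

lemma nn_integral_cmult_le:
  fixes f :: "'w \<Rightarrow> ennreal"
  assumes "c > 0"
  shows "(\<integral>\<^sup>+ x. ennreal c * f x \<partial>M) \<le> ennreal c * (\<integral>\<^sup>+ x. f x \<partial>M)"
proof (rule nn_integral_le_of_measurable_le)
  fix g assume [measurable]: "g \<in> borel_measurable M"
    and g: "\<And>x. x \<in> space M \<Longrightarrow> g x \<le> ennreal c * f x"
  have inv: "ennreal c * (ennreal (inverse c) * y) = y" "ennreal (inverse c) * (ennreal c * y) = y" for y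
    using assms by (simp_all add: mult.assoc[symmetric] ennreal_mult'[symmetric])
  have "(\<integral>\<^sup>+ x. g x \<partial>M) = ennreal c * (\<integral>\<^sup>+ x. ennreal (inverse c) * g x \<partial>M)"
    by (simp add: nn_integral_cmult inv)
  also have "\<dots> \<le> ennreal c * (\<integral>\<^sup>+ x. f x \<partial>M)"
  proof (intro mult_left_mono nn_integral_mono)
    fix x assume "x \<in> space M"
    then show "ennreal (inverse c) * g x \<le> f x"
      using mult_left_mono[OF g, of x "ennreal (inverse c)"] by (simp add: inv)
  qed simp
  finally show "(\<integral>\<^sup>+ x. g x \<partial>M) \<le> ennreal c * (\<integral>\<^sup>+ x. f x \<partial>M)" .
qed

text \<open>A minorant on the target pulls back to one on the source. The reverse inequality would
  require minorants on the source to factor through X.\<close>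

lemma nn_integral_distr_le:
  fixes f :: "'b \<Rightarrow> ennreal"
  assumes [measurable]: "X \<in> M \<rightarrow>\<^sub>M N"
  shows "(\<integral>\<^sup>+ y. f y \<partial>distr M N X) \<le> (\<integral>\<^sup>+ w. f (X w) \<partial>M)"
proof (rule nn_integral_le_of_measurable_le)
  fix g assume g: "g \<in> borel_measurable (distr M N X)"
    and le: "\<And>y. y \<in> space (distr M N X) \<Longrightarrow> g y \<le> f y"
  have "(\<integral>\<^sup>+ y. g y \<partial>distr M N X) = (\<integral>\<^sup>+ w. g (X w) \<partial>M)"
    using g by (intro nn_integral_distr) auto
  also have "\<dots> \<le> (\<integral>\<^sup>+ w. f (X w) \<partial>M)"
    using measurable_space[OF assms] by (intro nn_integral_mono le) auto
  finally show "(\<integral>\<^sup>+ y. g y \<partial>distr M N X) \<le> (\<integral>\<^sup>+ w. f (X w) \<partial>M)" .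
qed

text \<open>Minorants are carried through the inverse affine map, where the change of variable for
  measurable functions applies.\<close>

lemma nn_integral_affine_le:
  fixes F :: "real \<Rightarrow> ennreal"
  assumes "c > 0"
  shows "(\<integral>\<^sup>+ t. F (a + c * t) \<partial>lborel) \<le> (\<integral>\<^sup>+ x. F x \<partial>lborel) / ennreal c"
proof (rule nn_integral_le_of_measurable_le)
  fix g :: "real \<Rightarrow> ennreal" assume "g \<in> borel_measurable lborel"
    and g: "\<And>t. t \<in> space lborel \<Longrightarrow> g t \<le> F (a + c * t)"
  then have [measurable]: "g \<in> borel_measurable borel" by simp
  have "(\<integral>\<^sup>+ x. g ((x - a) / c) \<partial>lborel) = ennreal \<bar>c\<bar> * (\<integral>\<^sup>+ t. g ((a + c * t - a) / c) \<partial>lborel)"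
    by (rule nn_integral_real_affine) (use assms in auto)
  then have "ennreal c * (\<integral>\<^sup>+ t. g t \<partial>lborel) = (\<integral>\<^sup>+ x. g ((x - a) / c) \<partial>lborel)"
    using assms by simp
  also have "\<dots> \<le> (\<integral>\<^sup>+ x. F x \<partial>lborel)"
  proof (rule nn_integral_mono)
    fix x show "g ((x - a) / c) \<le> F x" using g[of "(x - a) / c"] assms by simp
  qed
  finally have "(\<integral>\<^sup>+ t. g t \<partial>lborel) * ennreal c / ennreal c \<le> (\<integral>\<^sup>+ x. F x \<partial>lborel) / ennreal c"
    by (intro divide_right_mono_ennreal) (simp add: mult.commute)
  then show "(\<integral>\<^sup>+ t. g t \<partial>lborel) \<le> (\<integral>\<^sup>+ x. F x \<partial>lborel) / ennreal c"
    using assms by (subst (asm) mult_divide_eq_ennreal) auto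
qed

section \<open>Absolute continuity of reparametrised and concatenated curves\<close>

lemma abs_continuous_onE:
  assumes "abs_continuous_on S f" "\<epsilon> > 0"
  obtains \<delta> where "\<delta> > 0"
    "\<And>I. finite I \<Longrightarrow> (\<forall>(a, b)\<in>I. a \<le> b \<and> {a..b} \<subseteq> S) \<Longrightarrow>
      disjoint_family_on (\<lambda>(a, b). {a<..<b}) I \<Longrightarrow> (\<Sum>(a, b)\<in>I. b - a) < \<delta> \<Longrightarrow>
      (\<Sum>(a, b)\<in>I. dist (f a) (f b)) < \<epsilon>"
  using assms(1)[unfolded abs_continuous_on_def, THEN spec, THEN mp, OF assms(2)]
proof (elim exE conjE)
  fix \<delta> :: real
  assume "\<delta> > 0" and *: "\<forall>I. finite I \<longrightarrow> (\<forall>(a, b)\<in>I. a \<le> b \<and> {a..b} \<subseteq> S) \<longrightarrow>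
      disjoint_family_on (\<lambda>(a, b). {a<..<b}) I \<longrightarrow> (\<Sum>(a, b)\<in>I. b - a) < \<delta> \<longrightarrow>
      (\<Sum>(a, b)\<in>I. dist (f a) (f b)) < \<epsilon>"
  then show thesis
    by (intro that[OF _ *[THEN spec, THEN mp, THEN mp, THEN mp, THEN mp]])
qed

text \<open>A monotone Lipschitz change of parameter takes non-overlapping intervals to
  non-overlapping ones and enlarges their total length at most by the factor L. It may be constant
  on intervals, as the clamped parameters of a concatenation are.\<close>

lemma abs_continuous_on_compose:
  fixes f :: "real \<Rightarrow> 'a::metric_space"
  assumes f: "abs_continuous_on {0..1} f"
    and \<phi>: "\<And>t. t \<in> {0..1} \<Longrightarrow> \<phi> t \<in> {0..1}"
      "\<And>a b. a \<in> {0..1} \<Longrightarrow> b \<in> {0..1} \<Longrightarrow> a \<le> b \<Longrightarrow> \<phi> a \<le> \<phi> b"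
      "\<And>a b. a \<in> {0..1} \<Longrightarrow> b \<in> {0..1} \<Longrightarrow> a \<le> b \<Longrightarrow> \<phi> b - \<phi> a \<le> L * (b - a)"
    and L: "L > 0"
  shows "abs_continuous_on {0..1} (\<lambda>t. f (\<phi> t))"
  unfolding abs_continuous_on_def
proof (intro allI impI)
  fix \<epsilon> :: real assume \<epsilon>: "\<epsilon> > 0"
  obtain \<delta> where \<delta>: "\<delta> > 0"
      "\<And>I. finite I \<Longrightarrow> (\<forall>(a, b)\<in>I. a \<le> b \<and> {a..b} \<subseteq> {0..1}) \<Longrightarrow>
        disjoint_family_on (\<lambda>(a, b). {a<..<b}) I \<Longrightarrow> (\<Sum>(a, b)\<in>I. b - a) < \<delta> \<Longrightarrow>
        (\<Sum>(a, b)\<in>I. dist (f a) (f b)) < \<epsilon>"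
    using abs_continuous_onE[OF f \<epsilon>] by blast
  have "(\<Sum>(a, b)\<in>I. dist (f (\<phi> a)) (f (\<phi> b))) < \<epsilon>"
    if I: "finite I" "\<forall>(a, b)\<in>I. a \<le> b \<and> {a..b} \<subseteq> {0..1}"
      "disjoint_family_on (\<lambda>(a, b). {a<..<b}) I" "(\<Sum>(a, b)\<in>I. b - a) < \<delta> / L" for I
  proof -
    \<comment> \<open>Intervals collapsed to a point contribute nothing to the sum, and several of
      them may have the same image; on the remaining ones \<open>F\<close> is injective.\<close>
    define K where "K = {(a, b)\<in>I. \<phi> a < \<phi> b}"
    define F where "F = (\<lambda>(a, b). (\<phi> a, \<phi> b))"
    have KI: "K \<subseteq> I" by (auto simp: K_def)
    have in01: "a \<in> {0..1}" "b \<in> {0..1}" "a \<le> b" if "(a, b) \<in> I" for a b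
      using I(2) that by fastforce+
    have lt: "a < b" if "(a, b) \<in> K" for a b
      using that in01[of a b] by (auto simp: K_def order_less_le)
    have sep: "\<phi> b \<le> \<phi> a' \<or> \<phi> b' \<le> \<phi> a"
      if ab: "(a, b) \<in> K" "(a', b') \<in> K" "(a, b) \<noteq> (a', b')" for a b a' b'
    proof -
      have "{a<..<b} \<inter> {a'<..<b'} = {}"
        using disjoint_family_onD[OF I(3), of "(a, b)" "(a', b')"] ab KI by auto
      then have "max a a' \<notin> {..<min b b'}"
        using dense[of "max a a'" "min b b'"] by (auto simp: max_def min_def split: if_splits)
      then have "b \<le> a' \<or> b' \<le> a"
        using lt[OF ab(1)] lt[OF ab(2)] by auto
      moreover have "a \<in> {0..1}" "b \<in> {0..1}" "a' \<in> {0..1}" "b' \<in> {0..1}"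
        using in01 ab(1,2) KI by blast+
      ultimately show ?thesis using \<phi>(2) by blast
    qed
    have pos: "\<phi> a < \<phi> b" if "(a, b) \<in> K" for a b using that by (auto simp: K_def)
    have inj: "inj_on F K"
    proof (rule inj_onI)
      fix x y assume xy: "x \<in> K" "y \<in> K" "F x = F y"
      obtain a b a' b' where "x = (a, b)" "y = (a', b')" by (metis surj_pair)
      then show "x = y" using sep[of a b a' b'] pos[of a b] pos[of a' b'] xy by (auto simp: F_def)
    qed
    have "(\<Sum>(a, b)\<in>F ` K. dist (f a) (f b)) < \<epsilon>"
    proof (rule \<delta>(2))
      show "finite (F ` K)" using I(1) KI finite_subset by blast
      show "\<forall>(a, b)\<in>F ` K. a \<le> b \<and> {a..b} \<subseteq> {0..1}"
      proof (clarsimp simp: F_def)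
        fix a b assume "(a, b) \<in> K"
        then show "\<phi> a \<le> \<phi> b \<and> (\<phi> a \<le> \<phi> b \<longrightarrow> 0 \<le> \<phi> a \<and> \<phi> b \<le> 1)"
          using pos[of a b] in01[of a b] KI \<phi>(1)[of a] \<phi>(1)[of b] by auto
      qed
      show "disjoint_family_on (\<lambda>(a, b). {a<..<b}) (F ` K)"
        unfolding disjoint_family_on_def
      proof (intro ballI impI)
        fix x y assume xy: "x \<in> F ` K" "y \<in> F ` K" "x \<noteq> y"
        then obtain a b a' b' where *: "x = (\<phi> a, \<phi> b)" "y = (\<phi> a', \<phi> b')" "(a, b) \<in> K" "(a', b') \<in> K"
          by (auto simp: F_def)
        then have "(a, b) \<noteq> (a', b')" using xy(3) by auto
        from sep[OF *(3,4) this]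
        show "(case x of (a, b) \<Rightarrow> {a<..<b}) \<inter> (case y of (a, b) \<Rightarrow> {a<..<b}) = {}"
          unfolding *(1,2) by auto
      qed
      have "(\<Sum>(a, b)\<in>F ` K. b - a) = (\<Sum>(a, b)\<in>K. \<phi> b - \<phi> a)"
        by (subst sum.reindex[OF inj]) (auto intro!: sum.cong simp: F_def)
      also have "\<dots> \<le> (\<Sum>(a, b)\<in>K. L * (b - a))"
      proof (rule sum_mono, clarify)
        fix a b assume "(a, b) \<in> K"
        then have "(a, b) \<in> I" using KI by blast
        then show "\<phi> b - \<phi> a \<le> L * (b - a)" by (intro \<phi>(3) in01)
      qed
      also have "\<dots> \<le> (\<Sum>(a, b)\<in>I. L * (b - a))"
        using in01 L by (intro sum_mono2 I(1) KI) auto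
      also have "\<dots> = L * (\<Sum>(a, b)\<in>I. b - a)"
        by (simp add: sum_distrib_left case_prod_unfold)
      also have "\<dots> < \<delta>" using I(4) L by (simp add: field_simps)
      finally show "(\<Sum>(a, b)\<in>F ` K. b - a) < \<delta>" .
    qed
    also have "(\<Sum>(a, b)\<in>F ` K. dist (f a) (f b)) = (\<Sum>(a, b)\<in>K. dist (f (\<phi> a)) (f (\<phi> b)))"
      by (subst sum.reindex[OF inj]) (auto intro!: sum.cong simp: F_def)
    also have "\<dots> = (\<Sum>(a, b)\<in>I. dist (f (\<phi> a)) (f (\<phi> b)))"
    proof (rule sum.mono_neutral_left[OF I(1) KI], rule ballI)
      fix x assume "x \<in> I - K"
      then obtain a b where x: "x = (a, b)" "(a, b) \<in> I" "(a, b) \<notin> K" by (cases x) auto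
      then have "\<phi> a = \<phi> b" using in01[of a b] \<phi>(2)[of a b] by (auto simp: K_def)
      then show "(case x of (a, b) \<Rightarrow> dist (f (\<phi> a)) (f (\<phi> b))) = 0" using x by simp
    qed
    finally show ?thesis .
  qed
  moreover have "\<delta> / L > 0" using \<delta>(1) L by simp
  ultimately show "\<exists>\<delta>>0. \<forall>I. finite I \<longrightarrow> (\<forall>(a, b)\<in>I. a \<le> b \<and> {a..b} \<subseteq> {0..1}) \<longrightarrow>
      disjoint_family_on (\<lambda>(a, b). {a<..<b}) I \<longrightarrow> (\<Sum>(a, b)\<in>I. b - a) < \<delta> \<longrightarrow>
      (\<Sum>(a, b)\<in>I. dist (f (\<phi> a)) (f (\<phi> b))) < \<epsilon>"
    by blast
qed

text \<open>Designed for concatenations: f and g are the two pieces with clamped parameters, and an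
  increment of h is at most the sum of theirs.\<close>

lemma abs_continuous_on_dist_le_add:
  assumes f: "abs_continuous_on {0..1} f" and g: "abs_continuous_on {0..1} g"
    and le: "\<And>a b. a \<in> {0..1} \<Longrightarrow> b \<in> {0..1} \<Longrightarrow> a \<le> b \<Longrightarrow>
      dist (h a) (h b) \<le> dist (f a) (f b) + dist (g a) (g b)"
  shows "abs_continuous_on {0..1} h"
  unfolding abs_continuous_on_def
proof (intro allI impI)
  fix \<epsilon> :: real assume "\<epsilon> > 0"
  then have e: "\<epsilon> / 2 > 0" by simp
  obtain \<delta>1 where \<delta>1: "\<delta>1 > 0"
      "\<And>I. finite I \<Longrightarrow> (\<forall>(a, b)\<in>I. a \<le> b \<and> {a..b} \<subseteq> {0..1}) \<Longrightarrow>
        disjoint_family_on (\<lambda>(a, b). {a<..<b}) I \<Longrightarrow> (\<Sum>(a, b)\<in>I. b - a) < \<delta>1 \<Longrightarrow>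
        (\<Sum>(a, b)\<in>I. dist (f a) (f b)) < \<epsilon> / 2"
    using abs_continuous_onE[OF f e] by blast
  obtain \<delta>2 where \<delta>2: "\<delta>2 > 0"
      "\<And>I. finite I \<Longrightarrow> (\<forall>(a, b)\<in>I. a \<le> b \<and> {a..b} \<subseteq> {0..1}) \<Longrightarrow>
        disjoint_family_on (\<lambda>(a, b). {a<..<b}) I \<Longrightarrow> (\<Sum>(a, b)\<in>I. b - a) < \<delta>2 \<Longrightarrow>
        (\<Sum>(a, b)\<in>I. dist (g a) (g b)) < \<epsilon> / 2"
    using abs_continuous_onE[OF g e] by blast
  have "(\<Sum>(a, b)\<in>I. dist (h a) (h b)) < \<epsilon>"
    if I: "finite I" "\<forall>(a, b)\<in>I. a \<le> b \<and> {a..b} \<subseteq> {0..1}"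
      "disjoint_family_on (\<lambda>(a, b). {a<..<b}) I" "(\<Sum>(a, b)\<in>I. b - a) < min \<delta>1 \<delta>2" for I
  proof -
    have in01: "a \<in> {0..1}" "b \<in> {0..1}" "a \<le> b" if "(a, b) \<in> I" for a b
      using I(2) that by fastforce+
    have "(\<Sum>(a, b)\<in>I. dist (h a) (h b)) \<le> (\<Sum>(a, b)\<in>I. dist (f a) (f b) + dist (g a) (g b))"
      using le in01 by (intro sum_mono) auto
    also have "\<dots> = (\<Sum>(a, b)\<in>I. dist (f a) (f b)) + (\<Sum>(a, b)\<in>I. dist (g a) (g b))"
      by (simp add: sum.distrib case_prod_unfold)
    also have "\<dots> < \<epsilon>" using \<delta>1(2)[OF I(1-3)] \<delta>2(2)[OF I(1-3)] I(4) by simp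
    finally show ?thesis .
  qed
  moreover have "min \<delta>1 \<delta>2 > 0" using \<delta>1(1) \<delta>2(1) by simp
  ultimately show "\<exists>\<delta>>0. \<forall>I. finite I \<longrightarrow> (\<forall>(a, b)\<in>I. a \<le> b \<and> {a..b} \<subseteq> {0..1}) \<longrightarrow>
      disjoint_family_on (\<lambda>(a, b). {a<..<b}) I \<longrightarrow> (\<Sum>(a, b)\<in>I. b - a) < \<delta> \<longrightarrow>
      (\<Sum>(a, b)\<in>I. dist (h a) (h b)) < \<epsilon>"
    by blast
qed

section \<open>Velocity under affine change of time\<close>

lemma velocity_eqI:
  assumes "has_velocity \<omega> v t" "t \<in> {0..1}"
  shows "velocity \<omega> t = v"
  using assms has_velocity_unique[OF _ _ assms(2)] unfolding velocity_def by auto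

lemma has_velocity_affine:
  fixes p q :: "real \<Rightarrow> 'd::finite torus"
  assumes v: "has_velocity p v (\<alpha> + \<beta> * t0)"
    and J: "open J" "t0 \<in> J" "J \<subseteq> {0..1}"
    and q: "\<And>t. t \<in> J \<Longrightarrow> \<alpha> + \<beta> * t \<in> {0..1} \<and> q t = p (\<alpha> + \<beta> * t)"
  shows "has_velocity q (\<beta> *\<^sub>R v) t0"
proof -
  obtain w where w: "\<forall>s\<in>{0..1}. to_torus (w s) = p s"
      "(w has_vector_derivative v) (at (\<alpha> + \<beta> * t0) within {0..1})"
    using v unfolding has_velocity_def by blast
  \<comment> \<open>Outside J any lift of q will do, because the lift in \<open>has_velocity\<close>
    has to be regular only at the time considered.\<close>
  define w' where "w' t = (if t \<in> J then w (\<alpha> + \<beta> * t) else torus_section (q t))" for t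
  have "((\<lambda>t. \<alpha> + \<beta> * t) has_vector_derivative \<beta>) (at t0 within J)"
    by (auto intro!: derivative_eq_intros)
  moreover have "(w has_vector_derivative v) (at (\<alpha> + \<beta> * t0) within (\<lambda>t. \<alpha> + \<beta> * t) ` J)"
    using w(2) by (rule has_vector_derivative_within_subset) (use q in auto)
  ultimately have "((w \<circ> (\<lambda>t. \<alpha> + \<beta> * t)) has_vector_derivative \<beta> *\<^sub>R v) (at t0 within J)"
    by (rule vector_diff_chain_within)
  then have "((w \<circ> (\<lambda>t. \<alpha> + \<beta> * t)) has_vector_derivative \<beta> *\<^sub>R v) (at t0)"
    using at_within_open[OF J(2,1)] by simp
  then have "(w' has_vector_derivative \<beta> *\<^sub>R v) (at t0)"
    by (rule has_vector_derivative_transform_within_open[OF _ J(1,2)]) (simp add: w'_def)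
  then have "(w' has_vector_derivative \<beta> *\<^sub>R v) (at t0 within {0..1})"
    by (rule has_vector_derivative_at_within)
  moreover have "\<forall>s\<in>{0..1}. to_torus (w' s) = q s"
    using w(1) q by (auto simp: w'_def)
  ultimately show ?thesis unfolding has_velocity_def by blast
qed

text \<open>If p has no velocity at the corresponding time, neither has q, as the inverse change of
  parameter shows; both sides are then the default value 0.\<close>

lemma velocity_affine:
  fixes p q :: "real \<Rightarrow> 'd::finite torus"
  assumes J: "open J" "t0 \<in> J" "J \<subseteq> {0..1}" and \<beta>: "\<beta> \<noteq> 0"
    and q: "\<And>t. t \<in> J \<Longrightarrow> \<alpha> + \<beta> * t \<in> {0..1} \<and> q t = p (\<alpha> + \<beta> * t)"
  shows "velocity q t0 = \<beta> *\<^sub>R velocity p (\<alpha> + \<beta> * t0)"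
proof (cases "\<exists>v. has_velocity p v (\<alpha> + \<beta> * t0)")
  case True
  then obtain v where v: "has_velocity p v (\<alpha> + \<beta> * t0)" by blast
  have "has_velocity q (\<beta> *\<^sub>R v) t0"
    using v J q by (rule has_velocity_affine)
  then show ?thesis
    using velocity_eqI[OF v] velocity_eqI[of q "\<beta> *\<^sub>R v" t0] q[OF J(2)] J(2,3) by auto
next
  case False
  have "\<not> has_velocity q u t0" for u
  proof
    assume u: "has_velocity q u t0"
    let ?J = "(\<lambda>t. \<alpha> + \<beta> *\<^sub>R t) ` J"
    have "has_velocity p (inverse \<beta> *\<^sub>R u) (\<alpha> + \<beta> * t0)"
    proof (rule has_velocity_affine[where J = ?J])
      show "has_velocity q u (- \<alpha> / \<beta> + inverse \<beta> * (\<alpha> + \<beta> * t0))"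
        using u \<beta> by (simp add: field_simps)
      show "open ?J" using J(1) \<beta> by (rule open_affinity)
      show "\<alpha> + \<beta> * t0 \<in> ?J" using J(2) by auto
      show "?J \<subseteq> {0..1}" using q by auto
      fix s assume "s \<in> ?J"
      then obtain t where t: "t \<in> J" "s = \<alpha> + \<beta> * t" by auto
      have "- \<alpha> / \<beta> + inverse \<beta> * s = t" using \<beta> t(2) by (simp add: field_simps)
      then show "- \<alpha> / \<beta> + inverse \<beta> * s \<in> {0..1} \<and> p s = q (- \<alpha> / \<beta> + inverse \<beta> * s)"
        using q[OF t(1)] t J(3) by auto
    qed
    then show False using False by blast
  qed
  then show ?thesis using False by (simp add: velocity_def)
qed

section \<open>Concatenated and geodesic paths\<close>

text \<open>Restriction to [0,1] makes the result extensional, as \<open>mspace path_metric\<close>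
  requires; \<open>geod_path\<close> is restricted for the same reason.\<close>

definition path_join :: "real \<Rightarrow> (real \<Rightarrow> 'd::finite torus) \<Rightarrow> (real \<Rightarrow> 'd torus) \<Rightarrow> real \<Rightarrow> 'd torus" where
  "path_join s p q = (\<lambda>t\<in>{0..1}. if t \<le> s then p (t / s) else q ((t - s) / (1 - s)))"

definition geod_path :: "'d::finite torus \<Rightarrow> 'd torus \<Rightarrow> real \<Rightarrow> 'd torus" where
  "geod_path p q = (\<lambda>t\<in>{0..1}. torus_geod t p q)"

lemma path_join_0 [simp]: "0 < s \<Longrightarrow> path_join s p q 0 = p 0"
  and path_join_1 [simp]: "s < 1 \<Longrightarrow> path_join s p q 1 = q 1"
  and geod_path_0 [simp]: "geod_path a b 0 = a"
  and geod_path_1 [simp]: "geod_path a b 1 = b"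
  by (simp_all add: path_join_def geod_path_def)

lemma path_join_in_mspace:
  assumes s: "0 < s" "s < 1" and p: "p \<in> mspace path_metric" and q: "q \<in> mspace path_metric"
    and eq: "p 1 = q 0"
  shows "path_join s p q \<in> mspace path_metric"
proof -
  have cp: "continuous_on {0..1} p" and cq: "continuous_on {0..1} q"
    using p q by (auto simp: mspace_path_metric)
  have "continuous_on ({0..s} \<union> {s..1}) (\<lambda>t. if t \<le> s then p (t / s) else q ((t - s) / (1 - s)))"
  proof (rule continuous_on_If)
    show "continuous_on {0..s} (\<lambda>t. p (t / s))"
      by (rule continuous_on_compose2[OF cp])
        (use s in \<open>auto intro!: continuous_on_divide continuous_on_id continuous_on_const\<close>)
    show "continuous_on {s..1} (\<lambda>t. q ((t - s) / (1 - s)))"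
      by (rule continuous_on_compose2[OF cq])
        (use s in \<open>auto intro!: continuous_on_divide continuous_on_diff continuous_on_id continuous_on_const\<close>)
  qed (use s eq in auto)
  moreover have "{0..s} \<union> {s..1} = {0..1}" using s by auto
  ultimately have "continuous_on {0..1} (\<lambda>t. if t \<le> s then p (t / s) else q ((t - s) / (1 - s)))"
    by simp
  then have "continuous_on {0..1} (path_join s p q)"
    by (rule continuous_on_eq) (simp add: path_join_def)
  then show ?thesis by (simp add: mspace_path_metric path_join_def)
qed

lemma geod_path_in_mspace: "geod_path p q \<in> mspace path_metric"
proof -
  have "continuous_on {0..1} (\<lambda>t. torus_geod t p q)"
    unfolding torus_geod_def
    by (rule continuous_on_compose2[OF continuous_on_to_torus[of UNIV]]) (auto intro!: continuous_intros)
  then have "continuous_on {0..1} (geod_path p q)"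
    by (rule continuous_on_eq) (simp add: geod_path_def)
  then show ?thesis by (simp add: mspace_path_metric geod_path_def)
qed

lemma abs_continuous_on_path_join:
  assumes s: "0 < s" "s < 1" and p: "abs_continuous_on {0..1} p" and q: "abs_continuous_on {0..1} q"
    and eq: "p 1 = q 0"
  shows "abs_continuous_on {0..1} (path_join s p q)"
proof (rule abs_continuous_on_dist_le_add)
  show "abs_continuous_on {0..1} (\<lambda>t. p (min t s / s))"
    using s by (intro abs_continuous_on_compose[OF p, where L = "1 / s"])
      (auto simp: min_def field_simps)
  show "abs_continuous_on {0..1} (\<lambda>t. q ((max t s - s) / (1 - s)))"
    using s by (intro abs_continuous_on_compose[OF q, where L = "1 / (1 - s)"])
      (auto simp: max_def divide_right_mono diff_divide_distrib[symmetric])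
  fix a b :: real assume ab: "a \<in> {0..1}" "b \<in> {0..1}" "a \<le> b"
  show "dist (path_join s p q a) (path_join s p q b)
      \<le> dist (p (min a s / s)) (p (min b s / s))
        + dist (q ((max a s - s) / (1 - s))) (q ((max b s - s) / (1 - s)))"
  \<comment> \<open>Only an interval that straddles the junction calls for the triangle inequality,
    through the common point p 1 = q 0.\<close>
  proof (cases "a \<le> s \<and> \<not> b \<le> s")
    case True
    then show ?thesis
      using ab s eq dist_triangle[of "p (a / s)" "q ((b - s) / (1 - s))" "p 1"]
      by (simp add: path_join_def)
  next
    case False
    then show ?thesis using ab s by (auto simp: path_join_def max_def)
  qed
qed

text \<open>Running p during time s multiplies its speed by 1/s and the duration by s, hence its
  action by 1/s. The relation is an inequality because the integrals are treated as lower
  integrals.\<close>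

lemma curve_action_path_join:
  fixes p q :: "real \<Rightarrow> 'd::finite torus"
  assumes s: "0 < s" "s < 1" and eq: "p 1 = q 0"
  shows "curve_action (path_join s p q) \<le> curve_action p / ennreal s + curve_action q / ennreal (1 - s)"
\<comment> \<open>A piece that is not absolutely continuous makes the right-hand side
  infinite.\<close>
proof (cases "abs_continuous_on {0..1} p \<and> abs_continuous_on {0..1} q")
  case False
  then show ?thesis by (auto simp: curve_action_def ennreal_top_divide)
next
  case True
  let ?j = "path_join s p q"
  let ?V = "\<lambda>\<omega> :: real \<Rightarrow> 'd torus. \<lambda>t. ennreal ((norm (velocity \<omega> t))\<^sup>2)"
  \<comment> \<open>The squared speed gains the factor \<beta> twice and the change of variable
    loses it once.\<close>
  have half: "(\<integral>\<^sup>+ t. ?V ?j t * indicator {l<..<r} t \<partial>lborel)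
      \<le> (\<integral>\<^sup>+ t\<in>{0..1}. ?V \<omega> t \<partial>lborel) * ennreal \<beta>"
    if \<beta>: "\<beta> > 0" and lr: "{l<..<r} \<subseteq> {0..1}"
      and j: "\<And>t. t \<in> {l<..<r} \<Longrightarrow> \<alpha> + \<beta> * t \<in> {0..1} \<and> ?j t = \<omega> (\<alpha> + \<beta> * t)"
    for \<omega> :: "real \<Rightarrow> 'd torus" and \<alpha> \<beta> l r
  proof -
    have "(\<integral>\<^sup>+ t. ?V ?j t * indicator {l<..<r} t \<partial>lborel)
        \<le> (\<integral>\<^sup>+ t. ennreal (\<beta>\<^sup>2) * (?V \<omega> (\<alpha> + \<beta> * t) * indicator {0..1} (\<alpha> + \<beta> * t)) \<partial>lborel)"
    proof (rule nn_integral_mono)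
      fix t
      show "?V ?j t * indicator {l<..<r} t
          \<le> ennreal (\<beta>\<^sup>2) * (?V \<omega> (\<alpha> + \<beta> * t) * indicator {0..1} (\<alpha> + \<beta> * t))"
      proof (cases "t \<in> {l<..<r}")
        case t: True
        have "velocity ?j t = \<beta> *\<^sub>R velocity \<omega> (\<alpha> + \<beta> * t)"
          by (rule velocity_affine[of "{l<..<r}"]) (use t lr j \<beta> in auto)
        then show ?thesis using t j[OF t] \<beta> by (simp add: power_mult_distrib ennreal_mult)
      qed simp
    qed
    also have "\<dots> \<le> (\<integral>\<^sup>+ x. ennreal (\<beta>\<^sup>2) * (?V \<omega> x * indicator {0..1} x) \<partial>lborel) / ennreal \<beta>"
      by (rule nn_integral_affine_le[OF \<beta>])
    also have "\<dots> \<le> (\<integral>\<^sup>+ t\<in>{0..1}. ?V \<omega> t \<partial>lborel) * ennreal \<beta>"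
    proof -
      have "(\<integral>\<^sup>+ x. ennreal (\<beta>\<^sup>2) * (?V \<omega> x * indicator {0..1} x) \<partial>lborel)
          \<le> ennreal (\<beta>\<^sup>2) * (\<integral>\<^sup>+ t\<in>{0..1}. ?V \<omega> t \<partial>lborel)"
        using \<beta> by (intro nn_integral_cmult_le) auto
      then have "(\<integral>\<^sup>+ x. ennreal (\<beta>\<^sup>2) * (?V \<omega> x * indicator {0..1} x) \<partial>lborel) / ennreal \<beta>
          \<le> ennreal (\<beta>\<^sup>2) * (\<integral>\<^sup>+ t\<in>{0..1}. ?V \<omega> t \<partial>lborel) / ennreal \<beta>"
        by (rule divide_right_mono_ennreal)
      also have "\<dots> = (\<integral>\<^sup>+ t\<in>{0..1}. ?V \<omega> t \<partial>lborel) * (ennreal (\<beta>\<^sup>2) / ennreal \<beta>)"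
        by (subst mult.commute) (rule ennreal_times_divide[symmetric])
      also have "ennreal (\<beta>\<^sup>2) / ennreal \<beta> = ennreal \<beta>"
        using \<beta> by (simp add: divide_ennreal power2_eq_square)
      finally show ?thesis .
    qed
    finally show ?thesis .
  qed
  \<comment> \<open>The end points and the junction form a null set; on the remaining open intervals
    \<open>velocity_affine\<close> applies.\<close>
  have "(\<integral>\<^sup>+ t\<in>{0..1}. ?V ?j t \<partial>lborel)
      \<le> (\<integral>\<^sup>+ t. ?V ?j t * indicator {0<..<s} t + ?V ?j t * indicator {s<..<1} t \<partial>lborel)"
  proof (rule nn_integral_mono_AE)
    show "AE t in lborel. ?V ?j t * indicator {0..1} t
        \<le> ?V ?j t * indicator {0<..<s} t + ?V ?j t * indicator {s<..<1} t"
      using AE_lborel_singleton[of 0] AE_lborel_singleton[of 1] AE_lborel_singleton[of s]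
      by eventually_elim (auto simp: indicator_def)
  qed
  also have "\<dots> \<le> (\<integral>\<^sup>+ t. ?V ?j t * indicator {0<..<s} t \<partial>lborel) + (\<integral>\<^sup>+ t. ?V ?j t * indicator {s<..<1} t \<partial>lborel)"
    by (rule nn_integral_indicator_add_le) auto
  also have "\<dots> \<le> (\<integral>\<^sup>+ t\<in>{0..1}. ?V p t \<partial>lborel) * ennreal (1 / s)
      + (\<integral>\<^sup>+ t\<in>{0..1}. ?V q t \<partial>lborel) * ennreal (1 / (1 - s))"
  proof (rule add_mono)
    show "(\<integral>\<^sup>+ t. ?V ?j t * indicator {0<..<s} t \<partial>lborel) \<le> (\<integral>\<^sup>+ t\<in>{0..1}. ?V p t \<partial>lborel) * ennreal (1 / s)"
      by (rule half[where \<alpha> = 0]) (use s in \<open>auto simp: path_join_def\<close>)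
    show "(\<integral>\<^sup>+ t. ?V ?j t * indicator {s<..<1} t \<partial>lborel) \<le> (\<integral>\<^sup>+ t\<in>{0..1}. ?V q t \<partial>lborel) * ennreal (1 / (1 - s))"
    proof (rule half[where \<alpha> = "- s / (1 - s)"])
      fix t assume t: "t \<in> {s<..<1}"
      have "- s / (1 - s) + 1 / (1 - s) * t = (t - s) / (1 - s)" by (simp add: diff_divide_distrib)
      then show "- s / (1 - s) + 1 / (1 - s) * t \<in> {0..1} \<and> ?j t = q (- s / (1 - s) + 1 / (1 - s) * t)"
        using s t by (auto simp: path_join_def)
    qed (use s in auto)
  qed
  finally have "(\<integral>\<^sup>+ t\<in>{0..1}. ?V ?j t \<partial>lborel) / 2
      \<le> ((\<integral>\<^sup>+ t\<in>{0..1}. ?V p t \<partial>lborel) * ennreal (1 / s)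
        + (\<integral>\<^sup>+ t\<in>{0..1}. ?V q t \<partial>lborel) * ennreal (1 / (1 - s))) / 2"
    by (rule divide_right_mono_ennreal)
  also have "\<dots> = curve_action p / ennreal s + curve_action q / ennreal (1 - s)"
  proof -
    have inv: "inverse (ennreal c) = ennreal (1 / c)" if "c > 0" for c
      using that by (simp add: inverse_ennreal inverse_eq_divide)
    show ?thesis
      using True s inv[of s] inv[of "1 - s"]
      by (simp add: curve_action_def divide_ennreal_def ring_distribs mult_ac)
  qed
  finally show ?thesis
    using abs_continuous_on_path_join[OF s conjunct1[OF True] conjunct2[OF True] eq]
    by (simp add: curve_action_def)
qed

text \<open>The geodesic has constant speed \<open>dist p q\<close>, so its action is half of the
  bound.\<close>

lemma curve_action_geod_path: "curve_action (geod_path p q) \<le> ennreal ((dist p q)\<^sup>2)"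
proof -
  have "abs_continuous_on {0..1} (geod_path p q)"
    unfolding abs_continuous_on_def
  proof (intro allI impI)
    fix \<epsilon> :: real assume \<epsilon>: "\<epsilon> > 0"
    \<comment> \<open>Adding 1 to the Lipschitz constant keeps the denominator positive when p =
      q.\<close>
    have "(\<Sum>(a, b)\<in>I. dist (geod_path p q a) (geod_path p q b)) < \<epsilon>"
      if I: "finite I" "\<forall>(a, b)\<in>I. a \<le> b \<and> {a..b} \<subseteq> {0..1}" "(\<Sum>(a, b)\<in>I. b - a) < \<epsilon> / (dist p q + 1)" for I
    proof -
      have "(\<Sum>(a, b)\<in>I. dist (geod_path p q a) (geod_path p q b)) \<le> (\<Sum>(a, b)\<in>I. (b - a) * (dist p q + 1))"
      proof (rule sum_mono, clarify)
        fix a b assume "(a, b) \<in> I"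
        then have "a \<le> b" "0 \<le> a" "b \<le> 1" using I(2) by fastforce+
        then have "dist (geod_path p q a) (geod_path p q b) \<le> (b - a) * dist p q"
          using dist_torus_geod_le[of a p q b] by (simp add: geod_path_def)
        also have "\<dots> \<le> (b - a) * (dist p q + 1)" using \<open>a \<le> b\<close> by (intro mult_left_mono) auto
        finally show "dist (geod_path p q a) (geod_path p q b) \<le> (b - a) * (dist p q + 1)" .
      qed
      also have "\<dots> = (\<Sum>(a, b)\<in>I. b - a) * (dist p q + 1)"
        by (simp add: sum_distrib_right case_prod_unfold)
      also have "\<dots> < \<epsilon>"
        using I(3) by (subst pos_less_divide_eq[symmetric]) (auto intro: add_nonneg_pos)
      finally show ?thesis .
    qed
    moreover have "\<epsilon> / (dist p q + 1) > 0" using \<epsilon> by (intro divide_pos_pos add_nonneg_pos) auto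
    ultimately show "\<exists>\<delta>>0. \<forall>I. finite I \<longrightarrow> (\<forall>(a, b)\<in>I. a \<le> b \<and> {a..b} \<subseteq> {0..1}) \<longrightarrow>
        disjoint_family_on (\<lambda>(a, b). {a<..<b}) I \<longrightarrow> (\<Sum>(a, b)\<in>I. b - a) < \<delta> \<longrightarrow>
        (\<Sum>(a, b)\<in>I. dist (geod_path p q a) (geod_path p q b)) < \<epsilon>"
      by blast
  qed
  moreover have "norm (velocity (geod_path p q) t) = dist p q" if "t \<in> {0..1}" for t
  proof -
    have "has_velocity (geod_path p q) (torus_disp p q) t"
      unfolding has_velocity_def
    proof (intro exI conjI ballI)
      show "to_torus (torus_section p + s *\<^sub>R torus_disp p q) = geod_path p q s" if "s \<in> {0..1}" for s
        using that by (simp add: geod_path_def torus_geod_def)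
      show "((\<lambda>s. torus_section p + s *\<^sub>R torus_disp p q) has_vector_derivative torus_disp p q) (at t within {0..1})"
        by (auto intro!: derivative_eq_intros)
    qed
    then show ?thesis using velocity_eqI that norm_torus_disp by metis
  qed
  ultimately have "curve_action (geod_path p q)
      = (\<integral>\<^sup>+ t\<in>{0..1::real}. ennreal ((dist p q)\<^sup>2) \<partial>lborel) / 2"
    by (auto simp: curve_action_def indicator_def intro!: arg_cong[where f = "\<lambda>x. x / 2"] nn_integral_cong)
  also have "\<dots> = ennreal ((dist p q)\<^sup>2) / 2" by (simp add: nn_integral_cmult_indicator)
  also have "\<dots> \<le> ennreal ((dist p q)\<^sup>2)"
    by (simp add: ennreal_divide_numeral ennreal_leI)
  finally show ?thesis .
qed

section \<open>Random connecting paths\<close>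

text \<open>For fixed w, a measurable minorant of \<open>f (fst z)\<close> is at most
  \<open>f w\<close>, and it is averaged against a kernel of mass at most 1. Mass below 1 occurs in
  \<open>approximate_gluing\<close>, on cells of measure zero.\<close>

lemma nn_integral_density_fst_le:
  fixes f :: "'w \<Rightarrow> ennreal"
  assumes "sigma_finite_measure N" and [measurable]: "D \<in> borel_measurable (M \<Otimes>\<^sub>M N)"
    and D: "\<And>w. w \<in> space M \<Longrightarrow> (\<integral>\<^sup>+ y. D (w, y) \<partial>N) \<le> 1"
  shows "(\<integral>\<^sup>+ z. f (fst z) \<partial>density (M \<Otimes>\<^sub>M N) D) \<le> (\<integral>\<^sup>+ w. f w \<partial>M)"
proof (rule nn_integral_le_of_measurable_le)
  interpret N: sigma_finite_measure N by fact
  fix g assume "g \<in> borel_measurable (density (M \<Otimes>\<^sub>M N) D)"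
    and g: "\<And>z. z \<in> space (density (M \<Otimes>\<^sub>M N) D) \<Longrightarrow> g z \<le> f (fst z)"
  then have [measurable]: "g \<in> borel_measurable (M \<Otimes>\<^sub>M N)" by simp
  have "(\<integral>\<^sup>+ z. g z \<partial>density (M \<Otimes>\<^sub>M N) D) = (\<integral>\<^sup>+ z. D z * g z \<partial>(M \<Otimes>\<^sub>M N))"
    by (rule nn_integral_density) auto
  also have "\<dots> = (\<integral>\<^sup>+ w. \<integral>\<^sup>+ y. D (w, y) * g (w, y) \<partial>N \<partial>M)"
    by (rule N.nn_integral_fst[symmetric]) auto
  also have "\<dots> \<le> (\<integral>\<^sup>+ w. f w \<partial>M)"
  proof (rule nn_integral_mono)
    fix w assume w: "w \<in> space M"
    have "(\<integral>\<^sup>+ y. D (w, y) * g (w, y) \<partial>N) \<le> (\<integral>\<^sup>+ y. D (w, y) * f w \<partial>N)"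
      using w g by (intro nn_integral_mono mult_left_mono) (auto simp: space_pair_measure)
    also have "\<dots> = (\<integral>\<^sup>+ y. D (w, y) \<partial>N) * f w"
      using w by (intro nn_integral_multc) auto
    also have "\<dots> \<le> f w" using mult_right_mono[OF D[OF w], of "f w"] by simp
    finally show "(\<integral>\<^sup>+ y. D (w, y) * g (w, y) \<partial>N) \<le> f w" .
  qed
  finally show "(\<integral>\<^sup>+ z. g z \<partial>density (M \<Otimes>\<^sub>M N) D) \<le> (\<integral>\<^sup>+ w. f w \<partial>M)" .
qed

text \<open>The components are random points z and z' near the two ends, an intermediate point u,
  and a flag telling whether the latter two are to be replaced by z.\<close>

type_synonym 'd aux = "'d torus \<times> 'd torus \<times> 'd torus \<times> bool"

text \<open>A reference measure, of total mass 2 because of the flag; the probabilities come from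
  \<open>aux_density\<close>.\<close>

definition aux_measure :: "'d::finite aux measure" where
  "aux_measure = torus_measure \<Otimes>\<^sub>M (torus_measure \<Otimes>\<^sub>M (torus_measure \<Otimes>\<^sub>M count_space UNIV))"

lemma sigma_finite_aux_measure: "sigma_finite_measure aux_measure"
  unfolding aux_measure_def
  by (intro sigma_finite_pair_measure sigma_finite_torus_measure sigma_finite_measure_count_space)

lemma sets_aux_measure [measurable_cong]:
  "sets aux_measure = sets (borel \<Otimes>\<^sub>M (borel \<Otimes>\<^sub>M (borel \<Otimes>\<^sub>M count_space UNIV)))"
  unfolding aux_measure_def by (intro sets_pair_measure_cong sets_torus_measure refl)

lemma nn_integral_aux_measure:
  fixes H :: "'d::finite aux \<Rightarrow> ennreal"
  assumes [measurable]: "H \<in> borel_measurable aux_measure"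
  shows "(\<integral>\<^sup>+ y. H y \<partial>aux_measure) = (\<integral>\<^sup>+ z. \<integral>\<^sup>+ z'. \<integral>\<^sup>+ u. H (z, z', u, True) + H (z, z', u, False)
    \<partial>torus_measure \<partial>torus_measure \<partial>torus_measure)"
proof -
  let ?T = "torus_measure :: 'd torus measure" and ?B = "count_space (UNIV :: bool set)"
  interpret B: sigma_finite_measure ?B by (rule sigma_finite_measure_count_space)
  interpret TB: sigma_finite_measure "?T \<Otimes>\<^sub>M ?B"
    by (intro sigma_finite_pair_measure sigma_finite_torus_measure sigma_finite_measure_count_space)
  interpret TTB: sigma_finite_measure "?T \<Otimes>\<^sub>M (?T \<Otimes>\<^sub>M ?B)"
    by (intro sigma_finite_pair_measure sigma_finite_torus_measure sigma_finite_measure_count_space)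
  have [measurable]: "H \<in> borel_measurable (?T \<Otimes>\<^sub>M (?T \<Otimes>\<^sub>M (?T \<Otimes>\<^sub>M ?B)))"
    using assms by (simp add: aux_measure_def)
  have "(\<integral>\<^sup>+ y. H y \<partial>aux_measure) = (\<integral>\<^sup>+ z. \<integral>\<^sup>+ y. H (z, y) \<partial>(?T \<Otimes>\<^sub>M (?T \<Otimes>\<^sub>M ?B)) \<partial>?T)"
    unfolding aux_measure_def by (rule TTB.nn_integral_fst[symmetric]) measurable
  also have "\<dots> = (\<integral>\<^sup>+ z. \<integral>\<^sup>+ z'. \<integral>\<^sup>+ y. H (z, z', y) \<partial>(?T \<Otimes>\<^sub>M ?B) \<partial>?T \<partial>?T)"
    by (intro nn_integral_cong TB.nn_integral_fst[symmetric]) measurable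
  also have "\<dots> = (\<integral>\<^sup>+ z. \<integral>\<^sup>+ z'. \<integral>\<^sup>+ u. \<integral>\<^sup>+ b. H (z, z', u, b) \<partial>?B \<partial>?T \<partial>?T \<partial>?T)"
    by (intro nn_integral_cong B.nn_integral_fst[symmetric]) measurable
  finally show ?thesis
    by (simp add: nn_integral_count_space_finite UNIV_bool add.commute)
qed

text \<open>The delicate case is l = 0, where \<open>l / l\<close> is 0 in \<open>ennreal\<close>:
  then p vanishes almost everywhere and so does the integral.\<close>

lemma ennreal_self_divide_mult_nn_integral:
  assumes [measurable]: "p \<in> borel_measurable M" "b \<in> borel_measurable M"
    and l: "(\<integral>\<^sup>+ z. p z \<partial>M) = l" "l < \<infinity>"
  shows "l / l * (\<integral>\<^sup>+ z. p z * b z \<partial>M) = (\<integral>\<^sup>+ z. p z * b z \<partial>M)"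
proof (cases "l = 0")
  case True
  then have "AE z in M. p z = 0" using l(1) by (simp add: nn_integral_0_iff_AE)
  then have "(\<integral>\<^sup>+ z. p z * b z \<partial>M) = 0" by (subst nn_integral_0_iff_AE) auto
  then show ?thesis by simp
next
  case False
  then show ?thesis using l(2) by (simp add: top.not_eq_extremum)
qed

text \<open>With weight \<open>m z\<close> the three auxiliary points coincide; otherwise \<open>z\<close> and \<open>z'\<close> are drawn
  independently from \<open>p\<close> and \<open>q\<close>, which have the same mass \<open>l\<close>, and \<open>u\<close> is uniform.\<close>

definition aux_density :: "('d::finite torus \<Rightarrow> ennreal) \<Rightarrow> ('d torus \<Rightarrow> ennreal) \<Rightarrow> ('d torus \<Rightarrow> ennreal) \<Rightarrow>
    ennreal \<Rightarrow> 'd aux \<Rightarrow> ennreal" where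
  "aux_density m p q l y =
    (if snd (snd (snd y)) then m (fst y) else p (fst y) * q (fst (snd y)) / l)"

text \<open>These are the laws of (z, u) and of (z', u) for a fixed trajectory. With the flag unset,
  integrating out the other end point, of mass l, cancels the division by l, and u stays uniform and
  independent. With the flag set, z' is read from the first component, hence
  \<open>A (fst y)\<close> in both formulas.\<close>

lemma nn_integral_aux_density:
  fixes p q m A :: "'d::finite torus \<Rightarrow> ennreal" and B :: "'d torus \<Rightarrow> 'd torus \<Rightarrow> ennreal"
  assumes [measurable]: "m \<in> borel_measurable borel" "p \<in> borel_measurable borel"
      "q \<in> borel_measurable borel" "A \<in> borel_measurable borel"
      "(\<lambda>(z, u). B z u) \<in> borel_measurable (borel \<Otimes>\<^sub>M borel)"
    and l: "(\<integral>\<^sup>+ z. p z \<partial>torus_measure) = l" "(\<integral>\<^sup>+ z. q z \<partial>torus_measure) = l" "l < \<infinity>"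
  shows nn_integral_aux_density_fst: "(\<integral>\<^sup>+ y. aux_density m p q l y *
        (if snd (snd (snd y)) then A (fst y) else B (fst y) (fst (snd (snd y)))) \<partial>aux_measure)
      = (\<integral>\<^sup>+ z. m z * A z + p z * (\<integral>\<^sup>+ u. B z u \<partial>torus_measure) \<partial>torus_measure)" (is ?C1)
    and nn_integral_aux_density_snd: "(\<integral>\<^sup>+ y. aux_density m p q l y *
        (if snd (snd (snd y)) then A (fst y) else B (fst (snd y)) (fst (snd (snd y)))) \<partial>aux_measure)
      = (\<integral>\<^sup>+ z. m z * A z + q z * (\<integral>\<^sup>+ u. B z u \<partial>torus_measure) \<partial>torus_measure)" (is ?C2)
proof -
  let ?T = "torus_measure :: 'd torus measure"
  interpret T: sigma_finite_measure ?T by (rule sigma_finite_torus_measure)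
  define b where "b z = (\<integral>\<^sup>+ u. B z u \<partial>?T)" for z
  have [measurable]: "b \<in> borel_measurable borel" unfolding b_def by measurable
  have one: "(\<integral>\<^sup>+ z. c \<partial>?T) = c" for c :: ennreal by simp
  have "(\<integral>\<^sup>+ y. aux_density m p q l y *
        (if snd (snd (snd y)) then A (fst y) else B (fst y) (fst (snd (snd y)))) \<partial>aux_measure)
      = (\<integral>\<^sup>+ z. \<integral>\<^sup>+ z'. \<integral>\<^sup>+ u. m z * A z + p z * q z' / l * B z u \<partial>?T \<partial>?T \<partial>?T)"
    by (subst nn_integral_aux_measure) (auto simp: aux_density_def)
  also have "\<dots> = (\<integral>\<^sup>+ z. \<integral>\<^sup>+ z'. m z * A z + q z' * (p z / l * b z) \<partial>?T \<partial>?T)"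
    by (intro nn_integral_cong)
      (simp add: nn_integral_add nn_integral_cmult one b_def divide_ennreal_def mult_ac)
  also have "\<dots> = (\<integral>\<^sup>+ z. m z * A z + l / l * (p z * b z) \<partial>?T)"
    by (intro nn_integral_cong)
      (simp add: nn_integral_add nn_integral_multc one l, simp add: divide_ennreal_def mult_ac)
  also have "\<dots> = (\<integral>\<^sup>+ z. m z * A z \<partial>?T) + l / l * (\<integral>\<^sup>+ z. p z * b z \<partial>?T)"
    by (simp add: nn_integral_add nn_integral_cmult)
  also have "\<dots> = (\<integral>\<^sup>+ z. m z * A z + p z * b z \<partial>?T)"
    by (subst ennreal_self_divide_mult_nn_integral[OF _ _ l(1,3)]) (auto simp: nn_integral_add)
  finally show ?C1 by (simp add: b_def)
  have "(\<integral>\<^sup>+ y. aux_density m p q l y *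
        (if snd (snd (snd y)) then A (fst y) else B (fst (snd y)) (fst (snd (snd y)))) \<partial>aux_measure)
      = (\<integral>\<^sup>+ z. \<integral>\<^sup>+ z'. \<integral>\<^sup>+ u. m z * A z + p z * q z' / l * B z' u \<partial>?T \<partial>?T \<partial>?T)"
    by (subst nn_integral_aux_measure) (auto simp: aux_density_def)
  also have "\<dots> = (\<integral>\<^sup>+ z. \<integral>\<^sup>+ z'. m z * A z + p z / l * (q z' * b z') \<partial>?T \<partial>?T)"
    by (intro nn_integral_cong)
      (simp add: nn_integral_add nn_integral_cmult one b_def divide_ennreal_def mult_ac)
  also have "\<dots> = (\<integral>\<^sup>+ z. m z * A z + p z * (inverse l * (\<integral>\<^sup>+ z'. q z' * b z' \<partial>?T)) \<partial>?T)"
    by (intro nn_integral_cong)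
      (simp add: nn_integral_add nn_integral_cmult one l, simp add: divide_ennreal_def mult_ac)
  also have "\<dots> = (\<integral>\<^sup>+ z. m z * A z \<partial>?T) + l / l * (\<integral>\<^sup>+ z. q z * b z \<partial>?T)"
    by (simp add: nn_integral_add nn_integral_multc l) (simp add: divide_ennreal_def mult_ac)
  also have "\<dots> = (\<integral>\<^sup>+ z. m z * A z + q z * b z \<partial>?T)"
    by (subst ennreal_self_divide_mult_nn_integral[OF _ _ l(2,3)]) (auto simp: nn_integral_add)
  finally show ?C2 by (simp add: b_def)
qed

section \<open>Random incompressible paths\<close>

text \<open>Random paths over an arbitrary space are used instead of laws on paths: several of them
  can share the space and be concatenated. The law of such a path is an incompressible flow.\<close>

definition equidistributed :: "'w measure \<Rightarrow> ('w \<Rightarrow> real \<Rightarrow> 'd::finite torus) \<Rightarrow> bool" where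
  "equidistributed M X \<longleftrightarrow> X \<in> M \<rightarrow>\<^sub>M path_borel \<and>
    (\<forall>t\<in>{0..1}. distr M borel (\<lambda>w. X w t) = torus_measure)"

lemma equidistributedD:
  assumes "equidistributed M X"
  shows "X \<in> M \<rightarrow>\<^sub>M path_borel" "t \<in> {0..1} \<Longrightarrow> (\<lambda>w. X w t) \<in> M \<rightarrow>\<^sub>M borel"
    "t \<in> {0..1} \<Longrightarrow> distr M borel (\<lambda>w. X w t) = torus_measure"
    "w \<in> space M \<Longrightarrow> X w \<in> mspace path_metric"
  using assms measurable_compose[OF _ measurable_path_eval, of X M]
  by (auto simp: equidistributed_def space_path_borel dest: measurable_space)

text \<open>At any time the concatenation equals one of the two paths at a time that does not depend
  on w, so the dependence between the two paths never enters a one-time law.\<close>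

lemma equidistributed_path_join:
  assumes s: "0 < s" "s < 1" and X: "equidistributed M X" and Y: "equidistributed M Y"
    and eq: "\<And>w. w \<in> space M \<Longrightarrow> X w 1 = Y w 0"
  shows "equidistributed M (\<lambda>w. path_join s (X w) (Y w))"
proof -
  have dich: "(\<exists>t'\<in>{0..1}. \<forall>w. path_join s (X w) (Y w) t = X w t')
      \<or> (\<exists>t'\<in>{0..1}. \<forall>w. path_join s (X w) (Y w) t = Y w t')" if t: "t \<in> {0..1}" for t
  proof (cases "t \<le> s")
    case True
    then show ?thesis using t s by (intro disjI1 bexI[of _ "t / s"]) (auto simp: path_join_def)
  next
    case False
    then show ?thesis
      using t s by (intro disjI2 bexI[of _ "(t - s) / (1 - s)"]) (auto simp: path_join_def)
  qed
  show ?thesis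
    unfolding equidistributed_def
  proof (intro conjI ballI)
    show "(\<lambda>w. path_join s (X w) (Y w)) \<in> M \<rightarrow>\<^sub>M path_borel"
    proof (rule measurable_path_borelI)
      fix w assume "w \<in> space M"
      then show "path_join s (X w) (Y w) \<in> mspace path_metric"
        using s eq equidistributedD(4)[OF X] equidistributedD(4)[OF Y] by (intro path_join_in_mspace)
    next
      fix t :: real assume "t \<in> {0..1}"
      then show "(\<lambda>w. path_join s (X w) (Y w) t) \<in> M \<rightarrow>\<^sub>M borel"
        using dich[of t] equidistributedD(2)[OF X] equidistributedD(2)[OF Y] by auto
    qed
    fix t :: real assume "t \<in> {0..1}"
    then show "distr M borel (\<lambda>w. path_join s (X w) (Y w) t) = torus_measure"
      using dich[of t] equidistributedD(3)[OF X] equidistributedD(3)[OF Y] by auto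
  qed
qed

lemma distr_eq_torus_measureI:
  assumes [measurable]: "X \<in> M \<rightarrow>\<^sub>M borel"
    and int: "\<And>f. f \<in> borel_measurable borel \<Longrightarrow> (\<integral>\<^sup>+ w. f (X w) \<partial>M) = (\<integral>\<^sup>+ p. f p \<partial>torus_measure)"
  shows "distr M borel X = torus_measure"
proof (rule measure_eqI)
  fix A assume "A \<in> sets (distr M borel X)"
  then have [measurable]: "A \<in> sets borel" by simp
  have "emeasure (distr M borel X) A = (\<integral>\<^sup>+ p. indicator A p \<partial>distr M borel X)" by simp
  also have "\<dots> = (\<integral>\<^sup>+ w. indicator A (X w) \<partial>M)" by (rule nn_integral_distr) auto
  also have "\<dots> = (\<integral>\<^sup>+ p. indicator A p \<partial>torus_measure)" by (rule int) auto
  also have "\<dots> = emeasure torus_measure A" by simp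
  finally show "emeasure (distr M borel X) A = emeasure torus_measure A" .
qed simp

lemma equidistributed_geod_path:
  assumes [measurable]: "A \<in> M \<rightarrow>\<^sub>M borel" "B \<in> M \<rightarrow>\<^sub>M borel"
    and int: "\<And>t f. f \<in> borel_measurable borel \<Longrightarrow>
      (\<integral>\<^sup>+ w. f (torus_geod t (A w) (B w)) \<partial>M) = (\<integral>\<^sup>+ p. f p \<partial>torus_measure)"
  shows "equidistributed M (\<lambda>w. geod_path (A w) (B w))"
  unfolding equidistributed_def
proof (intro conjI ballI)
  show "(\<lambda>w. geod_path (A w) (B w)) \<in> M \<rightarrow>\<^sub>M path_borel"
    by (rule measurable_path_borelI[OF geod_path_in_mspace]) (auto simp: geod_path_def)
  fix t :: real assume "t \<in> {0..1}"
  then show "distr M borel (\<lambda>w. geod_path (A w) (B w) t) = torus_measure"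
    by (intro distr_eq_torus_measureI) (auto simp: geod_path_def int)
qed

text \<open>Exchanging the variables replaces reversing the geodesic: \<open>torus_disp\<close> is
  not antisymmetric on the cut locus, where both displacements have a coordinate -1/2.\<close>

lemma nn_integral_torus_geod_flip:
  fixes f :: "'d::finite torus \<Rightarrow> ennreal"
  assumes [measurable]: "f \<in> borel_measurable borel" "k \<in> borel_measurable borel"
  shows "(\<integral>\<^sup>+ p. \<integral>\<^sup>+ q. k (dist p q) * f (torus_geod t q p) \<partial>torus_measure \<partial>torus_measure)
    = (\<integral>\<^sup>+ p. f p \<partial>torus_measure) * (\<integral>\<^sup>+ u. k (norm u) * indicator centred_cube (u :: real ^ 'd) \<partial>lborel)"
proof -
  interpret T: sigma_finite_measure "torus_measure :: 'd torus measure"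
    by (rule sigma_finite_torus_measure)
  interpret TT: pair_sigma_finite "torus_measure :: 'd torus measure" "torus_measure :: 'd torus measure" ..
  have "(\<integral>\<^sup>+ p. \<integral>\<^sup>+ q. k (dist p q) * f (torus_geod t q p) \<partial>torus_measure \<partial>torus_measure)
      = (\<integral>\<^sup>+ q. \<integral>\<^sup>+ p. k (dist p q) * f (torus_geod t q p) \<partial>torus_measure \<partial>torus_measure)"
    by (rule TT.Fubini') measurable
  then show ?thesis
    using nn_integral_torus_geod[OF assms, of t] by (simp add: mult.commute dist_commute)
qed

text \<open>Every \<open>w\<close> moves from \<open>a w\<close> to a \<open>k\<close>-random nearby point \<open>z\<close> and reaches \<open>x w\<close> from a
  \<open>k\<close>-random nearby point \<open>z'\<close>. The common part of the two kernels, rescaled so that it fills the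
  torus with constant density \<open>1 - \<alpha>\<close>, keeps \<open>z = z'\<close>; the remaining mass \<open>\<alpha>\<close> travels from \<open>z\<close> to
  \<open>z'\<close> through a uniform intermediate point.\<close>

lemma torus_connector:
  fixes M :: "'w measure" and a x :: "'w \<Rightarrow> 'd::finite torus" and k :: "real \<Rightarrow> ennreal"
  assumes M: "sigma_finite_measure M"
    and a [measurable]: "a \<in> M \<rightarrow>\<^sub>M borel" and x [measurable]: "x \<in> M \<rightarrow>\<^sub>M borel"
    and da: "distr M borel a = torus_measure" and dx: "distr M borel x = torus_measure"
    and k [measurable]: "k \<in> borel_measurable borel"
    and k_norm: "(\<integral>\<^sup>+ u. k (norm u) * indicator centred_cube (u :: real ^ 'd) \<partial>lborel) = 1"
    and k_lip: "\<And>s t. k s \<le> k t + ennreal (K * \<bar>s - t\<bar>)" and K: "K \<ge> 0"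
    and k_supp: "\<And>s. h < s \<Longrightarrow> k s = 0"
    and \<alpha>: "0 \<le> \<alpha>" "\<alpha> \<le> 1"
    and close: "\<alpha> = 1 \<or> (\<integral>\<^sup>+ w. ennreal (K * dist (a w) (x w)) \<partial>M) \<le> ennreal \<alpha>"
  obtains D :: "'w \<times> 'd aux \<Rightarrow> ennreal" and Y :: "'w \<times> 'd aux \<Rightarrow> real \<Rightarrow> 'd torus" and G
  where "D \<in> borel_measurable (M \<Otimes>\<^sub>M aux_measure)"
    "\<forall>w\<in>space M. (\<integral>\<^sup>+ y. D (w, y) \<partial>aux_measure) = 1"
    "equidistributed (density (M \<Otimes>\<^sub>M aux_measure) D) Y"
    "\<forall>w. Y w 0 = a (fst w) \<and> Y w 1 = x (fst w)"
    "G \<in> borel_measurable (M \<Otimes>\<^sub>M aux_measure)"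
    "\<forall>w. curve_action (Y w) \<le> G w \<and> G w < \<infinity>"
    "(\<integral>\<^sup>+ w. G w \<partial>density (M \<Otimes>\<^sub>M aux_measure) D) \<le> ennreal (8 * h\<^sup>2 + 8 * \<alpha> * (real CARD('d))\<^sup>2)"
proof -
  let ?T = "torus_measure :: 'd torus measure"
  let ?A = "aux_measure :: 'd aux measure"
  interpret M: sigma_finite_measure M by (rule M)
  interpret T: sigma_finite_measure ?T by (rule sigma_finite_torus_measure)
  interpret A: sigma_finite_measure ?A by (rule sigma_finite_aux_measure)
  interpret MT: pair_sigma_finite M ?T ..
  interpret TT: pair_sigma_finite ?T ?T ..
  have one: "(\<integral>\<^sup>+ z. c \<partial>?T) = c" for c :: ennreal by simp

  have int_z: "(\<integral>\<^sup>+ z. k (dist p z) \<partial>?T) = 1" for p :: "'d torus"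
    by (simp add: nn_integral_torus_dist k_norm)
  \<comment> \<open>Since y is uniform, the kernels centred at y average to the constant density
    1.\<close>
  have int_w: "(\<integral>\<^sup>+ w. k (dist (y w) z) \<partial>M) = 1"
    if [measurable]: "y \<in> M \<rightarrow>\<^sub>M borel" and y: "distr M borel y = ?T" for y and z :: "'d torus"
  proof -
    have "(\<integral>\<^sup>+ w. k (dist (y w) z) \<partial>M) = (\<integral>\<^sup>+ p. k (dist p z) \<partial>distr M borel y)"
      by (rule nn_integral_distr[symmetric]) auto
    then show ?thesis using int_z[of z] by (simp add: y dist_commute)
  qed

  \<comment> \<open>The mass that both kernels place at z; \<open>S\<close> is the density of z that
    would result from keeping all of it.\<close>
  define r where "r w z = min (k (dist (a w) z)) (k (dist (x w) z))" for w z
  have [measurable]: "(\<lambda>(w, z). r w z) \<in> borel_measurable (M \<Otimes>\<^sub>M borel)"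
    "(\<lambda>(z, w). r w z) \<in> borel_measurable (borel \<Otimes>\<^sub>M M)"
    unfolding r_def by measurable
  define S where "S z = (\<integral>\<^sup>+ w. r w z \<partial>M)" for z
  have [measurable]: "S \<in> borel_measurable borel" unfolding S_def by measurable
  have S_le: "S z \<le> 1" for z
    unfolding S_def r_def int_w[OF a da, of z, symmetric] by (intro nn_integral_mono) simp
  \<comment> \<open>Replacing a kernel by the overlap loses at most \<open>K\<close> times the
    distance of the centres, on average at most \<alpha>. For \<alpha> = 1 the bound is 0.\<close>
  have S_ge: "ennreal (1 - \<alpha>) \<le> S z" for z
    using close
  proof
    assume c: "(\<integral>\<^sup>+ w. ennreal (K * dist (a w) (x w)) \<partial>M) \<le> ennreal \<alpha>"
    have "k (dist (a w) z) \<le> r w z + ennreal (K * dist (a w) (x w))" for w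
    proof (cases "k (dist (a w) z) \<le> k (dist (x w) z)")
      case True
      then show ?thesis by (simp add: r_def min_def)
    next
      case False
      have le: "K * \<bar>dist (a w) z - dist (x w) z\<bar> \<le> K * dist (a w) (x w)"
        using K abs_dist_diff_le[of "a w" z "x w"] by (intro mult_left_mono) (auto simp: dist_commute)
      have "k (dist (a w) z) \<le> k (dist (x w) z) + ennreal (K * dist (a w) (x w))"
        by (rule order_trans[OF k_lip add_left_mono[OF ennreal_leI[OF le]]])
      then show ?thesis using False by (simp add: r_def min_def)
    qed
    then have "(\<integral>\<^sup>+ w. k (dist (a w) z) \<partial>M) \<le> (\<integral>\<^sup>+ w. r w z + ennreal (K * dist (a w) (x w)) \<partial>M)"
      by (intro nn_integral_mono)
    also have "\<dots> = S z + (\<integral>\<^sup>+ w. ennreal (K * dist (a w) (x w)) \<partial>M)"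
      unfolding S_def by (rule nn_integral_add) auto
    also have "\<dots> \<le> S z + ennreal \<alpha>" using c by (intro add_left_mono)
    finally have "1 \<le> S z + ennreal \<alpha>" by (simp add: int_w[OF a da])
    then have "1 - ennreal \<alpha> \<le> S z"
      by (subst ennreal_minus_le_iff) (auto simp: add.commute)
    then show ?thesis using \<alpha> by (simp add: ennreal_minus ennreal_1[symmetric] del: ennreal_1)
  qed simp
  \<comment> \<open>\<open>S z\<close> can vanish only if \<alpha> = 1, and then \<open>c z\<close>
    is 0 by the conventions of \<open>ennreal\<close>. As \<open>c\<close> is at most 1, the
    rescaled overlap still fits under both kernels.\<close>
  define c where "c z = ennreal (1 - \<alpha>) / S z" for z
  have [measurable]: "c \<in> borel_measurable borel" unfolding c_def by measurable
  have S_fin: "S z \<noteq> top" for z using S_le[of z] by (metis ennreal_one_neq_top top.extremum_uniqueI)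
  have c_le: "c z \<le> 1" for z
  proof (cases "S z = 0")
    case True
    then show ?thesis using S_ge[of z] by (simp add: c_def)
  next
    case False
    have "c z \<le> S z / S z" unfolding c_def by (intro divide_right_mono_ennreal S_ge)
    then show ?thesis using False S_fin[of z] by (simp add: top.not_eq_extremum)
  qed
  have S_c: "S z * c z = ennreal (1 - \<alpha>)" for z
  proof (cases "S z = 0")
    case True
    then show ?thesis using S_ge[of z] by simp
  next
    case False
    then show ?thesis
      using S_fin[of z] unfolding c_def by (subst ennreal_times_divide, subst mult.commute) (rule mult_divide_eq_ennreal)
  qed

  define m where "m w z = r w z * c z" for w z
  define p where "p w z = k (dist (a w) z) - m w z" for w z
  define q where "q w z = k (dist (x w) z) - m w z" for w z
  define l where "l w = (\<integral>\<^sup>+ z. p w z \<partial>?T)" for w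
  have [measurable]: "(\<lambda>(w, z). m w z) \<in> borel_measurable (M \<Otimes>\<^sub>M borel)"
    "(\<lambda>(z, w). m w z) \<in> borel_measurable (borel \<Otimes>\<^sub>M M)"
    unfolding m_def by measurable
  have [measurable]: "(\<lambda>(w, z). p w z) \<in> borel_measurable (M \<Otimes>\<^sub>M borel)"
    "(\<lambda>(z, w). p w z) \<in> borel_measurable (borel \<Otimes>\<^sub>M M)"
    "(\<lambda>(w, z). q w z) \<in> borel_measurable (M \<Otimes>\<^sub>M borel)"
    "(\<lambda>(z, w). q w z) \<in> borel_measurable (borel \<Otimes>\<^sub>M M)"
    unfolding p_def q_def by measurable
  have [measurable]: "l \<in> borel_measurable M" unfolding l_def by measurable
  have mw [measurable]: "m w \<in> borel_measurable borel" "p w \<in> borel_measurable borel"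
    "q w \<in> borel_measurable borel" if "w \<in> space M" for w
    using that by measurable
  have m_le: "m w z \<le> r w z" for w z
    using mult_left_mono[OF c_le[of z], of "r w z"] by (simp add: m_def)
  have mp: "m w z + p w z = k (dist (a w) z)" and mq: "m w z + q w z = k (dist (x w) z)" for w z
    using m_le[of w z] unfolding p_def q_def r_def
    by (auto intro!: add_diff_inverse_ennreal)
  have sum_p: "(\<integral>\<^sup>+ z. m w z \<partial>?T) + (\<integral>\<^sup>+ z. p w z \<partial>?T) = 1"
    and sum_q: "(\<integral>\<^sup>+ z. m w z \<partial>?T) + (\<integral>\<^sup>+ z. q w z \<partial>?T) = 1" if w: "w \<in> space M" for w
    using mw[OF w] by (simp_all add: nn_integral_add[symmetric] mp mq int_z)
  have int_m_fin: "(\<integral>\<^sup>+ z. m w z \<partial>?T) \<noteq> top" if "w \<in> space M" for w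
  proof
    assume "(\<integral>\<^sup>+ z. m w z \<partial>?T) = top"
    then show False using sum_p[OF that] by simp
  qed
  \<comment> \<open>Both kernels have mass 1 and share the part \<open>m\<close>, so their
    remainders have equal mass.\<close>
  have l_q: "(\<integral>\<^sup>+ z. q w z \<partial>?T) = l w" if "w \<in> space M" for w
  proof -
    have "(\<integral>\<^sup>+ z. m w z \<partial>?T) + (\<integral>\<^sup>+ z. q w z \<partial>?T) = (\<integral>\<^sup>+ z. m w z \<partial>?T) + l w"
      using sum_p[OF that] sum_q[OF that] by (simp add: l_def)
    then show ?thesis using int_m_fin[OF that] by (subst (asm) ennreal_add_left_cancel) simp
  qed
  have l_fin: "l w < \<infinity>" if "w \<in> space M" for w
  proof -
    have "l w \<le> (\<integral>\<^sup>+ z. m w z \<partial>?T) + (\<integral>\<^sup>+ z. p w z \<partial>?T)" by (simp add: l_def)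
    then show ?thesis unfolding sum_p[OF that] by (rule le_less_trans) simp
  qed
  have int_mM: "(\<integral>\<^sup>+ w. m w z \<partial>M) = ennreal (1 - \<alpha>)" for z
    unfolding m_def by (subst nn_integral_multc) (auto simp: S_def[symmetric] S_c)
  have cancel: "X = ennreal \<alpha>" if "ennreal (1 - \<alpha>) + X = 1" for X
  proof -
    have "ennreal (1 - \<alpha>) + ennreal \<alpha> = 1" using \<alpha> by (simp add: ennreal_plus[symmetric] del: ennreal_plus)
    with that have "ennreal (1 - \<alpha>) + X = ennreal (1 - \<alpha>) + ennreal \<alpha>" by simp
    then show ?thesis by (subst (asm) ennreal_add_left_cancel) simp
  qed
  \<comment> \<open>The purpose of the rescaling: averaged over w, the leftover densities are
    constant.\<close>
  have int_pM: "(\<integral>\<^sup>+ w. p w z \<partial>M) = ennreal \<alpha>" and int_qM: "(\<integral>\<^sup>+ w. q w z \<partial>M) = ennreal \<alpha>" for z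
    by (rule cancel, simp add: int_mM[of z, symmetric] nn_integral_add[symmetric] mp mq int_w[OF a da] int_w[OF x dx])+

  define D where "D v = aux_density (m (fst v)) (p (fst v)) (q (fst v)) (l (fst v)) (snd v)" for v :: "'w \<times> 'd aux"
  have D_meas [measurable]: "D \<in> borel_measurable (M \<Otimes>\<^sub>M ?A)"
    unfolding D_def aux_density_def by measurable
  let ?N = "density (M \<Otimes>\<^sub>M ?A) D"
  have int_N: "(\<integral>\<^sup>+ v. F v \<partial>?N) = (\<integral>\<^sup>+ w. \<integral>\<^sup>+ y. D (w, y) * F (w, y) \<partial>?A \<partial>M)"
    if [measurable]: "F \<in> borel_measurable (M \<Otimes>\<^sub>M ?A)" for F
    by (subst nn_integral_density) (auto intro!: A.nn_integral_fst[symmetric])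

  define b where "b v = snd (snd (snd (snd v)))" for v :: "'w \<times> 'd aux"
  define z where "z v = fst (snd v)" for v :: "'w \<times> 'd aux"
  \<comment> \<open>When the flag is set the points coincide, so the two middle geodesics are
    constant.\<close>
  define z' where "z' v = (if b v then z v else fst (snd (snd v)))" for v :: "'w \<times> 'd aux"
  define u where "u v = (if b v then z v else fst (snd (snd (snd v))))" for v :: "'w \<times> 'd aux"
  have [measurable]: "Measurable.pred (M \<Otimes>\<^sub>M ?A) b" unfolding b_def by measurable
  have [measurable]: "z \<in> M \<Otimes>\<^sub>M ?A \<rightarrow>\<^sub>M borel" unfolding z_def by measurable
  have [measurable]: "z' \<in> M \<Otimes>\<^sub>M ?A \<rightarrow>\<^sub>M borel" "u \<in> M \<Otimes>\<^sub>M ?A \<rightarrow>\<^sub>M borel"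
    unfolding z'_def u_def by measurable

  \<comment> \<open>Since \<open>m\<close> and \<open>p\<close> add up to the kernel around
    \<open>a w\<close>, that kernel is the law of z given w.\<close>
  have int_left: "(\<integral>\<^sup>+ v. \<phi> (fst v) (z v) \<partial>?N) = (\<integral>\<^sup>+ w. \<integral>\<^sup>+ s. k (dist (a w) s) * \<phi> w s \<partial>?T \<partial>M)"
    if [measurable]: "(\<lambda>(w, s). \<phi> w s) \<in> borel_measurable (M \<Otimes>\<^sub>M borel)" for \<phi>
  proof -
    have "(\<integral>\<^sup>+ v. \<phi> (fst v) (z v) \<partial>?N) = (\<integral>\<^sup>+ w. \<integral>\<^sup>+ y. D (w, y) * \<phi> w (fst y) \<partial>?A \<partial>M)"
      by (subst int_N) (auto simp: z_def)
    also have "\<dots> = (\<integral>\<^sup>+ w. \<integral>\<^sup>+ s. k (dist (a w) s) * \<phi> w s \<partial>?T \<partial>M)"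
    proof (rule nn_integral_cong)
      fix w assume w [measurable]: "w \<in> space M"
      show "(\<integral>\<^sup>+ y. D (w, y) * \<phi> w (fst y) \<partial>?A) = (\<integral>\<^sup>+ s. k (dist (a w) s) * \<phi> w s \<partial>?T)"
        using nn_integral_aux_density_fst[OF mw[OF w], of "\<phi> w" "\<lambda>s _. \<phi> w s" "l w"] l_q[OF w] l_fin[OF w]
        by (simp add: D_def one mp[symmetric] distrib_right l_def[symmetric])
    qed
    finally show ?thesis .
  qed
  have int_right: "(\<integral>\<^sup>+ v. \<phi> (fst v) (z' v) \<partial>?N) = (\<integral>\<^sup>+ w. \<integral>\<^sup>+ s. k (dist (x w) s) * \<phi> w s \<partial>?T \<partial>M)"
    if [measurable]: "(\<lambda>(w, s). \<phi> w s) \<in> borel_measurable (M \<Otimes>\<^sub>M borel)" for \<phi>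
  proof -
    have "(\<integral>\<^sup>+ v. \<phi> (fst v) (z' v) \<partial>?N) = (\<integral>\<^sup>+ w. \<integral>\<^sup>+ y. D (w, y) *
        (if snd (snd (snd y)) then \<phi> w (fst y) else \<phi> w (fst (snd y))) \<partial>?A \<partial>M)"
      by (subst int_N) (auto simp: z'_def z_def b_def if_distrib[of "\<phi> _"] cong: if_cong)
    also have "\<dots> = (\<integral>\<^sup>+ w. \<integral>\<^sup>+ s. k (dist (x w) s) * \<phi> w s \<partial>?T \<partial>M)"
    proof (rule nn_integral_cong)
      fix w assume w [measurable]: "w \<in> space M"
      show "(\<integral>\<^sup>+ y. D (w, y) * (if snd (snd (snd y)) then \<phi> w (fst y) else \<phi> w (fst (snd y))) \<partial>?A)
          = (\<integral>\<^sup>+ s. k (dist (x w) s) * \<phi> w s \<partial>?T)"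
        using nn_integral_aux_density_snd[OF mw[OF w], of "\<phi> w" "\<lambda>s _. \<phi> w s" "l w"] l_q[OF w] l_fin[OF w]
        by (simp add: D_def one mq[symmetric] distrib_right l_def[symmetric])
    qed
    finally show ?thesis .
  qed
  \<comment> \<open>Integrating over w first, where the averaged densities are constant, leaves a
    mixture with weights 1 - \<alpha> and \<alpha>.\<close>
  have mix: "(\<integral>\<^sup>+ w. \<integral>\<^sup>+ s. m w s * f s + g w s * e s \<partial>?T \<partial>M)
      = ennreal (1 - \<alpha>) * (\<integral>\<^sup>+ s. f s \<partial>?T) + ennreal \<alpha> * (\<integral>\<^sup>+ s. e s \<partial>?T)"
    if [measurable]: "f \<in> borel_measurable borel" "e \<in> borel_measurable borel"
        "(\<lambda>(w, s). g w s) \<in> borel_measurable (M \<Otimes>\<^sub>M borel)"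
        "(\<lambda>(s, w). g w s) \<in> borel_measurable (borel \<Otimes>\<^sub>M M)"
      and g: "\<And>s. (\<integral>\<^sup>+ w. g w s \<partial>M) = ennreal \<alpha>" for f e g
  proof -
    have "(\<integral>\<^sup>+ w. \<integral>\<^sup>+ s. m w s * f s + g w s * e s \<partial>?T \<partial>M)
        = (\<integral>\<^sup>+ s. \<integral>\<^sup>+ w. m w s * f s + g w s * e s \<partial>M \<partial>?T)"
      by (rule MT.Fubini'[symmetric]) measurable
    also have "\<dots> = (\<integral>\<^sup>+ s. ennreal (1 - \<alpha>) * f s + ennreal \<alpha> * e s \<partial>?T)"
      by (intro nn_integral_cong) (simp add: nn_integral_add nn_integral_multc int_mM g)
    finally show ?thesis by (simp add: nn_integral_add nn_integral_cmult)
  qed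
  \<comment> \<open>On the unmatched part z and u are independent and uniform, and so are z' and u;
    nothing is claimed about z and z' jointly.\<close>
  have int_mid_left: "(\<integral>\<^sup>+ v. (if b v then f (z v) else B (z v) (u v)) \<partial>?N)
      = ennreal (1 - \<alpha>) * (\<integral>\<^sup>+ s. f s \<partial>?T) + ennreal \<alpha> * (\<integral>\<^sup>+ s. \<integral>\<^sup>+ t. B s t \<partial>?T \<partial>?T)"
      (is "?left = ?mixture")
    and int_mid_right: "(\<integral>\<^sup>+ v. (if b v then f (z v) else B (z' v) (u v)) \<partial>?N)
      = ennreal (1 - \<alpha>) * (\<integral>\<^sup>+ s. f s \<partial>?T) + ennreal \<alpha> * (\<integral>\<^sup>+ s. \<integral>\<^sup>+ t. B s t \<partial>?T \<partial>?T)"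
      (is "?right = _")
    if [measurable]: "f \<in> borel_measurable borel" "(\<lambda>(s, t). B s t) \<in> borel_measurable (borel \<Otimes>\<^sub>M borel)"
    for f and B :: "'d torus \<Rightarrow> 'd torus \<Rightarrow> ennreal"
  proof -
    have "?left = (\<integral>\<^sup>+ w. \<integral>\<^sup>+ y. D (w, y) *
        (if snd (snd (snd y)) then f (fst y) else B (fst y) (fst (snd (snd y)))) \<partial>?A \<partial>M)"
      by (subst int_N) (auto simp: z_def b_def u_def intro!: nn_integral_cong)
    also have "\<dots> = (\<integral>\<^sup>+ w. \<integral>\<^sup>+ s. m w s * f s + p w s * (\<integral>\<^sup>+ t. B s t \<partial>?T) \<partial>?T \<partial>M)"
    proof (rule nn_integral_cong)
      fix w assume w: "w \<in> space M"
      show "(\<integral>\<^sup>+ y. D (w, y) * (if snd (snd (snd y)) then f (fst y) else B (fst y) (fst (snd (snd y)))) \<partial>?A)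
          = (\<integral>\<^sup>+ s. m w s * f s + p w s * (\<integral>\<^sup>+ t. B s t \<partial>?T) \<partial>?T)"
        using nn_integral_aux_density_fst[OF mw[OF w] that, of "l w"] l_q[OF w] l_fin[OF w]
        by (simp add: D_def l_def[symmetric])
    qed
    also have "\<dots> = ?mixture"
      by (rule mix) (auto simp: int_pM)
    finally show "?left = ?mixture" .
    have "?right = (\<integral>\<^sup>+ w. \<integral>\<^sup>+ y. D (w, y) *
        (if snd (snd (snd y)) then f (fst y) else B (fst (snd y)) (fst (snd (snd y)))) \<partial>?A \<partial>M)"
      by (subst int_N) (auto simp: z_def z'_def b_def u_def intro!: nn_integral_cong)
    also have "\<dots> = (\<integral>\<^sup>+ w. \<integral>\<^sup>+ s. m w s * f s + q w s * (\<integral>\<^sup>+ t. B s t \<partial>?T) \<partial>?T \<partial>M)"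
    proof (rule nn_integral_cong)
      fix w assume w: "w \<in> space M"
      show "(\<integral>\<^sup>+ y. D (w, y) * (if snd (snd (snd y)) then f (fst y) else B (fst (snd y)) (fst (snd (snd y)))) \<partial>?A)
          = (\<integral>\<^sup>+ s. m w s * f s + q w s * (\<integral>\<^sup>+ t. B s t \<partial>?T) \<partial>?T)"
        using nn_integral_aux_density_snd[OF mw[OF w] that, of "l w"] l_q[OF w] l_fin[OF w]
        by (simp add: D_def l_def[symmetric])
    qed
    also have "\<dots> = ?mixture"
      by (rule mix) (auto simp: int_qM)
    finally show "?right = ?mixture" .
  qed

  have cube: "(\<integral>\<^sup>+ s. indicator centred_cube (s :: real ^ 'd) \<partial>lborel) = 1"
    using nn_integral_torus_dist[of "\<lambda>_. 1" "undefined :: 'd torus"] by simp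
  have conv: "ennreal (1 - \<alpha>) * I + ennreal \<alpha> * I = I" for I
    using \<alpha> by (simp add: distrib_right[symmetric] ennreal_plus[symmetric] del: ennreal_plus)

  have eq1: "equidistributed ?N (\<lambda>v. geod_path (a (fst v)) (z v))"
  proof (rule equidistributed_geod_path)
    fix t and f :: "'d torus \<Rightarrow> ennreal" assume [measurable]: "f \<in> borel_measurable borel"
    have "(\<integral>\<^sup>+ v. f (torus_geod t (a (fst v)) (z v)) \<partial>?N)
        = (\<integral>\<^sup>+ w. \<integral>\<^sup>+ s. k (dist (a w) s) * f (torus_geod t (a w) s) \<partial>?T \<partial>M)"
      by (rule int_left) measurable
    also have "\<dots> = (\<integral>\<^sup>+ c0. \<integral>\<^sup>+ s. k (dist c0 s) * f (torus_geod t c0 s) \<partial>?T \<partial>distr M borel a)"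
      by (rule nn_integral_distr[symmetric]) measurable
    also have "\<dots> = (\<integral>\<^sup>+ s. f s \<partial>?T)"
      using nn_integral_torus_geod[of f k t] by (simp add: da k_norm mult.commute[of "f _"])
    finally show "(\<integral>\<^sup>+ v. f (torus_geod t (a (fst v)) (z v)) \<partial>?N) = (\<integral>\<^sup>+ s. f s \<partial>?T)" .
  qed measurable
  \<comment> \<open>The kernel is centred at the final point of this geodesic, hence the flipped
    formula.\<close>
  have eq4: "equidistributed ?N (\<lambda>v. geod_path (z' v) (x (fst v)))"
  proof (rule equidistributed_geod_path)
    fix t and f :: "'d torus \<Rightarrow> ennreal" assume [measurable]: "f \<in> borel_measurable borel"
    have "(\<integral>\<^sup>+ v. f (torus_geod t (z' v) (x (fst v))) \<partial>?N)
        = (\<integral>\<^sup>+ w. \<integral>\<^sup>+ s. k (dist (x w) s) * f (torus_geod t s (x w)) \<partial>?T \<partial>M)"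
      by (rule int_right) measurable
    also have "\<dots> = (\<integral>\<^sup>+ c0. \<integral>\<^sup>+ s. k (dist c0 s) * f (torus_geod t s c0) \<partial>?T \<partial>distr M borel x)"
      by (rule nn_integral_distr[symmetric]) measurable
    also have "\<dots> = (\<integral>\<^sup>+ s. f s \<partial>?T)"
      by (simp add: dx nn_integral_torus_geod_flip k_norm)
    finally show "(\<integral>\<^sup>+ v. f (torus_geod t (z' v) (x (fst v))) \<partial>?N) = (\<integral>\<^sup>+ s. f s \<partial>?T)" .
  qed measurable
  \<comment> \<open>The matched part rests at z; the other part joins independent uniform points,
    which is the case of the constant kernel 1.\<close>
  have eq2: "equidistributed ?N (\<lambda>v. geod_path (z v) (u v))"
  proof (rule equidistributed_geod_path)
    fix t and f :: "'d torus \<Rightarrow> ennreal" assume [measurable]: "f \<in> borel_measurable borel"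
    have "(\<integral>\<^sup>+ v. f (torus_geod t (z v) (u v)) \<partial>?N)
        = (\<integral>\<^sup>+ v. (if b v then f (z v) else f (torus_geod t (z v) (u v))) \<partial>?N)"
      by (intro nn_integral_cong) (simp add: u_def)
    also have "\<dots> = ennreal (1 - \<alpha>) * (\<integral>\<^sup>+ s. f s \<partial>?T)
        + ennreal \<alpha> * (\<integral>\<^sup>+ s. \<integral>\<^sup>+ c0. f (torus_geod t s c0) \<partial>?T \<partial>?T)"
      by (rule int_mid_left) measurable
    also have "\<dots> = (\<integral>\<^sup>+ s. f s \<partial>?T)"
      using nn_integral_torus_geod[of f "\<lambda>_. 1" t] by (simp add: cube conv)
    finally show "(\<integral>\<^sup>+ v. f (torus_geod t (z v) (u v)) \<partial>?N) = (\<integral>\<^sup>+ s. f s \<partial>?T)" .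
  qed measurable
  have eq3: "equidistributed ?N (\<lambda>v. geod_path (u v) (z' v))"
  proof (rule equidistributed_geod_path)
    fix t and f :: "'d torus \<Rightarrow> ennreal" assume [measurable]: "f \<in> borel_measurable borel"
    have "(\<integral>\<^sup>+ v. f (torus_geod t (u v) (z' v)) \<partial>?N)
        = (\<integral>\<^sup>+ v. (if b v then f (z v) else f (torus_geod t (u v) (z' v))) \<partial>?N)"
      by (intro nn_integral_cong) (simp add: u_def z'_def)
    also have "\<dots> = ennreal (1 - \<alpha>) * (\<integral>\<^sup>+ s. f s \<partial>?T)
        + ennreal \<alpha> * (\<integral>\<^sup>+ s. \<integral>\<^sup>+ c0. f (torus_geod t c0 s) \<partial>?T \<partial>?T)"
      by (rule int_mid_right) measurable
    also have "\<dots> = (\<integral>\<^sup>+ s. f s \<partial>?T)"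
      using nn_integral_torus_geod_flip[of f "\<lambda>_. 1" t] by (simp add: cube conv)
    finally show "(\<integral>\<^sup>+ v. f (torus_geod t (u v) (z' v)) \<partial>?N) = (\<integral>\<^sup>+ s. f s \<partial>?T)" .
  qed measurable

  \<comment> \<open>Four pieces of duration 1/4 each, so every action is multiplied by 4.\<close>
  define Y where "Y v = path_join (1 / 2)
      (path_join (1 / 2) (geod_path (a (fst v)) (z v)) (geod_path (z v) (u v)))
      (path_join (1 / 2) (geod_path (u v) (z' v)) (geod_path (z' v) (x (fst v))))" for v
  \<comment> \<open>A measurable finite majorant of the action, as
    \<open>nn_integral_add_measurable_le\<close> requires. The last term bounds the two middle
    pieces by the squared diameter bound.\<close>
  define G where "G v = 4 * (ennreal ((dist (a (fst v)) (z v))\<^sup>2) + ennreal ((dist (x (fst v)) (z' v))\<^sup>2)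
      + (if b v then 0 else ennreal (2 * (real CARD('d))\<^sup>2)))" for v
  show ?thesis
  proof (rule that)
    show "D \<in> borel_measurable (M \<Otimes>\<^sub>M ?A)" by (rule D_meas)
    show "\<forall>w\<in>space M. (\<integral>\<^sup>+ y. D (w, y) \<partial>?A) = 1"
    proof
      fix w assume w: "w \<in> space M"
      show "(\<integral>\<^sup>+ y. D (w, y) \<partial>?A) = 1"
        using nn_integral_aux_density_fst[OF mw[OF w], of "\<lambda>_. 1" "\<lambda>_ _. 1" "l w"] l_q[OF w] l_fin[OF w]
        by (simp add: D_def l_def[symmetric] mp int_z)
    qed
    show "equidistributed ?N Y"
      unfolding Y_def by (intro equidistributed_path_join eq1 eq2 eq3 eq4) auto
    show "\<forall>v. Y v 0 = a (fst v) \<and> Y v 1 = x (fst v)" by (simp add: Y_def)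
    show "G \<in> borel_measurable (M \<Otimes>\<^sub>M ?A)" unfolding G_def by measurable
    show "\<forall>v. curve_action (Y v) \<le> G v \<and> G v < \<infinity>"
    proof (intro allI conjI)
      fix v
      have half: "curve_action (path_join (1 / 2) P Q) \<le> 2 * (B + C)"
        if "curve_action P \<le> B" "curve_action Q \<le> C" "P 1 = Q 0" for P Q :: "real \<Rightarrow> 'd torus" and B C
      proof -
        have "inverse (ennreal (1 / 2)) = 2" by (subst inverse_ennreal) auto
        then have d2: "y / ennreal (1 / 2) = 2 * y" for y
          unfolding divide_ennreal_def by (simp only: mult.commute)
        have "curve_action (path_join (1 / 2) P Q) \<le> 2 * curve_action P + 2 * curve_action Q"
          using curve_action_path_join[of "1 / 2" P Q] that(3) by (simp add: d2 del: ennreal_half)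
        also have "\<dots> \<le> 2 * (B + C)"
          using that(1,2) unfolding distrib_left by (intro add_mono mult_left_mono) auto
        finally show ?thesis .
      qed
      let ?C = "real CARD('d)"
      have mid: "(dist (z v) (u v))\<^sup>2 \<le> (if b v then 0 else ?C\<^sup>2)" "(dist (u v) (z' v))\<^sup>2 \<le> (if b v then 0 else ?C\<^sup>2)"
        using dist_torus_le[of "z v" "u v"] dist_torus_le[of "u v" "z' v"]
        by (auto simp: u_def z'_def intro!: power_mono)
      have "curve_action (Y v) \<le> 2 * (2 * (ennreal ((dist (a (fst v)) (z v))\<^sup>2) + ennreal (if b v then 0 else ?C\<^sup>2))
          + 2 * (ennreal (if b v then 0 else ?C\<^sup>2) + ennreal ((dist (z' v) (x (fst v)))\<^sup>2)))"
        unfolding Y_def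
        by (intro half order_trans[OF curve_action_geod_path] ennreal_leI mid order_refl) auto
      also have "\<dots> = G v"
        by (auto simp: G_def dist_commute[of "z' v"] ennreal_plus[symmetric] ennreal_mult'[symmetric]
              ennreal_numeral[symmetric] simp del: ennreal_plus ennreal_numeral)
      finally show "curve_action (Y v) \<le> G v" .
      show "G v < \<infinity>" by (simp add: G_def ennreal_mult_less_top)
    qed
    have mass: "emeasure M (space M) = 1"
    proof -
      have "emeasure (distr M borel a) UNIV = emeasure M (a -` UNIV \<inter> space M)"
        by (rule emeasure_distr) auto
      then show ?thesis by (simp add: da)
    qed
    \<comment> \<open>The kernel vanishes beyond distance h, so the drawn point lies within h of its
      centre.\<close>
    have loc: "(\<integral>\<^sup>+ w. \<integral>\<^sup>+ s. k (dist (y w) s) * ennreal ((dist (y w) s)\<^sup>2) \<partial>?T \<partial>M) \<le> ennreal (h\<^sup>2)"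
      for y :: "'w \<Rightarrow> 'd torus"
    proof -
      have "k (dist c0 s) * ennreal ((dist c0 s)\<^sup>2) \<le> k (dist c0 s) * ennreal (h\<^sup>2)" for c0 s :: "'d torus"
      proof (cases "h < dist c0 s")
        case False
        then show ?thesis by (intro mult_left_mono ennreal_leI power_mono) auto
      qed (simp add: k_supp)
      then have "(\<integral>\<^sup>+ w. \<integral>\<^sup>+ s. k (dist (y w) s) * ennreal ((dist (y w) s)\<^sup>2) \<partial>?T \<partial>M)
          \<le> (\<integral>\<^sup>+ w. \<integral>\<^sup>+ s. k (dist (y w) s) * ennreal (h\<^sup>2) \<partial>?T \<partial>M)"
        by (intro nn_integral_mono)
      also have "\<dots> = ennreal (h\<^sup>2)" by (simp add: nn_integral_multc int_z mass)
      finally show ?thesis .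
    qed
    have "(\<integral>\<^sup>+ v. G v \<partial>?N) = 4 * ((\<integral>\<^sup>+ v. ennreal ((dist (a (fst v)) (z v))\<^sup>2) \<partial>?N)
        + (\<integral>\<^sup>+ v. ennreal ((dist (x (fst v)) (z' v))\<^sup>2) \<partial>?N)
        + (\<integral>\<^sup>+ v. (if b v then 0 else ennreal (2 * (real CARD('d))\<^sup>2)) \<partial>?N))"
      unfolding G_def by (simp add: nn_integral_cmult nn_integral_add)
    also have "\<dots> \<le> 4 * (ennreal (h\<^sup>2) + ennreal (h\<^sup>2) + ennreal (\<alpha> * (2 * (real CARD('d))\<^sup>2)))"
    proof (intro mult_left_mono add_mono)
      show "(\<integral>\<^sup>+ v. ennreal ((dist (a (fst v)) (z v))\<^sup>2) \<partial>?N) \<le> ennreal (h\<^sup>2)"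
        using loc[of a] by (subst int_left) auto
      show "(\<integral>\<^sup>+ v. ennreal ((dist (x (fst v)) (z' v))\<^sup>2) \<partial>?N) \<le> ennreal (h\<^sup>2)"
        using loc[of x] by (subst int_right) auto
      show "(\<integral>\<^sup>+ v. (if b v then 0 else ennreal (2 * (real CARD('d))\<^sup>2)) \<partial>?N) \<le> ennreal (\<alpha> * (2 * (real CARD('d))\<^sup>2))"
        using int_mid_left[of "\<lambda>_. 0" "\<lambda>_ _. ennreal (2 * (real CARD('d))\<^sup>2)"] \<alpha>(1)
        by (simp add: ennreal_mult)
    qed auto
    also have "\<dots> = ennreal (8 * h\<^sup>2 + 8 * \<alpha> * (real CARD('d))\<^sup>2)"
      using \<alpha>(1) by (simp add: ennreal_plus[symmetric] ennreal_mult'[symmetric] ennreal_numeral[symmetric]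
            algebra_simps del: ennreal_plus ennreal_numeral)
    finally show "(\<integral>\<^sup>+ v. G v \<partial>?N) \<le> ennreal (8 * h\<^sup>2 + 8 * \<alpha> * (real CARD('d))\<^sup>2)" .
  qed
qed

section \<open>Kernels and gluing\<close>

text \<open>The normalised tent of height and radius h. Its mass is of order h^(d+1), the height
  times the volume of a ball of radius h, and its Lipschitz constant is the reciprocal of the
  mass.\<close>

lemma torus_kernel:
  assumes h: "0 < h" "h < 1 / 2"
  obtains k :: "real \<Rightarrow> ennreal" where "k \<in> borel_measurable borel"
    "(\<integral>\<^sup>+ u. k (norm u) * indicator centred_cube (u :: real ^ 'd::finite) \<partial>lborel) = 1"
    "\<forall>s t. k s \<le> k t + ennreal (2 * (2 * real CARD('d)) ^ CARD('d) / h ^ (CARD('d) + 1) * \<bar>s - t\<bar>)"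
    "\<forall>s>h. k s = 0"
proof -
  let ?d = "CARD('d)"
  have d: "real ?d \<ge> 1" by (simp add: Suc_leI)
  define f where "f u = ennreal (max 0 (h - norm u)) * indicator centred_cube u" for u :: "real ^ 'd"
  have [measurable]: "f \<in> borel_measurable borel" unfolding f_def by measurable
  \<comment> \<open>The side is chosen so that on the box \<open>B\<close> the sum of the
    coordinates, hence the norm, is at most h/2 and the tent is at least h/2.\<close>
  define s where "s = h / (2 * real ?d)"
  have s: "0 < s" "s \<le> h / 2" "real ?d * s = h / 2"
    using h d by (auto simp: s_def field_simps)
  define B where "B = cbox 0 (\<chi> i :: 'd. s)"
  have B: "f u \<ge> ennreal (h / 2) * indicator B u" for u
  proof (cases "u \<in> B")
    case True
    then have u: "0 \<le> u $ i" "u $ i \<le> s" for i by (auto simp: B_def mem_box_cart)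
    have "norm u \<le> (\<Sum>i\<in>UNIV. \<bar>u $ i\<bar>)" by (rule norm_le_l1_cart)
    also have "\<dots> \<le> (\<Sum>i\<in>(UNIV :: 'd set). s)" by (intro sum_mono) (use u in auto)
    finally have "norm u \<le> h / 2" using s(3) by simp
    moreover have "u \<in> centred_cube"
      unfolding centred_cube_def mem_Collect_eq
    proof
      fix i show "- 1 / 2 \<le> u $ i \<and> u $ i < 1 / 2" using u[of i] s(2) h by linarith
    qed
    moreover from \<open>norm u \<le> h / 2\<close> have "h / 2 \<le> max 0 (h - norm u)" by linarith
    ultimately show ?thesis using True ennreal_leI[of "h / 2" "max 0 (h - norm u)"] by (simp add: f_def)
  qed simp
  have "emeasure lborel B = ennreal (s ^ ?d)"
  proof -
    have "(\<chi> i :: 'd. s) \<bullet> b = s" if "b \<in> Basis" for b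
      using that by (auto simp: Basis_vec_def inner_axis)
    then show ?thesis
      unfolding B_def using s(1) by (subst emeasure_lborel_cbox) (auto simp: prod_constant)
  qed
  then have "ennreal (h / 2 * s ^ ?d) = (\<integral>\<^sup>+ u. ennreal (h / 2) * indicator B u \<partial>lborel)"
    using h s(1) by (subst nn_integral_cmult_indicator) (auto simp: B_def ennreal_mult'[symmetric])
  also have "\<dots> \<le> (\<integral>\<^sup>+ u. f u \<partial>lborel)" by (intro nn_integral_mono B)
  finally have lower: "ennreal (h / 2 * s ^ ?d) \<le> (\<integral>\<^sup>+ u. f u \<partial>lborel)" .
  have "(\<integral>\<^sup>+ u. f u \<partial>lborel) \<le> (\<integral>\<^sup>+ u. ennreal h * indicator centred_cube (u :: real ^ 'd) \<partial>lborel)"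
    using h by (intro nn_integral_mono) (auto simp: f_def indicator_def intro!: ennreal_leI)
  also have "\<dots> = ennreal h"
    using nn_integral_torus_dist[of "\<lambda>_. ennreal h" "undefined :: 'd torus"] by simp
  finally have upper: "(\<integral>\<^sup>+ u. f u \<partial>lborel) < top" by (rule le_less_trans) simp
  define n where "n = enn2real (\<integral>\<^sup>+ u. f u \<partial>lborel)"
  have n_eq: "(\<integral>\<^sup>+ u. f u \<partial>lborel) = ennreal n" using upper by (simp add: n_def)
  have n_ge: "h / 2 * s ^ ?d \<le> n"
    using lower unfolding n_eq by (subst (asm) ennreal_le_iff) (simp_all add: n_def)
  have n_pos: "n > 0" using n_ge s(1) h by (intro less_le_trans[OF _ n_ge]) simp
  define k where "k t = ennreal (max 0 (h - t) / n)" for t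
  show ?thesis
  proof (rule that)
    show [measurable]: "k \<in> borel_measurable borel" unfolding k_def by measurable
    have "(\<integral>\<^sup>+ u. k (norm u) * indicator centred_cube (u :: real ^ 'd) \<partial>lborel)
        = (\<integral>\<^sup>+ u. ennreal (inverse n) * f u \<partial>lborel)"
      using n_pos by (intro nn_integral_cong)
        (simp add: k_def f_def divide_inverse ennreal_mult mult_ac)
    also have "\<dots> = 1" using n_pos by (simp add: nn_integral_cmult n_eq ennreal_mult[symmetric])
    finally show "(\<integral>\<^sup>+ u. k (norm u) * indicator centred_cube (u :: real ^ 'd) \<partial>lborel) = 1" .
    show "\<forall>t>h. k t = 0" by (simp add: k_def)
    have "1 / n \<le> 1 / (h / 2 * s ^ ?d)"
      using n_ge s(1) h by (intro divide_left_mono mult_pos_pos n_pos) auto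
    also have "\<dots> = 2 * (2 * real ?d) ^ ?d / h ^ (?d + 1)"
      using h by (simp add: s_def power_divide)
    finally have K: "1 / n \<le> 2 * (2 * real ?d) ^ ?d / h ^ (?d + 1)" .
    show "\<forall>s t. k s \<le> k t + ennreal (2 * (2 * real ?d) ^ ?d / h ^ (?d + 1) * \<bar>s - t\<bar>)"
    proof (intro allI)
      fix s t :: real
      have "max 0 (h - s) / n \<le> (max 0 (h - t) + \<bar>s - t\<bar>) / n"
        using n_pos by (intro divide_right_mono) auto
      also have "\<dots> = max 0 (h - t) / n + 1 / n * \<bar>s - t\<bar>" by (simp add: add_divide_distrib)
      also have "\<dots> \<le> max 0 (h - t) / n + 2 * (2 * real ?d) ^ ?d / h ^ (?d + 1) * \<bar>s - t\<bar>"
        by (intro add_left_mono mult_right_mono K) auto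
      finally have "k s \<le> ennreal (max 0 (h - t) / n
          + 2 * (2 * real ?d) ^ ?d / h ^ (?d + 1) * \<bar>s - t\<bar>)"
        unfolding k_def by (rule ennreal_leI)
      also have "\<dots> = k t + ennreal (2 * (2 * real ?d) ^ ?d / h ^ (?d + 1) * \<bar>s - t\<bar>)"
        unfolding k_def using n_pos h by (intro ennreal_plus) auto
      finally show "k s \<le> k t + ennreal (2 * (2 * real ?d) ^ ?d / h ^ (?d + 1) * \<bar>s - t\<bar>)" .
    qed
  qed
qed

text \<open>The enlarged space keeps the old one as its first marginal, so everything built earlier
  survives. Mass 1 is asked almost everywhere because of the null cells in
  \<open>approximate_gluing\<close>.\<close>

lemma distr_density_fst:
  assumes N: "sigma_finite_measure N" and [measurable]: "D \<in> borel_measurable (M \<Otimes>\<^sub>M N)"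
    and D: "AE w in M. (\<integral>\<^sup>+ y. D (w, y) \<partial>N) = 1"
  shows "distr (density (M \<Otimes>\<^sub>M N) D) M fst = M"
proof (rule measure_eqI)
  interpret N: sigma_finite_measure N by fact
  fix A assume "A \<in> sets (distr (density (M \<Otimes>\<^sub>M N) D) M fst)"
  then have [measurable]: "A \<in> sets M" by simp
  have "emeasure (distr (density (M \<Otimes>\<^sub>M N) D) M fst) A
      = (\<integral>\<^sup>+ w. indicator A w \<partial>distr (density (M \<Otimes>\<^sub>M N) D) M fst)" by simp
  also have "\<dots> = (\<integral>\<^sup>+ v. indicator A (fst v) \<partial>density (M \<Otimes>\<^sub>M N) D)"
    by (rule nn_integral_distr) auto
  also have "\<dots> = (\<integral>\<^sup>+ v. D v * indicator A (fst v) \<partial>(M \<Otimes>\<^sub>M N))"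
    by (rule nn_integral_density) auto
  also have "\<dots> = (\<integral>\<^sup>+ w. \<integral>\<^sup>+ y. D (w, y) * indicator A w \<partial>N \<partial>M)"
    by (subst N.nn_integral_fst[symmetric]) auto
  also have "\<dots> = (\<integral>\<^sup>+ w. indicator A w \<partial>M)"
  proof (rule nn_integral_cong_AE)
    show "AE w in M. (\<integral>\<^sup>+ y. D (w, y) * indicator A w \<partial>N) = indicator A w"
      using D AE_space[of M]
    proof eventually_elim
      case (elim w)
      then show ?case by (subst nn_integral_multc) auto
    qed
  qed
  also have "\<dots> = emeasure M A" by simp
  finally show "emeasure (distr (density (M \<Otimes>\<^sub>M N) D) M fst) A = emeasure M A" .
qed simp

lemma finite_measure_of_distr:
  assumes X: "X \<in> M \<rightarrow>\<^sub>M N" and "distr M N X = N'" "finite_measure N'"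
  shows "finite_measure M"
proof -
  have "space N' = space N" using assms(2) by auto
  then have "emeasure N' (space N') = emeasure M (X -` space N \<inter> space M)"
    using assms(2) X by (auto simp: emeasure_distr)
  also have "X -` space N \<inter> space M = space M" using measurable_space[OF X] by auto
  finally show ?thesis
    using finite_measure.emeasure_finite[OF assms(3), of "space N'"] by (intro finite_measureI) simp
qed

lemma equidistributed_comp:
  assumes X [measurable]: "X \<in> M' \<rightarrow>\<^sub>M M" and M: "distr M' M X = M" and Y: "equidistributed M Y"
  shows "equidistributed M' (\<lambda>w. Y (X w))"
  unfolding equidistributed_def
proof (intro conjI ballI)
  show "(\<lambda>w. Y (X w)) \<in> M' \<rightarrow>\<^sub>M path_borel"
    by (rule measurable_compose[OF X equidistributedD(1)[OF Y]])
  fix t :: real assume t: "t \<in> {0..1}"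
  have "distr M' borel (\<lambda>w. Y (X w) t) = distr (distr M' M X) borel (\<lambda>w. Y w t)"
    using equidistributedD(2)[OF Y t] by (subst distr_distr) (auto simp: o_def)
  then show "distr M' borel (\<lambda>w. Y (X w) t) = torus_measure"
    using equidistributedD(3)[OF Y t] by (simp add: M)
qed

text \<open>The cell of a point is the first member of a dense sequence within r/2 of it; a least
  index of this kind is a Borel function.\<close>

lemma countable_partition_index:
  fixes r :: real
  assumes "r > 0"
  obtains idx :: "'a::{metric_space, second_countable_topology} \<Rightarrow> nat"
  where "idx \<in> borel \<rightarrow>\<^sub>M count_space UNIV" "\<forall>x y. idx x = idx y \<longrightarrow> dist x y \<le> r"
proof -
  obtain S :: "'a set" where S: "countable S" "S \<subseteq> UNIV" "UNIV \<subseteq> closure S"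
    by (rule separable[of "UNIV :: 'a set"])
  define s where "s = from_nat_into S"
  have "\<exists>n. dist x (s n) < r / 2" for x
  proof -
    obtain y where "y \<in> S" "dist y x < r / 2"
      using S(3) closure_approachable[of x S] half_gt_zero[OF assms] by blast
    then show ?thesis
      using from_nat_into_surj[OF S(1)] unfolding s_def by (metis dist_commute)
  qed
  then have near: "dist x (s (LEAST n. dist x (s n) < r / 2)) < r / 2" for x
    by (rule LeastI_ex)
  define idx where "idx x = (LEAST n. dist x (s n) < r / 2)" for x
  show ?thesis
  proof (rule that)
    show "idx \<in> borel \<rightarrow>\<^sub>M count_space UNIV" unfolding idx_def by measurable
    show "\<forall>x y. idx x = idx y \<longrightarrow> dist x y \<le> r"
    proof (intro allI impI)
      fix x y assume "idx x = idx y"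
      then show "dist x y \<le> r"
        using near[of x] near[of y] dist_triangle2[of x y "s (idx x)"] by (simp add: idx_def)
    qed
  qed
qed

text \<open>Gluing two measures along a common marginal without disintegration: on each cell of a
  countable partition the two conditional measures are taken independent, so the glued values
  agree up to the diameter of the cells.\<close>

lemma approximate_gluing:
  fixes e :: "'a \<Rightarrow> 'x::{metric_space, second_countable_topology}" and g :: "'b \<Rightarrow> 'x"
  assumes E: "finite_measure E" and P: "finite_measure P"
    and e [measurable]: "e \<in> E \<rightarrow>\<^sub>M borel" and g [measurable]: "g \<in> P \<rightarrow>\<^sub>M borel"
    and eq: "distr E borel e = distr P borel g" and r: "r > 0"
  obtains D where "D \<in> borel_measurable (E \<Otimes>\<^sub>M P)"
    "\<forall>w\<in>space E. (\<integral>\<^sup>+ y. D (w, y) \<partial>P) \<le> 1"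
    "distr (density (E \<Otimes>\<^sub>M P) D) E fst = E" "distr (density (E \<Otimes>\<^sub>M P) D) P snd = P"
    "\<forall>v. D v \<noteq> 0 \<longrightarrow> dist (e (fst v)) (g (snd v)) \<le> r"
proof -
  interpret E: finite_measure E by (rule E)
  interpret P: finite_measure P by (rule P)
  interpret EP: pair_sigma_finite E P ..
  obtain idx :: "'x \<Rightarrow> nat" where idx [measurable]: "idx \<in> borel \<rightarrow>\<^sub>M count_space UNIV"
      and close: "\<forall>x y. idx x = idx y \<longrightarrow> dist x y \<le> r"
    using countable_partition_index[OF r] by metis
  define i where "i w = idx (e w)" for w
  define j where "j y = idx (g y)" for y
  have [measurable]: "i \<in> E \<rightarrow>\<^sub>M count_space UNIV" "j \<in> P \<rightarrow>\<^sub>M count_space UNIV"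
    unfolding i_def j_def by measurable
  define c where "c n = emeasure E {w \<in> space E. i w = n}" for n
  \<comment> \<open>Cells have the same mass under both measures because \<open>e\<close> and
    \<open>g\<close> have the same law.\<close>
  have c': "c n = emeasure P {y \<in> space P. j y = n}" for n
  proof -
    have [measurable]: "idx -` {n} \<in> sets borel" using measurable_sets[OF idx, of "{n}"] by simp
    have "c n = emeasure (distr E borel e) (idx -` {n})"
      by (subst emeasure_distr) (auto simp: c_def i_def intro!: arg_cong[where f = "emeasure E"])
    also have "\<dots> = emeasure P {y \<in> space P. j y = n}"
      unfolding eq by (subst emeasure_distr) (auto simp: j_def intro!: arg_cong[where f = "emeasure P"])
    finally show ?thesis .
  qed
  have c_fin: "c n < top" for n by (simp add: c_def E.emeasure_finite top.not_eq_extremum[symmetric])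
  have self: "c n / c n \<le> 1" "c n \<noteq> 0 \<Longrightarrow> c n / c n = 1" for n
    using c_fin[of n] by (cases "c n = 0"; auto)+
  \<comment> \<open>On cell n, the mass \<open>c n\<close> times the two conditional densities
    \<open>1 / c n\<close> leaves \<open>1 / c n\<close>.\<close>
  define D where "D v = indicator {v. i (fst v) = j (snd v)} v / c (j (snd v))" for v
  have [measurable]: "c \<in> borel_measurable (count_space UNIV)" by simp
  have D_meas [measurable]: "D \<in> borel_measurable (E \<Otimes>\<^sub>M P)"
  proof -
    have "(\<lambda>v. i (fst v) = j (snd v)) = (\<lambda>v. \<exists>n. i (fst v) = n \<and> j (snd v) = n)" by auto
    then have [measurable]: "Measurable.pred (E \<Otimes>\<^sub>M P) (\<lambda>v. i (fst v) = j (snd v))" by (simp only:) measurable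
    have "(\<lambda>v. if i (fst v) = j (snd v) then 1 / c (j (snd v)) else 0) \<in> borel_measurable (E \<Otimes>\<^sub>M P)"
      by measurable
    also have "(\<lambda>v. if i (fst v) = j (snd v) then 1 / c (j (snd v)) else 0) = D"
      by (auto simp: D_def fun_eq_iff)
    finally show ?thesis .
  qed
  have int_P: "(\<integral>\<^sup>+ y. D (w, y) \<partial>P) = c (i w) / c (i w)" for w
  proof -
    have "(\<integral>\<^sup>+ y. D (w, y) \<partial>P) = (\<integral>\<^sup>+ y. inverse (c (i w)) * indicator {y \<in> space P. j y = i w} y \<partial>P)"
      by (intro nn_integral_cong) (auto simp: D_def indicator_def divide_ennreal_def)
    also have "\<dots> = inverse (c (i w)) * c (i w)"
      by (subst nn_integral_cmult_indicator) (auto simp: c'[symmetric])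
    finally show ?thesis by (simp add: divide_ennreal_def mult.commute)
  qed
  have int_E: "(\<integral>\<^sup>+ w. D (w, y) \<partial>E) = c (j y) / c (j y)" for y
  proof -
    have "(\<integral>\<^sup>+ w. D (w, y) \<partial>E) = (\<integral>\<^sup>+ w. inverse (c (j y)) * indicator {w \<in> space E. i w = j y} w \<partial>E)"
      by (intro nn_integral_cong) (auto simp: D_def indicator_def divide_ennreal_def)
    also have "\<dots> = inverse (c (j y)) * c (j y)"
      by (subst nn_integral_cmult_indicator) (auto simp: c_def[symmetric])
    finally show ?thesis by (simp add: divide_ennreal_def mult.commute)
  qed
  \<comment> \<open>On cells of mass 0 the kernel integrates to 0 instead of 1; there are countably
    many, so together they are null.\<close>
  have ae_E: "AE w in E. c (i w) \<noteq> 0"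
  proof -
    have "AE w in E. i w = n \<longrightarrow> c n \<noteq> 0" for n
    proof (cases "c n = 0")
      case True
      then have "AE w in E. \<not> i w = n" unfolding c_def by (subst AE_iff_measurable[OF _ refl]) auto
      then show ?thesis by eventually_elim auto
    qed auto
    then have "AE w in E. \<forall>n. i w = n \<longrightarrow> c n \<noteq> 0" by (subst AE_all_countable) auto
    then show ?thesis by auto
  qed
  have ae_P: "AE y in P. c (j y) \<noteq> 0"
  proof -
    have "AE y in P. j y = n \<longrightarrow> c n \<noteq> 0" for n
    proof (cases "c n = 0")
      case True
      then have "AE y in P. \<not> j y = n" unfolding c' by (subst AE_iff_measurable[OF _ refl]) auto
      then show ?thesis by eventually_elim auto
    qed auto
    then have "AE y in P. \<forall>n. j y = n \<longrightarrow> c n \<noteq> 0" by (subst AE_all_countable) auto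
    then show ?thesis by auto
  qed
  show ?thesis
  proof (rule that[OF D_meas])
    show "\<forall>w\<in>space E. (\<integral>\<^sup>+ y. D (w, y) \<partial>P) \<le> 1" by (simp add: int_P self(1))
    have "AE w in E. (\<integral>\<^sup>+ y. D (w, y) \<partial>P) = 1"
      using ae_E by eventually_elim (simp only: int_P self(2) not_False_eq_True)
    then show "distr (density (E \<Otimes>\<^sub>M P) D) E fst = E"
      by (intro distr_density_fst P.sigma_finite_measure_axioms D_meas)
    show "distr (density (E \<Otimes>\<^sub>M P) D) P snd = P"
    proof (rule measure_eqI)
      fix A assume "A \<in> sets (distr (density (E \<Otimes>\<^sub>M P) D) P snd)"
      then have [measurable]: "A \<in> sets P" by simp
      have "emeasure (distr (density (E \<Otimes>\<^sub>M P) D) P snd) A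
          = (\<integral>\<^sup>+ w. indicator A w \<partial>distr (density (E \<Otimes>\<^sub>M P) D) P snd)" by simp
      also have "\<dots> = (\<integral>\<^sup>+ v. indicator A (snd v) \<partial>density (E \<Otimes>\<^sub>M P) D)"
        by (rule nn_integral_distr) auto
      also have "\<dots> = (\<integral>\<^sup>+ v. D v * indicator A (snd v) \<partial>(E \<Otimes>\<^sub>M P))"
        by (rule nn_integral_density) auto
      also have "\<dots> = (\<integral>\<^sup>+ y. \<integral>\<^sup>+ w. D (w, y) * indicator A y \<partial>E \<partial>P)"
        by (subst EP.nn_integral_snd[symmetric]) auto
      also have "\<dots> = (\<integral>\<^sup>+ y. indicator A y \<partial>P)"
      proof (rule nn_integral_cong_AE)
        show "AE y in P. (\<integral>\<^sup>+ w. D (w, y) * indicator A y \<partial>E) = indicator A y"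
          using ae_P AE_space[of P]
        proof eventually_elim
          case (elim y)
          then have "(\<integral>\<^sup>+ w. D (w, y) * indicator A y \<partial>E) = (\<integral>\<^sup>+ w. D (w, y) \<partial>E) * indicator A y"
            by (intro nn_integral_multc) auto
          then show ?case using elim by (simp only: int_E self(2) not_False_eq_True mult_1)
        qed
      qed
      also have "\<dots> = emeasure P A" by simp
      finally show "emeasure (distr (density (E \<Otimes>\<^sub>M P) D) P snd) A = emeasure P A" .
    qed simp
    show "\<forall>v. D v \<noteq> 0 \<longrightarrow> dist (e (fst v)) (g (snd v)) \<le> r"
      using close by (auto simp: D_def i_def j_def indicator_def split: if_splits)
  qed
qed

section \<open>Perturbation of the minimal action\<close>

lemma measurable_path_endpoints: "(\<lambda>\<omega>. (\<omega> 0, \<omega> 1)) \<in> path_borel \<rightarrow>\<^sub>M borel"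
  by (intro borel_measurable_Pair measurable_path_eval) auto

text \<open>The law of \<open>Z\<close> is an admissible flow, and
  \<open>nn_integral_distr_le\<close> bounds its action from above by the integral over
  \<open>M\<close>.\<close>

lemma minimal_action_le:
  fixes Z :: "'w \<Rightarrow> real \<Rightarrow> 'd::finite torus"
  assumes Z: "equidistributed M Z" and law: "distr M borel (\<lambda>w. (Z w 0, Z w 1)) = \<nu>"
    and act: "(\<integral>\<^sup>+ w. curve_action (Z w) \<partial>M) \<le> c" and c: "c < \<infinity>"
  shows "minimal_action \<nu> \<le> c"
proof -
  note [measurable] = equidistributedD(1)[OF Z]
  let ?\<eta> = "distr M path_borel Z"
  have le: "flow_action ?\<eta> \<le> c"
  proof -
    have "flow_action ?\<eta> \<le> (\<integral>\<^sup>+ w. curve_action (Z w) \<partial>M)"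
      unfolding flow_action_def by (rule nn_integral_distr_le) measurable
    then show ?thesis using act by (rule order_trans)
  qed
  have "admissible \<nu> ?\<eta>"
    unfolding admissible_def
  proof (intro conjI ballI)
    show "generalized_flow ?\<eta>" by (simp add: generalized_flow_def)
    show "flow_action ?\<eta> < \<infinity>" using le c by (rule le_less_trans)
    fix \<phi> :: "'d torus \<times> 'd torus \<Rightarrow> ennreal" assume \<phi> [measurable]: "\<phi> \<in> borel_measurable borel"
    have "(\<integral>\<^sup>+ \<omega>. \<phi> (\<omega> 0, \<omega> 1) \<partial>?\<eta>) = (\<integral>\<^sup>+ w. \<phi> (Z w 0, Z w 1) \<partial>M)"
      by (rule nn_integral_distr) (use measurable_compose[OF measurable_path_endpoints \<phi>] in auto)
    also have "\<dots> = (\<integral>\<^sup>+ z. \<phi> z \<partial>distr M borel (\<lambda>w. (Z w 0, Z w 1)))"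
      by (rule nn_integral_distr[symmetric])
        (use measurable_compose[OF equidistributedD(1)[OF Z] measurable_path_endpoints] in auto)
    finally show "(\<integral>\<^sup>+ \<omega>. \<phi> (\<omega> 0, \<omega> 1) \<partial>?\<eta>) = (\<integral>\<^sup>+ z. \<phi> z \<partial>\<nu>)" by (simp add: law)
  next
    fix t :: real assume t: "t \<in> {0..1}"
    then show "distr ?\<eta> borel (\<lambda>\<omega>. \<omega> t) = torus_measure"
      using equidistributedD(3)[OF Z t] by (subst distr_distr) (auto simp: o_def measurable_path_eval)
  qed
  then show ?thesis unfolding minimal_action_def using le by (intro INF_lower2[of ?\<eta>]) auto
qed

lemma measurable_fst_borel [measurable]:
    "fst \<in> (borel :: ('a::second_countable_topology \<times> 'b::second_countable_topology) measure) \<rightarrow>\<^sub>M borel"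
  and measurable_snd_borel [measurable]:
    "snd \<in> (borel :: ('a::second_countable_topology \<times> 'b::second_countable_topology) measure) \<rightarrow>\<^sub>M borel"
  unfolding borel_prod[symmetric] by measurable

lemma bistochasticD:
  assumes "bistochastic \<gamma>"
  shows "sets \<gamma> = sets borel" "distr \<gamma> borel fst = torus_measure" "distr \<gamma> borel snd = torus_measure"
    "space \<gamma> = UNIV" "finite_measure \<gamma>" "emeasure \<gamma> UNIV = 1"
proof -
  show s: "sets \<gamma> = sets borel" and f: "distr \<gamma> borel fst = torus_measure"
    and "distr \<gamma> borel snd = torus_measure"
    using assms by (auto simp: bistochastic_def)
  show sp: "space \<gamma> = UNIV" using sets_eq_imp_space_eq[OF s] by simp
  have [measurable]: "fst \<in> \<gamma> \<rightarrow>\<^sub>M borel" 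
    unfolding measurable_cong_sets[OF s refl] by (rule measurable_fst_borel)
  have "emeasure (distr \<gamma> borel fst) UNIV = emeasure \<gamma> UNIV" by (subst emeasure_distr) (auto simp: sp)
  then show e: "emeasure \<gamma> UNIV = 1" by (simp add: f)
  then show "finite_measure \<gamma>" by (intro finite_measureI) (simp add: sp)
qed

text \<open>The connector with \<alpha> = 1, over \<nu> itself with the two projections as end
  points: every particle passes through an independent uniform point. The kernel width 1/4 is one
  admissible choice and contributes 8 (1/4)^2 = 1/2.\<close>

lemma minimal_action_bounded:
  fixes \<nu> :: "('d::finite torus \<times> 'd torus) measure"
  assumes \<nu>: "bistochastic \<nu>"
  shows "minimal_action \<nu> \<le> ennreal (1 / 2 + 8 * (real CARD('d))\<^sup>2)"
proof -
  note [measurable_cong] = bistochasticD(1)[OF \<nu>]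
  interpret \<nu>: finite_measure \<nu> by (rule bistochasticD(5)[OF \<nu>])
  define K where "K = 2 * (2 * real CARD('d)) ^ CARD('d) / (1 / 4) ^ (CARD('d) + 1)"
  obtain k :: "real \<Rightarrow> ennreal" where k: "k \<in> borel_measurable borel"
    "(\<integral>\<^sup>+ u. k (norm u) * indicator centred_cube (u :: real ^ 'd) \<partial>lborel) = 1"
    "\<forall>s t. k s \<le> k t + ennreal (K * \<bar>s - t\<bar>)"
    "\<forall>s>1 / 4. k s = 0"
    unfolding K_def by (rule torus_kernel[where h = "1 / 4" and ?'d = 'd]) auto
  have K: "K \<ge> 0" by (simp add: K_def)
  obtain D and Y :: "('d torus \<times> 'd torus) \<times> 'd aux \<Rightarrow> real \<Rightarrow> 'd torus" and G
    where D [measurable]: "D \<in> borel_measurable (\<nu> \<Otimes>\<^sub>M aux_measure)"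
    and D1: "\<forall>w\<in>space \<nu>. (\<integral>\<^sup>+ y. D (w, y) \<partial>aux_measure) = 1"
    and Y: "equidistributed (density (\<nu> \<Otimes>\<^sub>M aux_measure) D) Y"
      "\<forall>w. Y w 0 = fst (fst w) \<and> Y w 1 = snd (fst w)"
    and G: "\<forall>w. curve_action (Y w) \<le> G w \<and> G w < \<infinity>"
      "(\<integral>\<^sup>+ w. G w \<partial>density (\<nu> \<Otimes>\<^sub>M aux_measure) D) \<le> ennreal (8 * (1 / 4)\<^sup>2 + 8 * 1 * (real CARD('d))\<^sup>2)"
    by (rule torus_connector[of \<nu> fst snd k K "1 / 4" 1])
      (use k K bistochasticD[OF \<nu>] \<nu>.sigma_finite_measure_axioms in auto)
  show ?thesis
  proof (rule minimal_action_le[OF Y(1)])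
    have "distr (density (\<nu> \<Otimes>\<^sub>M aux_measure) D) \<nu> fst = \<nu>"
      using D1 by (intro distr_density_fst sigma_finite_aux_measure D AE_I2) auto
    moreover have "distr (density (\<nu> \<Otimes>\<^sub>M aux_measure) D) borel fst
        = distr (density (\<nu> \<Otimes>\<^sub>M aux_measure) D) \<nu> fst"
      by (rule distr_cong) (auto simp: bistochasticD(1)[OF \<nu>])
    moreover have "(\<lambda>w. (Y w 0, Y w 1)) = fst" using Y(2) by (auto simp: fun_eq_iff)
    ultimately show "distr (density (\<nu> \<Otimes>\<^sub>M aux_measure) D) borel (\<lambda>w. (Y w 0, Y w 1)) = \<nu>"
      by simp
    have "(\<integral>\<^sup>+ w. curve_action (Y w) \<partial>density (\<nu> \<Otimes>\<^sub>M aux_measure) D)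
        \<le> (\<integral>\<^sup>+ w. G w \<partial>density (\<nu> \<Otimes>\<^sub>M aux_measure) D)"
      using G(1) by (intro nn_integral_mono) auto
    also have "\<dots> \<le> ennreal (1 / 2 + 8 * (real CARD('d))\<^sup>2)"
      using G(2) by (simp add: power2_eq_square)
    finally show "(\<integral>\<^sup>+ w. curve_action (Y w) \<partial>density (\<nu> \<Otimes>\<^sub>M aux_measure) D)
        \<le> ennreal (1 / 2 + 8 * (real CARD('d))\<^sup>2)" .
  qed (simp only: infinity_ennreal_def ennreal_less_top)
qed

text \<open>Here h^(d+3) plays the role of the distance. The factor 1/(1-h)^2 is the price of the
  shortened middle interval; the 3 counts the first connector once and the second twice, since 2
  bounds 1/(1-h).\<close>

lemma minimal_action_perturb:
  fixes \<mu> \<nu> :: "('d::finite torus \<times> 'd torus) measure"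
  assumes \<mu>: "bistochastic \<mu>" and \<nu>: "bistochastic \<nu>" and \<eta>: "admissible \<mu> \<eta>"
    and \<pi>: "\<pi> \<in> couplings \<mu> \<nu>" and h: "0 < h" "h \<le> 1 / 4"
    and cost: "(\<integral>\<^sup>+ z. ennreal ((dist (fst z) (snd z))\<^sup>2) \<partial>\<pi>) \<le> ennreal ((h ^ (CARD('d) + 3))\<^sup>2)"
  shows "minimal_action \<nu> \<le> ennreal (1 / (1 - h)\<^sup>2) * flow_action \<eta>
    + ennreal (3 * (8 + 32 * (2 * real CARD('d)) ^ CARD('d) * (real CARD('d))\<^sup>2) * h)"
proof -
  let ?d = "CARD('d)" and ?A = "aux_measure :: 'd aux measure"
  define s where "s = h ^ (?d + 3)"
  have s: "s > 0" using h by (simp add: s_def)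
  define K where "K = 2 * (2 * real ?d) ^ ?d / h ^ (?d + 1)"
  have K: "K \<ge> 0" using h by (simp add: K_def)
  \<comment> \<open>The mean distance to be bridged at each end is at most 2s: s from the gluing and
    s from the transport.\<close>
  define \<alpha> where "\<alpha> = min 1 (K * (2 * s))"
  have \<alpha>: "0 \<le> \<alpha>" "\<alpha> \<le> 1" using K s by (auto simp: \<alpha>_def)
  \<comment> \<open>The exponents leave (d+3) - (d+1) = 2: the unmatched mass is of order h^2, like
    the cost of spreading.\<close>
  have Ks: "K * (2 * s) = 4 * (2 * real ?d) ^ ?d * h\<^sup>2"
    using h by (simp add: K_def s_def power_add power2_eq_square eval_nat_numeral)
  define C where "C = 8 + 32 * (2 * real ?d) ^ ?d * (real ?d)\<^sup>2"
  have C: "C \<ge> 0" by (simp add: C_def)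
  have C_ge: "8 * h\<^sup>2 + 8 * \<alpha> * (real ?d)\<^sup>2 \<le> C * h\<^sup>2"
  proof -
    have "\<alpha> * (real ?d)\<^sup>2 \<le> 4 * (2 * real ?d) ^ ?d * h\<^sup>2 * (real ?d)\<^sup>2"
      unfolding Ks[symmetric] by (intro mult_right_mono) (auto simp: \<alpha>_def)
    then show ?thesis by (simp add: C_def algebra_simps)
  qed
  obtain k :: "real \<Rightarrow> ennreal" where k: "k \<in> borel_measurable borel"
    "(\<integral>\<^sup>+ u. k (norm u) * indicator centred_cube (u :: real ^ 'd) \<partial>lborel) = 1"
    "\<forall>s t. k s \<le> k t + ennreal (K * \<bar>s - t\<bar>)"
    "\<forall>s>h. k s = 0"
    unfolding K_def by (rule torus_kernel[of h, where ?'d = 'd]) (use h in auto)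

  have sets_\<eta> [measurable_cong]: "sets \<eta> = sets path_borel"
    using \<eta> by (simp add: admissible_def generalized_flow_def)
  have sets_\<pi> [measurable_cong]: "sets \<pi> = sets borel" using \<pi> by (simp add: couplings_def)
  have space_\<pi>: "space \<pi> = UNIV" using sets_eq_imp_space_eq[OF sets_\<pi>] by simp
  have ends [measurable]: "(\<lambda>\<omega>. (\<omega> 0, \<omega> 1)) \<in> \<eta> \<rightarrow>\<^sub>M borel"
    using measurable_path_endpoints by (simp add: measurable_cong_sets[OF sets_\<eta> refl])
  have law_\<eta>: "distr \<eta> borel (\<lambda>\<omega>. (\<omega> 0, \<omega> 1)) = \<mu>"
  proof (rule measure_eqI)
    fix B assume "B \<in> sets (distr \<eta> borel (\<lambda>\<omega>. (\<omega> 0, \<omega> 1)))"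
    then have [measurable]: "B \<in> sets borel" and B: "B \<in> sets \<mu>" by (auto simp: bistochasticD(1)[OF \<mu>])
    have "emeasure (distr \<eta> borel (\<lambda>\<omega>. (\<omega> 0, \<omega> 1))) B
        = (\<integral>\<^sup>+ z. indicator B z \<partial>distr \<eta> borel (\<lambda>\<omega>. (\<omega> 0, \<omega> 1)))" by simp
    also have "\<dots> = (\<integral>\<^sup>+ \<omega>. indicator B (\<omega> 0, \<omega> 1) \<partial>\<eta>)" by (rule nn_integral_distr) auto
    also have "\<dots> = (\<integral>\<^sup>+ z. indicator B z \<partial>\<mu>)" using \<eta> by (simp add: admissible_def)
    also have "\<dots> = emeasure \<mu> B" using B by simp
    finally show "emeasure (distr \<eta> borel (\<lambda>\<omega>. (\<omega> 0, \<omega> 1))) B = emeasure \<mu> B" .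
  qed (simp add: bistochasticD(1)[OF \<mu>])
  have law_fst: "distr \<pi> borel fst = \<mu>" and law_snd: "distr \<pi> borel snd = \<nu>"
    using \<pi> by (auto simp: couplings_def)
  have fin_\<eta>: "finite_measure \<eta>" by (rule finite_measure_of_distr[OF ends law_\<eta> bistochasticD(5)[OF \<mu>]])
  have [measurable]: "fst \<in> \<pi> \<rightarrow>\<^sub>M borel" "snd \<in> \<pi> \<rightarrow>\<^sub>M borel" by measurable
  have fin_\<pi>: "finite_measure \<pi>"
    by (rule finite_measure_of_distr[OF _ law_fst bistochasticD(5)[OF \<mu>]]) measurable
  have mass_\<pi>: "emeasure \<pi> UNIV = 1"
  proof -
    have "emeasure (distr \<pi> borel fst) UNIV = emeasure \<pi> UNIV"
      by (subst emeasure_distr) (auto simp: space_\<pi>)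
    then show ?thesis by (simp add: law_fst bistochasticD(6)[OF \<mu>])
  qed
  have eq_\<eta>: "equidistributed \<eta> (\<lambda>\<omega>. \<omega>)"
    using \<eta> by (simp add: equidistributed_def admissible_def measurable_cong_sets[OF sets_\<eta> refl])

  \<comment> \<open>The path is glued, up to an error s, to a transport pair whose first component
    matches its end points; the second component then has law \<nu>.\<close>
  obtain D0 where D0 [measurable]: "D0 \<in> borel_measurable (\<eta> \<Otimes>\<^sub>M \<pi>)"
    and D0_le: "\<forall>w\<in>space \<eta>. (\<integral>\<^sup>+ y. D0 (w, y) \<partial>\<pi>) \<le> 1"
    and M0_fst: "distr (density (\<eta> \<Otimes>\<^sub>M \<pi>) D0) \<eta> fst = \<eta>"
    and M0_snd: "distr (density (\<eta> \<Otimes>\<^sub>M \<pi>) D0) \<pi> snd = \<pi>"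
    and D0_close: "\<forall>v. D0 v \<noteq> 0 \<longrightarrow> dist (fst v 0, fst v 1) (fst (snd v)) \<le> s"
    by (rule approximate_gluing[OF fin_\<eta> fin_\<pi> ends, of fst s]) (use law_\<eta> law_fst s in auto)
  define M0 where "M0 = density (\<eta> \<Otimes>\<^sub>M \<pi>) D0"
  have sets_M0 [measurable_cong]: "sets M0 = sets (\<eta> \<Otimes>\<^sub>M \<pi>)" by (simp add: M0_def)
  have fin_M0: "finite_measure M0"
    by (rule finite_measure_of_distr[OF _ M0_fst[folded M0_def] fin_\<eta>]) measurable
  interpret M0: finite_measure M0 by (rule fin_M0)
  have eq_M0: "equidistributed M0 fst"
    by (rule equidistributed_comp[OF _ M0_fst[folded M0_def] eq_\<eta>]) measurable
  define a where "a v = fst (snd (snd v))" for v :: "(real \<Rightarrow> 'd torus) \<times> ('d torus \<times> 'd torus) \<times> 'd torus \<times> 'd torus"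
  define b where "b v = snd (snd (snd v))" for v :: "(real \<Rightarrow> 'd torus) \<times> ('d torus \<times> 'd torus) \<times> 'd torus \<times> 'd torus"
  have ab_meas [measurable]: "(\<lambda>v. snd (snd v)) \<in> M0 \<rightarrow>\<^sub>M borel" by measurable
  have a_meas [measurable]: "a \<in> M0 \<rightarrow>\<^sub>M borel" and b_meas [measurable]: "b \<in> M0 \<rightarrow>\<^sub>M borel"
    unfolding a_def b_def by measurable
  have law_ab: "distr M0 borel (\<lambda>v. snd (snd v)) = \<nu>"
  proof -
    have "distr M0 borel (\<lambda>v. snd (snd v)) = distr (distr M0 \<pi> snd) borel snd"
      by (subst distr_distr) (auto simp: o_def)
    then show ?thesis by (simp add: M0_snd[folded M0_def] law_snd)
  qed
  have law_a: "distr M0 borel a = torus_measure" and law_b: "distr M0 borel b = torus_measure"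
  proof -
    have "distr M0 borel a = distr (distr M0 borel (\<lambda>v. snd (snd v))) borel fst"
      by (subst distr_distr) (auto simp: o_def a_def[abs_def])
    moreover have "distr M0 borel b = distr (distr M0 borel (\<lambda>v. snd (snd v))) borel snd"
      by (subst distr_distr) (auto simp: o_def b_def[abs_def])
    ultimately show "distr M0 borel a = torus_measure" "distr M0 borel b = torus_measure"
      by (simp_all add: law_ab bistochasticD(2,3)[OF \<nu>])
  qed

  \<comment> \<open>The inequality 2 s x \<le> x^2 + s^2, in place of Cauchy-Schwarz, turns the
    quadratic cost s^2 into the mean distance s.\<close>
  have transport: "(\<integral>\<^sup>+ z. ennreal (dist (fst z) (snd z)) \<partial>\<pi>) \<le> ennreal s"
  proof -
    have "dist (fst z) (snd z) \<le> 1 / (2 * s) * (dist (fst z) (snd z))\<^sup>2 + s / 2" for z :: "('d torus \<times> 'd torus) \<times> 'd torus \<times> 'd torus"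
    proof -
      have "0 \<le> (dist (fst z) (snd z) - s)\<^sup>2" by simp
      then have "2 * s * dist (fst z) (snd z) \<le> (dist (fst z) (snd z))\<^sup>2 + s * s"
        by (simp add: power2_diff power2_eq_square algebra_simps)
      then show ?thesis using s by (simp add: field_simps)
    qed
    then have "(\<integral>\<^sup>+ z. ennreal (dist (fst z) (snd z)) \<partial>\<pi>)
        \<le> (\<integral>\<^sup>+ z. ennreal (1 / (2 * s)) * ennreal ((dist (fst z) (snd z))\<^sup>2) + ennreal (s / 2) \<partial>\<pi>)"
      using s by (intro nn_integral_mono)
        (simp add: ennreal_mult'[symmetric] ennreal_plus[symmetric] ennreal_leI del: ennreal_plus)
    also have "\<dots> = ennreal (1 / (2 * s)) * (\<integral>\<^sup>+ z. ennreal ((dist (fst z) (snd z))\<^sup>2) \<partial>\<pi>) + ennreal (s / 2)"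
      by (simp add: nn_integral_add nn_integral_cmult space_\<pi> mass_\<pi>)
    also have "\<dots> \<le> ennreal (1 / (2 * s)) * ennreal (s\<^sup>2) + ennreal (s / 2)"
      using cost by (intro add_mono mult_left_mono) (auto simp: s_def)
    also have "\<dots> = ennreal s"
      using s by (simp add: ennreal_mult'[symmetric] ennreal_plus[symmetric] power2_eq_square del: ennreal_plus)
    finally show ?thesis .
  qed
  have close: "(\<integral>\<^sup>+ v. ennreal (K * dist (y v) (y' v)) \<partial>M0) \<le> ennreal (K * (2 * s))"
    if yy: "\<And>v. dist (y v) (y' v) \<le> dist (fst v 0, fst v 1) (fst (snd v)) + dist (fst (snd v)) (snd (snd v))"
    for y y' :: "_ \<Rightarrow> 'd torus"
  proof -
    have "(\<integral>\<^sup>+ v. ennreal (K * dist (y v) (y' v)) \<partial>M0)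
        \<le> (\<integral>\<^sup>+ v. ennreal K * (ennreal s + ennreal (dist (fst (snd v)) (snd (snd v)))) \<partial>M0)"
    proof (rule nn_integral_mono_AE)
      \<comment> \<open>The gluing estimate holds where \<open>D0\<close> is nonzero, that is almost
        everywhere for \<open>M0\<close>.\<close>
      have "AE v in M0. D0 v \<noteq> 0" unfolding M0_def by (subst AE_density) auto
      then show "AE v in M0. ennreal (K * dist (y v) (y' v))
          \<le> ennreal K * (ennreal s + ennreal (dist (fst (snd v)) (snd (snd v))))"
      proof eventually_elim
        case (elim v)
        then have "dist (y v) (y' v) \<le> s + dist (fst (snd v)) (snd (snd v))"
          using D0_close yy[of v] by (meson add_right_mono order_trans)
        then show ?case
          using K s by (simp add: ennreal_mult'[symmetric] ennreal_plus[symmetric] ennreal_leI mult_left_mono del: ennreal_plus)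
      qed
    qed
    also have "\<dots> = (\<integral>\<^sup>+ z. ennreal K * (ennreal s + ennreal (dist (fst z) (snd z))) \<partial>distr M0 \<pi> snd)"
      by (rule nn_integral_distr[symmetric]) measurable
    also have "\<dots> = ennreal K * (ennreal s + (\<integral>\<^sup>+ z. ennreal (dist (fst z) (snd z)) \<partial>\<pi>))"
      by (simp add: M0_snd[folded M0_def] nn_integral_cmult nn_integral_add space_\<pi> mass_\<pi>)
    also have "\<dots> \<le> ennreal K * (ennreal s + ennreal s)" by (intro mult_left_mono add_left_mono transport) auto
    also have "\<dots> = ennreal (K * (2 * s))"
      using K s by (simp add: ennreal_mult'[symmetric] ennreal_plus[symmetric] del: ennreal_plus)
    finally show ?thesis .
  qed
  have close_\<alpha>: "\<alpha> = 1 \<or> I \<le> ennreal \<alpha>" if "I \<le> ennreal (K * (2 * s))" for I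
    using that by (auto simp: \<alpha>_def min_def)

  have start: "\<alpha> = 1 \<or> (\<integral>\<^sup>+ v. ennreal (K * dist (a v) (fst v 0)) \<partial>M0) \<le> ennreal \<alpha>"
  proof (intro close_\<alpha> close)
    fix v :: "(real \<Rightarrow> 'd torus) \<times> ('d torus \<times> 'd torus) \<times> 'd torus \<times> 'd torus"
    have "dist (a v) (fst v 0) \<le> dist (fst v 0) (fst (fst (snd v))) + dist (fst (fst (snd v))) (a v)"
      by (metis dist_commute dist_triangle)
    then show "dist (a v) (fst v 0) \<le> dist (fst v 0, fst v 1) (fst (snd v)) + dist (fst (snd v)) (snd (snd v))"
      using dist_fst_le[of "(fst v 0, fst v 1)" "fst (snd v)"] dist_fst_le[of "fst (snd v)" "snd (snd v)"]
      by (simp add: a_def)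
  qed
  have stop: "\<alpha> = 1 \<or> (\<integral>\<^sup>+ v. ennreal (K * dist (fst v 1) (b v)) \<partial>M0) \<le> ennreal \<alpha>"
  proof (intro close_\<alpha> close)
    fix v :: "(real \<Rightarrow> 'd torus) \<times> ('d torus \<times> 'd torus) \<times> 'd torus \<times> 'd torus"
    have "dist (fst v 1) (b v) \<le> dist (fst v 1) (snd (fst (snd v))) + dist (snd (fst (snd v))) (b v)"
      by (rule dist_triangle)
    then show "dist (fst v 1) (b v) \<le> dist (fst v 0, fst v 1) (fst (snd v)) + dist (fst (snd v)) (snd (snd v))"
      using dist_snd_le[of "(fst v 0, fst v 1)" "fst (snd v)"] dist_snd_le[of "fst (snd v)" "snd (snd v)"]
      by (simp add: b_def)
  qed
  have end_meas [measurable]: "(\<lambda>v. fst v 0) \<in> M0 \<rightarrow>\<^sub>M borel" "(\<lambda>v. fst v 1) \<in> M0 \<rightarrow>\<^sub>M borel"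
    using equidistributedD(2)[OF eq_M0, of 0] equidistributedD(2)[OF eq_M0, of 1] by auto
  have end_law: "distr M0 borel (\<lambda>v. fst v 0) = torus_measure" "distr M0 borel (\<lambda>v. fst v 1) = torus_measure"
    using equidistributedD(3)[OF eq_M0, of 0] equidistributedD(3)[OF eq_M0, of 1] by auto

  \<comment> \<open>The first connector leads from the point prescribed by \<nu> to the start of the
    path. The second is built over \<open>M1\<close>, which already carries the first.\<close>
  obtain D1 and Y1 :: "_ \<Rightarrow> real \<Rightarrow> 'd torus" and G1
    where D1 [measurable]: "D1 \<in> borel_measurable (M0 \<Otimes>\<^sub>M ?A)"
    and D1_eq: "\<forall>w\<in>space M0. (\<integral>\<^sup>+ y. D1 (w, y) \<partial>?A) = 1"
    and Y1: "equidistributed (density (M0 \<Otimes>\<^sub>M ?A) D1) Y1"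
      "\<forall>w. Y1 w 0 = a (fst w) \<and> Y1 w 1 = fst (fst w) 0"
    and G1 [measurable]: "G1 \<in> borel_measurable (M0 \<Otimes>\<^sub>M ?A)"
    and G1_le: "\<forall>w. curve_action (Y1 w) \<le> G1 w \<and> G1 w < \<infinity>"
      "(\<integral>\<^sup>+ w. G1 w \<partial>density (M0 \<Otimes>\<^sub>M ?A) D1) \<le> ennreal (8 * h\<^sup>2 + 8 * \<alpha> * (real ?d)\<^sup>2)"
    by (rule torus_connector[of M0 a "\<lambda>v. fst v 0" k K h \<alpha>])
      (use k K \<alpha> law_a end_law start M0.sigma_finite_measure_axioms in auto)
  define M1 where "M1 = density (M0 \<Otimes>\<^sub>M ?A) D1"
  have sets_M1 [measurable_cong]: "sets M1 = sets (M0 \<Otimes>\<^sub>M ?A)" by (simp add: M1_def)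
  have M1_fst: "distr M1 M0 fst = M0"
    unfolding M1_def using D1_eq by (intro distr_density_fst sigma_finite_aux_measure D1 AE_I2) auto
  have fin_M1: "finite_measure M1" by (rule finite_measure_of_distr[OF _ M1_fst fin_M0]) measurable
  interpret M1: finite_measure M1 by (rule fin_M1)
  have pull: "distr M1 borel (\<lambda>w. y (fst w)) = distr M0 borel y"
    if "y \<in> M0 \<rightarrow>\<^sub>M borel" for y :: "_ \<Rightarrow> 'd torus"
  proof -
    have "distr M1 borel (\<lambda>w. y (fst w)) = distr (distr M1 M0 fst) borel y"
      using that by (subst distr_distr) (auto simp: o_def)
    then show ?thesis by (simp add: M1_fst)
  qed
  have stop1: "\<alpha> = 1 \<or> (\<integral>\<^sup>+ w. ennreal (K * dist (fst (fst w) 1) (b (fst w))) \<partial>M1) \<le> ennreal \<alpha>"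
  proof -
    have "(\<integral>\<^sup>+ w. ennreal (K * dist (fst (fst w) 1) (b (fst w))) \<partial>M1)
        = (\<integral>\<^sup>+ v. ennreal (K * dist (fst v 1) (b v)) \<partial>distr M1 M0 fst)"
      by (rule nn_integral_distr[symmetric]) measurable
    then show ?thesis using stop by (simp add: M1_fst)
  qed
  obtain D2 and Y2 :: "_ \<Rightarrow> real \<Rightarrow> 'd torus" and G2
    where D2 [measurable]: "D2 \<in> borel_measurable (M1 \<Otimes>\<^sub>M ?A)"
    and D2_eq: "\<forall>w\<in>space M1. (\<integral>\<^sup>+ y. D2 (w, y) \<partial>?A) = 1"
    and Y2: "equidistributed (density (M1 \<Otimes>\<^sub>M ?A) D2) Y2"
      "\<forall>w. Y2 w 0 = fst (fst (fst w)) 1 \<and> Y2 w 1 = b (fst (fst w))"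
    and G2 [measurable]: "G2 \<in> borel_measurable (M1 \<Otimes>\<^sub>M ?A)"
    and G2_le: "\<forall>w. curve_action (Y2 w) \<le> G2 w \<and> G2 w < \<infinity>"
      "(\<integral>\<^sup>+ w. G2 w \<partial>density (M1 \<Otimes>\<^sub>M ?A) D2) \<le> ennreal (8 * h\<^sup>2 + 8 * \<alpha> * (real ?d)\<^sup>2)"
  proof (rule torus_connector[of M1 "\<lambda>w. fst (fst w) 1" "\<lambda>w. b (fst w)" k K h \<alpha>])
    show "(\<lambda>w. fst (fst w) 1) \<in> M1 \<rightarrow>\<^sub>M borel" "(\<lambda>w. b (fst w)) \<in> M1 \<rightarrow>\<^sub>M borel"
      by measurable
    show "distr M1 borel (\<lambda>w. fst (fst w) 1) = torus_measure" "distr M1 borel (\<lambda>w. b (fst w)) = torus_measure"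
      using pull[OF end_meas(2)] pull[OF b_meas] by (simp_all add: end_law law_b)
  qed (use k K \<alpha> stop1 M1.sigma_finite_measure_axioms in auto)
  define M2 where "M2 = density (M1 \<Otimes>\<^sub>M ?A) D2"
  have sets_M2 [measurable_cong]: "sets M2 = sets (M1 \<Otimes>\<^sub>M ?A)" by (simp add: M2_def)
  have M2_fst: "distr M2 M1 fst = M1"
    unfolding M2_def using D2_eq by (intro distr_density_fst sigma_finite_aux_measure D2 AE_I2) auto

  \<comment> \<open>The given path starts at time h and lasts (1 - h)^2; the connectors take times h
    and h (1 - h).\<close>
  define Z where "Z w = path_join h (Y1 (fst w)) (path_join (1 - h) (fst (fst (fst w))) (Y2 w))" for w
  have h1: "1 - h > 0" "1 - h < 1" "h < 1" using h by auto
  have eq_M1: "equidistributed M1 (\<lambda>w. fst (fst w))"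
    by (rule equidistributed_comp[OF _ M1_fst eq_M0]) measurable
  have eq_M2: "equidistributed M2 (\<lambda>w. fst (fst (fst w)))"
    by (rule equidistributed_comp[OF _ M2_fst eq_M1]) measurable
  have eq_Y1: "equidistributed M2 (\<lambda>w. Y1 (fst w))"
    by (rule equidistributed_comp[OF _ M2_fst Y1(1)[folded M1_def]]) measurable
  have Z: "equidistributed M2 Z"
    unfolding Z_def using h h1 Y1(2) Y2(2)
    by (intro equidistributed_path_join eq_Y1 eq_M2 Y2(1)[folded M2_def]) auto
  have law_Z: "distr M2 borel (\<lambda>w. (Z w 0, Z w 1)) = \<nu>"
  proof -
    have "(\<lambda>w. (Z w 0, Z w 1)) = (\<lambda>w. snd (snd (fst (fst w))))"
      using h h1 Y1(2) Y2(2) by (simp add: Z_def a_def b_def fun_eq_iff)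
    moreover have "distr M2 borel (\<lambda>w. snd (snd (fst (fst w))))
        = distr (distr (distr M2 M1 fst) M0 fst) borel (\<lambda>v. snd (snd v))"
      by (subst (2) distr_distr, measurable, subst distr_distr, measurable) (simp add: o_def)
    ultimately show ?thesis by (simp add: M2_fst M1_fst law_ab)
  qed
  \<comment> \<open>Measurable and finite, so it can be separated from the action of the given path
    inside a lower integral.\<close>
  define R where "R w = (G1 (fst w) + 2 * G2 w) * ennreal (1 / h)" for w
  have [measurable]: "R \<in> borel_measurable M2" unfolding R_def by measurable
  have act: "curve_action (Z w) \<le> ennreal (1 / (1 - h)\<^sup>2) * curve_action (fst (fst (fst w))) + R w" for w
  proof -
    have inv: "y / ennreal c = y * ennreal (1 / c)" if "c > 0" for y c
      using that by (simp add: divide_ennreal_def inverse_ennreal inverse_eq_divide)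
    let ?\<omega> = "fst (fst (fst w))"
    have Y1_1: "Y1 v 1 = fst (fst v) 0" and Y2_0: "Y2 u 0 = fst (fst (fst u)) 1" for v u
      using Y1(2) Y2(2) by blast+
    have "curve_action (Z w) \<le> curve_action (Y1 (fst w)) / ennreal h
        + curve_action (path_join (1 - h) ?\<omega> (Y2 w)) / ennreal (1 - h)"
      unfolding Z_def using h h1 by (intro curve_action_path_join) (simp_all add: Y1_1)
    also have "\<dots> \<le> G1 (fst w) / ennreal h
        + (curve_action ?\<omega> / ennreal (1 - h) + G2 w / ennreal h) / ennreal (1 - h)"
    proof (intro add_mono divide_right_mono_ennreal)
      show "curve_action (Y1 (fst w)) \<le> G1 (fst w)" using G1_le by blast
      have "curve_action (path_join (1 - h) ?\<omega> (Y2 w))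
          \<le> curve_action ?\<omega> / ennreal (1 - h) + curve_action (Y2 w) / ennreal (1 - (1 - h))"
        using h1 by (intro curve_action_path_join) (simp_all add: Y2_0)
      also have "\<dots> \<le> curve_action ?\<omega> / ennreal (1 - h) + G2 w / ennreal h"
      proof -
        have "curve_action (Y2 w) \<le> G2 w" using G2_le(1) by blast
        then show ?thesis by (simp add: add_left_mono divide_right_mono_ennreal)
      qed
      finally show "curve_action (path_join (1 - h) ?\<omega> (Y2 w))
          \<le> curve_action ?\<omega> / ennreal (1 - h) + G2 w / ennreal h" .
    qed
    also have "\<dots> = G1 (fst w) * ennreal (1 / h)
        + (curve_action ?\<omega> * ennreal (1 / (1 - h)\<^sup>2) + G2 w * ennreal (1 / h) * ennreal (1 / (1 - h)))"
      using h1 h by (simp add: inv distrib_right mult.assoc ennreal_mult'[symmetric] power2_eq_square)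
    also have "\<dots> \<le> G1 (fst w) * ennreal (1 / h)
        + (curve_action ?\<omega> * ennreal (1 / (1 - h)\<^sup>2) + G2 w * ennreal (1 / h) * 2)"
    proof (intro add_left_mono mult_left_mono)
      have "1 / (1 - h) \<le> 2" using h by (simp add: field_simps)
      then have "ennreal (1 / (1 - h)) \<le> ennreal 2" by (rule ennreal_leI)
      then show "ennreal (1 / (1 - h)) \<le> 2" by simp
    qed auto
    also have "\<dots> = ennreal (1 / (1 - h)\<^sup>2) * curve_action ?\<omega> + R w"
      by (simp add: R_def algebra_simps)
    finally show ?thesis .
  qed
  have "(\<integral>\<^sup>+ w. curve_action (Z w) \<partial>M2)
      \<le> (\<integral>\<^sup>+ w. ennreal (1 / (1 - h)\<^sup>2) * curve_action (fst (fst (fst w))) + R w \<partial>M2)"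
    by (intro nn_integral_mono act)
  also have "\<dots> \<le> (\<integral>\<^sup>+ w. ennreal (1 / (1 - h)\<^sup>2) * curve_action (fst (fst (fst w))) \<partial>M2) + (\<integral>\<^sup>+ w. R w \<partial>M2)"
    using G1_le(1) G2_le(1) by (intro nn_integral_add_measurable_le) (auto simp: R_def ennreal_mult_less_top)
  also have "\<dots> \<le> ennreal (1 / (1 - h)\<^sup>2) * flow_action \<eta> + ennreal (3 * C * h)"
  proof (rule add_mono)
    \<comment> \<open>Descent through the successive enlargements \<open>M2\<close>,
      \<open>M1\<close> and \<open>M0\<close> down to \<eta>.\<close>
    have "(\<integral>\<^sup>+ w. ennreal (1 / (1 - h)\<^sup>2) * curve_action (fst (fst (fst w))) \<partial>M2)
        \<le> (\<integral>\<^sup>+ w. ennreal (1 / (1 - h)\<^sup>2) * curve_action (fst (fst w)) \<partial>M1)"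
      unfolding M2_def using D2_eq
      by (intro nn_integral_density_fst_le[where f = "\<lambda>w. ennreal (1 / (1 - h)\<^sup>2) * curve_action (fst (fst w))"] sigma_finite_aux_measure D2) auto
    also have "\<dots> \<le> (\<integral>\<^sup>+ w. ennreal (1 / (1 - h)\<^sup>2) * curve_action (fst w) \<partial>M0)"
      unfolding M1_def using D1_eq
      by (intro nn_integral_density_fst_le[where f = "\<lambda>w. ennreal (1 / (1 - h)\<^sup>2) * curve_action (fst w)"] sigma_finite_aux_measure D1) auto
    also have "\<dots> \<le> (\<integral>\<^sup>+ \<omega>. ennreal (1 / (1 - h)\<^sup>2) * curve_action \<omega> \<partial>\<eta>)"
      unfolding M0_def using D0_le
      by (intro nn_integral_density_fst_le[where f = "\<lambda>\<omega>. ennreal (1 / (1 - h)\<^sup>2) * curve_action \<omega>"] D0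
          finite_measure.axioms(1)[OF fin_\<pi>]) auto
    also have "\<dots> \<le> ennreal (1 / (1 - h)\<^sup>2) * flow_action \<eta>"
      unfolding flow_action_def using h1 by (intro nn_integral_cmult_le) auto
    finally show "(\<integral>\<^sup>+ w. ennreal (1 / (1 - h)\<^sup>2) * curve_action (fst (fst (fst w))) \<partial>M2)
        \<le> ennreal (1 / (1 - h)\<^sup>2) * flow_action \<eta>" .
    have "(\<integral>\<^sup>+ w. G1 (fst w) \<partial>M2) \<le> (\<integral>\<^sup>+ w. G1 w \<partial>M1)"
      unfolding M2_def using D2_eq by (intro nn_integral_density_fst_le sigma_finite_aux_measure D2) auto
    also have "\<dots> \<le> ennreal (C * h\<^sup>2)"
      using G1_le(2) ennreal_leI[OF C_ge] unfolding M1_def by (rule order_trans)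
    finally have I1: "(\<integral>\<^sup>+ w. G1 (fst w) \<partial>M2) \<le> ennreal (C * h\<^sup>2)" .
    have I2: "(\<integral>\<^sup>+ w. G2 w \<partial>M2) \<le> ennreal (C * h\<^sup>2)"
      using G2_le(2) ennreal_leI[OF C_ge] unfolding M2_def by (rule order_trans)
    have "(\<integral>\<^sup>+ w. R w \<partial>M2) = ((\<integral>\<^sup>+ w. G1 (fst w) \<partial>M2) + 2 * (\<integral>\<^sup>+ w. G2 w \<partial>M2)) * ennreal (1 / h)"
      unfolding R_def by (simp add: nn_integral_multc nn_integral_add nn_integral_cmult)
    also have "\<dots> \<le> (ennreal (C * h\<^sup>2) + 2 * ennreal (C * h\<^sup>2)) * ennreal (1 / h)"
      by (intro mult_right_mono add_mono mult_left_mono I1 I2) auto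
    also have "\<dots> = ennreal (3 * C * h)"
    proof -
      have "ennreal (C * h\<^sup>2) + 2 * ennreal (C * h\<^sup>2) = ennreal (C * h\<^sup>2) + ennreal (2 * (C * h\<^sup>2))"
        using C by (subst ennreal_mult) auto
      also have "\<dots> = ennreal (3 * (C * h\<^sup>2))" using C by (subst ennreal_plus[symmetric]) auto
      finally show ?thesis using C h
        by (simp add: ennreal_mult'[symmetric] power2_eq_square)
    qed
    finally show "(\<integral>\<^sup>+ w. R w \<partial>M2) \<le> ennreal (3 * C * h)" .
  qed
  finally have bound: "(\<integral>\<^sup>+ w. curve_action (Z w) \<partial>M2)
      \<le> ennreal (1 / (1 - h)\<^sup>2) * flow_action \<eta> + ennreal (3 * C * h)" .
  have "flow_action \<eta> < \<infinity>" using \<eta> by (simp add: admissible_def)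
  then have "ennreal (1 / (1 - h)\<^sup>2) * flow_action \<eta> + ennreal (3 * C * h) < \<infinity>"
    by (simp add: ennreal_mult_less_top)
  then show ?thesis using minimal_action_le[OF Z law_Z bound] by (simp add: C_def)
qed

section \<open>Symmetry and finiteness of the transport distance\<close>

lemma couplings_swap_cost_le:
  fixes \<mu> \<nu> :: "'a::{metric_space, second_countable_topology} measure"
  shows "(INF \<pi>\<in>couplings \<nu> \<mu>. \<integral>\<^sup>+ z. ennreal ((dist (fst z) (snd z))\<^sup>2) \<partial>\<pi>)
    \<le> (INF \<pi>\<in>couplings \<mu> \<nu>. \<integral>\<^sup>+ z. ennreal ((dist (fst z) (snd z))\<^sup>2) \<partial>\<pi>)"
proof (rule INF_greatest)
  fix \<pi> assume "\<pi> \<in> couplings \<mu> \<nu>"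
  then have s [measurable_cong]: "sets \<pi> = sets borel"
    and m: "distr \<pi> borel fst = \<mu>" "distr \<pi> borel snd = \<nu>"
    by (auto simp: couplings_def)
  have [measurable]: "(\<lambda>z. (snd z, fst z)) \<in> \<pi> \<rightarrow>\<^sub>M (borel :: ('a \<times> 'a) measure)"
    by (intro borel_measurable_Pair) measurable
  let ?\<pi> = "distr \<pi> borel (\<lambda>z. (snd z, fst z))"
  have "?\<pi> \<in> couplings \<nu> \<mu>"
    unfolding couplings_def mem_Collect_eq
    by (subst (1 2) distr_distr) (auto simp: o_def m measurable_fst_borel measurable_snd_borel)
  moreover have "(\<integral>\<^sup>+ z. ennreal ((dist (fst z) (snd z))\<^sup>2) \<partial>?\<pi>)
      \<le> (\<integral>\<^sup>+ z. ennreal ((dist (fst z) (snd z))\<^sup>2) \<partial>\<pi>)"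
    by (rule order_trans[OF nn_integral_distr_le[where f = "\<lambda>z. ennreal ((dist (fst z) (snd z))\<^sup>2)"]])
      (simp_all add: dist_commute)
  ultimately show "(INF \<pi>\<in>couplings \<nu> \<mu>. \<integral>\<^sup>+ z. ennreal ((dist (fst z) (snd z))\<^sup>2) \<partial>\<pi>)
      \<le> (\<integral>\<^sup>+ z. ennreal ((dist (fst z) (snd z))\<^sup>2) \<partial>\<pi>)"
    by (rule INF_lower2)
qed

lemma monge_kantorovich_commute:
  "monge_kantorovich \<mu> \<nu> = monge_kantorovich \<nu> (\<mu> :: 'a::{metric_space, second_countable_topology} measure)"
  unfolding monge_kantorovich_def
  using couplings_swap_cost_le[of \<mu> \<nu>] couplings_swap_cost_le[of \<nu> \<mu>] by (simp add: antisym)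

lemma pair_measure_in_couplings:
  fixes \<mu> \<nu> :: "'a::second_countable_topology measure"
  assumes s: "sets \<mu> = sets borel" "sets \<nu> = sets borel"
    and m: "emeasure \<mu> UNIV = 1" "emeasure \<nu> UNIV = 1"
  shows "\<mu> \<Otimes>\<^sub>M \<nu> \<in> couplings \<mu> \<nu>"
proof -
  note [measurable_cong] = s
  have sp: "space \<mu> = UNIV" "space \<nu> = UNIV"
    using sets_eq_imp_space_eq[OF s(1)] sets_eq_imp_space_eq[OF s(2)] by auto
  interpret \<nu>: sigma_finite_measure \<nu>
    by (intro finite_measure.axioms(1) finite_measureI) (simp add: sp m)
  have "sets (\<mu> \<Otimes>\<^sub>M \<nu>) = sets ((borel :: 'a measure) \<Otimes>\<^sub>M (borel :: 'a measure))" by (intro sets_pair_measure_cong s)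
  then have "sets (\<mu> \<Otimes>\<^sub>M \<nu>) = sets (borel :: ('a \<times> 'a) measure)" unfolding borel_prod .
  moreover have "distr (\<mu> \<Otimes>\<^sub>M \<nu>) borel fst = \<mu>"
  proof (rule measure_eqI)
    fix B assume "B \<in> sets (distr (\<mu> \<Otimes>\<^sub>M \<nu>) borel fst)"
    then have [measurable]: "B \<in> sets borel" by simp
    have "fst -` B \<inter> space (\<mu> \<Otimes>\<^sub>M \<nu>) = B \<times> UNIV" by (auto simp: space_pair_measure sp)
    moreover have "emeasure (\<mu> \<Otimes>\<^sub>M \<nu>) (B \<times> UNIV) = emeasure \<mu> B * emeasure \<nu> UNIV"
      by (rule \<nu>.emeasure_pair_measure_Times) (auto simp: s)
    ultimately show "emeasure (distr (\<mu> \<Otimes>\<^sub>M \<nu>) borel fst) B = emeasure \<mu> B"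
      by (subst emeasure_distr) (auto simp: m)
  qed (simp add: s)
  moreover have "distr (\<mu> \<Otimes>\<^sub>M \<nu>) borel snd = \<nu>"
  proof (rule measure_eqI)
    fix B assume "B \<in> sets (distr (\<mu> \<Otimes>\<^sub>M \<nu>) borel snd)"
    then have [measurable]: "B \<in> sets borel" by simp
    have "snd -` B \<inter> space (\<mu> \<Otimes>\<^sub>M \<nu>) = UNIV \<times> B" by (auto simp: space_pair_measure sp)
    moreover have "emeasure (\<mu> \<Otimes>\<^sub>M \<nu>) (UNIV \<times> B) = emeasure \<mu> UNIV * emeasure \<nu> B"
      by (rule \<nu>.emeasure_pair_measure_Times) (auto simp: s)
    ultimately show "emeasure (distr (\<mu> \<Otimes>\<^sub>M \<nu>) borel snd) B = emeasure \<nu> B"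
      by (subst emeasure_distr) (auto simp: m)
  qed (simp add: s)
  ultimately show ?thesis by (simp add: couplings_def)
qed

text \<open>The bounded cost of the product coupling makes the infimum finite; at infinity
  \<open>enn2real\<close> would return 0 and the hypothesis would carry no information. The strict
  inequality replaces an optimal coupling.\<close>

lemma monge_kantorovich_less_imp_coupling:
  fixes \<mu> \<nu> :: "('d::finite torus \<times> 'd torus) measure"
  assumes \<mu>: "bistochastic \<mu>" and \<nu>: "bistochastic \<nu>" and less: "monge_kantorovich \<mu> \<nu> < s"
  obtains \<pi> where "\<pi> \<in> couplings \<mu> \<nu>"
    "(\<integral>\<^sup>+ z. ennreal ((dist (fst z) (snd z))\<^sup>2) \<partial>\<pi>) \<le> ennreal (s\<^sup>2)"
proof -
  let ?cost = "\<lambda>\<pi> :: (('d torus \<times> 'd torus) \<times> ('d torus \<times> 'd torus)) measure.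
    \<integral>\<^sup>+ z. ennreal ((dist (fst z) (snd z))\<^sup>2) \<partial>\<pi>"
  let ?I = "INF \<pi>\<in>couplings \<mu> \<nu>. ?cost \<pi>"
  have prod: "\<mu> \<Otimes>\<^sub>M \<nu> \<in> couplings \<mu> \<nu>"
    by (intro pair_measure_in_couplings bistochasticD \<mu> \<nu>)
  have "?cost (\<mu> \<Otimes>\<^sub>M \<nu>) \<le> (\<integral>\<^sup>+ z. ennreal ((2 * real CARD('d))\<^sup>2) \<partial>(\<mu> \<Otimes>\<^sub>M \<nu>))"
  proof (intro nn_integral_mono ennreal_leI power_mono)
    fix z :: "('d torus \<times> 'd torus) \<times> ('d torus \<times> 'd torus)"
    have "dist (fst z) (snd z) \<le> dist (fst (fst z)) (fst (snd z)) + dist (snd (fst z)) (snd (snd z))"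
      unfolding dist_prod_def by (intro sqrt_sum_squares_le_sum) auto
    then show "dist (fst z) (snd z) \<le> 2 * real CARD('d)"
      using dist_torus_le[of "fst (fst z)" "fst (snd z)"] dist_torus_le[of "snd (fst z)" "snd (snd z)"]
      by linarith
  qed auto
  also have "\<dots> < top"
  proof -
    interpret \<nu>: finite_measure \<nu> by (rule bistochasticD(5)[OF \<nu>])
    have "emeasure (\<mu> \<Otimes>\<^sub>M \<nu>) (UNIV \<times> UNIV) = emeasure \<mu> UNIV * emeasure \<nu> UNIV"
      by (rule \<nu>.emeasure_pair_measure_Times) (auto simp: bistochasticD(1)[OF \<mu>] bistochasticD(1)[OF \<nu>])
    then show ?thesis
      by (simp add: space_pair_measure bistochasticD[OF \<mu>] bistochasticD[OF \<nu>])
  qed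
  finally have "?I < top" using INF_lower[OF prod, of ?cost] by (rule le_less_trans[rotated])
  then have I: "?I = ennreal (enn2real ?I)" by simp
  have "sqrt (enn2real ?I) < s" using less by (simp add: monge_kantorovich_def)
  then have "(sqrt (enn2real ?I))\<^sup>2 < s\<^sup>2" by (intro power_strict_mono) auto
  then have "enn2real ?I < s\<^sup>2" by simp
  then have "?I < ennreal (s\<^sup>2)" by (subst I) (simp add: ennreal_less_iff)
  then obtain \<pi> where "\<pi> \<in> couplings \<mu> \<nu>" "?cost \<pi> < ennreal (s\<^sup>2)"
    unfolding INF_less_iff by blast
  then show ?thesis by (intro that[of \<pi>]) (auto intro: less_imp_le)
qed

section \<open>The Hoelder estimate\<close>

text \<open>For a small distance the perturbation lemma is applied with h just above the power of
  the distance; for a large one the uniform bound on the action is already below the error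
  term.\<close>

lemma minimal_action_holder:
  obtains M where "M > 0" "\<forall>\<mu> \<nu> :: ('d::finite torus \<times> 'd torus) measure.
    bistochastic \<mu> \<longrightarrow> bistochastic \<nu> \<longrightarrow> enn2real (minimal_action \<nu>)
      \<le> enn2real (minimal_action \<mu>) + M * monge_kantorovich \<mu> \<nu> powr (1 / (real CARD('d) + 3))"
proof -
  let ?d = "CARD('d)"
  define B where "B = 1 / 2 + 8 * (real ?d)\<^sup>2"
  define C where "C = 3 * (8 + 32 * (2 * real ?d) ^ ?d * (real ?d)\<^sup>2)"
  \<comment> \<open>For h \<le> 1/4, (1 + 4h)(a + h) + C h exceeds a by at most (4B + 1 + 1 + C) h
    when a \<le> B. For large distances L \<ge> 4B is what counts.\<close>
  define L where "L = 4 * B + 2 + C"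
  have pos: "B > 0" "C > 0" by (auto simp: B_def C_def intro!: add_pos_nonneg)
  then have L: "L > 0" by (simp add: L_def)
  let ?a = "\<lambda>\<gamma> :: ('d torus \<times> 'd torus) measure. enn2real (minimal_action \<gamma>)"
  have a: "minimal_action \<gamma> = ennreal (?a \<gamma>)" "?a \<gamma> \<le> B" if "bistochastic \<gamma>"
    for \<gamma> :: "('d torus \<times> 'd torus) measure"
  proof -
    have le: "minimal_action \<gamma> \<le> ennreal B" using minimal_action_bounded[OF that] by (simp add: B_def)
    then have "minimal_action \<gamma> < top" by (rule le_less_trans) simp
    then show "minimal_action \<gamma> = ennreal (?a \<gamma>)" by simp
    show "?a \<gamma> \<le> B" using enn2real_mono[OF le] pos(1) by simp
  qed
  have step: "?a \<nu> \<le> ?a \<mu> + L * h"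
    if \<mu>: "bistochastic \<mu>" and \<nu>: "bistochastic \<nu>" and h: "0 < h" "h \<le> 1 / 4"
      and W: "monge_kantorovich \<mu> \<nu> < h ^ (?d + 3)"
    for \<mu> \<nu> :: "('d torus \<times> 'd torus) measure" and h
  proof -
    obtain \<pi> where \<pi>: "\<pi> \<in> couplings \<mu> \<nu>"
      "(\<integral>\<^sup>+ z. ennreal ((dist (fst z) (snd z))\<^sup>2) \<partial>\<pi>) \<le> ennreal ((h ^ (?d + 3))\<^sup>2)"
      by (rule monge_kantorovich_less_imp_coupling[OF \<mu> \<nu> W])
    \<comment> \<open>An almost optimal flow; its excess h is absorbed by the error term.\<close>
    have "minimal_action \<mu> < ennreal (?a \<mu> + h)"
      using a(1)[OF \<mu>] h(1) by (metis enn2real_nonneg ennreal_less_iff less_add_same_cancel1)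
    then obtain \<eta> where \<eta>: "admissible \<mu> \<eta>" "flow_action \<eta> < ennreal (?a \<mu> + h)"
      unfolding minimal_action_def[of \<mu>] INF_less_iff by auto
    have h1: "0 \<le> 1 / (1 - h)\<^sup>2" by simp
    have "minimal_action \<nu> \<le> ennreal (1 / (1 - h)\<^sup>2) * flow_action \<eta> + ennreal (C * h)"
      unfolding C_def by (rule minimal_action_perturb[OF \<mu> \<nu> \<eta>(1) \<pi>(1) h \<pi>(2)])
    also have "\<dots> \<le> ennreal (1 / (1 - h)\<^sup>2) * ennreal (?a \<mu> + h) + ennreal (C * h)"
      using \<eta>(2) by (intro add_right_mono mult_left_mono) auto
    also have "\<dots> = ennreal (1 / (1 - h)\<^sup>2 * (?a \<mu> + h) + C * h)"
      using h pos(2) by (subst ennreal_mult[symmetric], simp, simp, subst ennreal_plus) auto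
    finally have "ennreal (?a \<nu>) \<le> ennreal (1 / (1 - h)\<^sup>2 * (?a \<mu> + h) + C * h)"
      using a(1)[OF \<nu>] by simp
    then have "?a \<nu> \<le> 1 / (1 - h)\<^sup>2 * (?a \<mu> + h) + C * h"
      using h pos(2) by (subst (asm) ennreal_le_iff) auto
    also have "\<dots> \<le> (1 + 4 * h) * (?a \<mu> + h) + C * h"
    proof (intro add_right_mono mult_right_mono)
      \<comment> \<open>Indeed (1 + 4h)(1 - h)^2 - 1 = h (2 - 7h + 4h^2), and 7h \<le> 2.\<close>
      have "h * (7 * h) \<le> h * 2" using h by (intro mult_left_mono) auto
      then have "0 \<le> h * (2 - 7 * h + 4 * h\<^sup>2)" using h by (intro mult_nonneg_nonneg) auto
      then have "1 \<le> (1 + 4 * h) * (1 - h)\<^sup>2"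
        by (simp add: power2_eq_square algebra_simps)
      moreover have "(1 - h)\<^sup>2 > 0" using h by simp
      ultimately show "1 / (1 - h)\<^sup>2 \<le> 1 + 4 * h" by (simp add: pos_divide_le_eq)
    qed (use h in auto)
    also have "\<dots> \<le> ?a \<mu> + L * h"
    proof -
      have "h * ?a \<mu> \<le> h * B" using a(2)[OF \<mu>] h by (intro mult_left_mono) auto
      moreover have "h * (4 * h) \<le> h * 1" using h by (intro mult_left_mono) auto
      ultimately show ?thesis by (simp add: L_def algebra_simps)
    qed
    finally show ?thesis .
  qed
  show ?thesis
  proof (rule that[of L])
    show "L > 0" by (rule L)
    show "\<forall>\<mu> \<nu> :: ('d torus \<times> 'd torus) measure. bistochastic \<mu> \<longrightarrow> bistochastic \<nu> \<longrightarrow>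
        ?a \<nu> \<le> ?a \<mu> + L * monge_kantorovich \<mu> \<nu> powr (1 / (real ?d + 3))"
    proof (intro allI impI)
      fix \<mu> \<nu> :: "('d torus \<times> 'd torus) measure"
      assume \<mu>: "bistochastic \<mu>" and \<nu>: "bistochastic \<nu>"
      define W where "W = monge_kantorovich \<mu> \<nu>"
      have W: "W \<ge> 0" by (simp add: W_def monge_kantorovich_def)
      define w where "w = W powr (1 / (real ?d + 3))"
      have w: "w \<ge> 0" by (simp add: w_def)
      have Ww: "W = w ^ (?d + 3)"
      proof (cases "W = 0")
        case False
        then have "w powr real (?d + 3) = W"
          using W by (simp add: w_def powr_powr)
        then show ?thesis using False by (subst (asm) powr_realpow) (auto simp: w_def)
      qed (simp add: w_def)
      show "?a \<nu> \<le> ?a \<mu> + L * monge_kantorovich \<mu> \<nu> powr (1 / (real ?d + 3))"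
      proof (cases "w < 1 / 4")
        case True
        \<comment> \<open>The slack e makes h positive and strictly larger than w, even at distance
          0; it tends to 0 in the end.\<close>
        have "?a \<nu> \<le> ?a \<mu> + L * w + e" if e: "e > 0" for e
        proof -
          define h where "h = min (1 / 4) (w + e / L)"
          have h: "w < h" "h \<le> 1 / 4" "h \<le> w + e / L" using True e L by (auto simp: h_def min_def)
          then have "W < h ^ (?d + 3)" unfolding Ww using w by (intro power_strict_mono) auto
          then have "?a \<nu> \<le> ?a \<mu> + L * h" using h w by (intro step \<mu> \<nu>) (auto simp: W_def)
          also have "L * h \<le> L * (w + e / L)" using h(3) L by (intro mult_left_mono) auto
          also have "\<dots> = L * w + e" using L by (simp add: distrib_left)
          finally show ?thesis by simp
        qed
        then have "?a \<nu> \<le> ?a \<mu> + L * w" by (rule field_le_epsilon)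
        then show ?thesis by (simp add: w_def W_def)
      next
        case False
        \<comment> \<open>Here L w is at least L/4, hence at least the uniform bound B.\<close>
        then have "?a \<nu> \<le> B" "L * (1 / 4) \<le> L * w" "0 \<le> ?a \<mu>"
          using a(2)[OF \<nu>] L by (auto intro: mult_left_mono)
        moreover have "B \<le> L * (1 / 4)" using pos by (simp add: L_def)
        ultimately have "?a \<nu> \<le> ?a \<mu> + L * w" by linarith
        then show ?thesis by (simp add: w_def W_def)
      qed
    qed
  qed
qed

theorem theorem1:
  shows "(\<exists>M>0. \<forall>\<mu> \<nu> :: ('d::finite torus \<times> 'd torus) measure.
            bistochastic \<mu> \<longrightarrow> bistochastic \<nu> \<longrightarrow>
            minimal_action \<nu> \<le> minimal_action \<mu> +
              ennreal (M * monge_kantorovich \<mu> \<nu> powr (1 / (real CARD('d) + 3)))) \<and>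
         (\<forall>\<gamma> :: ('d torus \<times> 'd torus) measure. bistochastic \<gamma> \<longrightarrow> minimal_action \<gamma> < \<infinity>) \<and>
         holder_continuous_wrt monge_kantorovich (1 / (real CARD('d) + 3))
           {\<gamma> :: ('d torus \<times> 'd torus) measure. bistochastic \<gamma>}
           (\<lambda>\<gamma>. enn2real (minimal_action \<gamma>)) \<and>
         (CARD('d) = 3 \<longrightarrow>
            holder_continuous_wrt monge_kantorovich (1 / 6)
              {\<gamma> :: ('d torus \<times> 'd torus) measure. bistochastic \<gamma>}
              (\<lambda>\<gamma>. enn2real (minimal_action \<gamma>)))"
proof -
  let ?e = "1 / (real CARD('d) + 3)"
  let ?a = "\<lambda>\<gamma> :: ('d torus \<times> 'd torus) measure. enn2real (minimal_action \<gamma>)"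
  obtain M where M: "M > 0" and le: "\<forall>\<mu> \<nu> :: ('d torus \<times> 'd torus) measure.
      bistochastic \<mu> \<longrightarrow> bistochastic \<nu> \<longrightarrow> ?a \<nu> \<le> ?a \<mu> + M * monge_kantorovich \<mu> \<nu> powr ?e"
    by (rule minimal_action_holder)
  have fin: "minimal_action \<gamma> < \<infinity>" if "bistochastic \<gamma>" for \<gamma> :: "('d torus \<times> 'd torus) measure"
    using minimal_action_bounded[OF that] by (rule le_less_trans) (simp only: infinity_ennreal_def ennreal_less_top)
  have real: "minimal_action \<gamma> = ennreal (?a \<gamma>)" if "bistochastic \<gamma>" for \<gamma> :: "('d torus \<times> 'd torus) measure"
    using fin[OF that] by simp
  have "minimal_action \<nu> \<le> minimal_action \<mu> + ennreal (M * monge_kantorovich \<mu> \<nu> powr ?e)"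
    if "bistochastic \<mu>" "bistochastic \<nu>" for \<mu> \<nu> :: "('d torus \<times> 'd torus) measure"
  proof -
    have "ennreal (?a \<nu>) \<le> ennreal (?a \<mu> + M * monge_kantorovich \<mu> \<nu> powr ?e)"
      using le that by (intro ennreal_leI) blast
    also have "\<dots> = ennreal (?a \<mu>) + ennreal (M * monge_kantorovich \<mu> \<nu> powr ?e)"
      using M by (intro ennreal_plus) auto
    finally show ?thesis using real[OF that(1)] real[OF that(2)] by simp
  qed
  moreover have "holder_continuous_wrt monge_kantorovich ?e {\<gamma>. bistochastic \<gamma>} ?a"
    unfolding holder_continuous_wrt_def
  proof (intro exI[of _ M] conjI ballI)
    fix \<mu> \<nu> :: "('d torus \<times> 'd torus) measure"
    assume "\<mu> \<in> {\<gamma>. bistochastic \<gamma>}" "\<nu> \<in> {\<gamma>. bistochastic \<gamma>}"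
    then have b: "bistochastic \<mu>" "bistochastic \<nu>" by auto
    have "?a \<mu> \<le> ?a \<nu> + M * monge_kantorovich \<mu> \<nu> powr ?e"
      unfolding monge_kantorovich_commute[of \<mu> \<nu>] using le b by blast
    moreover have "?a \<nu> \<le> ?a \<mu> + M * monge_kantorovich \<mu> \<nu> powr ?e"
      using le b by blast
    ultimately show "\<bar>?a \<mu> - ?a \<nu>\<bar> \<le> M * monge_kantorovich \<mu> \<nu> powr ?e" by linarith
  qed (use M in simp)
  ultimately show ?thesis using M fin by auto
qed

end
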